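(* Let $\varphi(w_1,w_2)$ be a symmetric measurable real kernel, centred in the independent-copy sense, with centred first-order projection $\varphi_i^{(1)}(W_i)$, and let $\sigma_n\ge0$ with $\sigma_n^2=\operatorname{Var}\big[n^{-1/2}\sum_{i=1}^n\varphi_i^{(1)}(W_i)\big]$. Suppose that $\{W_i\}$ is uniformly $L_2$-near-epoch dependent on an i.i.d. base sequence with constants $\nu_m\to0$; that the order-2 kernel perturbation condition holds (one of its branches (A), (B)), with associated rate $\rho_m$; that for some $r\ge2$ the uniform integrability condition $$\lim_{M\to\infty}\sup_{i,j}E\big[|\varphi(W_i,W_j)|^r1\{|\varphi(W_i,W_j)|>M\}\big]=0,\qquad \lim_{M\to\infty}\sup_{m\ge0}\sup_{i,j}E\big[|\varphi(W_i^{(m)},W_j^{(m)})|^r1\{|\varphi(W_i^{(m)},W_j^{(m)})|>M\}\big]=0\qquad(\ast)$$ holds; and that $\rho_m=O(m^{-\eta})$ for some $\eta>1$. Let $m_n$ be a sequence of non-negative integers with $m_n\to\infty$, $m_n=o(\sqrt n)$ and $\sqrt n\,\rho_{m_n}=o(1)$. Then, as $n\to\infty$: (a) $\displaystyle U_{n,2}=\frac2n\sum_{i=1}^n\varphi_i^{(1)}(W_i)+o_p(n^{-1/2})$; (b) $\displaystyle U_{n,2}=O_p(n^{-1/2})=o_p(1)$. (c) If, in addition, $(\ast)$ holds for some $r>2$ and $\sigma_n\ge\lambda>0$ for a constant $\lambda$ not depending on $n$, then $(2\sigma_n)^{-1}\sqrt n\,U_{n,2}\xrightarrow{d}\mathcal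 N(0,1)$.
   Context: $\|X\|_p=(E\|X\|^p)^{1/p}$ with Euclidean inner norm. The $W_i$ take values in a Euclidean space. $U_{n,2}=\frac1{n(n-1)}\sum_{i=1}^n\sum_{j\neq i}\varphi(W_i,W_j)$. Near-epoch dependence: there are an i.i.d. sequence $\{\mathcal E_t\}_{t\in\mathbb Z}$ and measurable maps $\Psi_i$ with $W_i=\Psi_i((\mathcal E_{i+t})_{t\in\mathbb Z})$. Put $\mathcal F_a^b=\sigma(\mathcal E_t:a\le t\le b)$ and, for $m\in\mathbb N_0=\{0,1,2,\dots\}$, $W_i^{(m)}=E[W_i\mid\mathcal F_{i-\lfloor m/2\rfloor}^{i+\lceil m/2\rceil}]$. Uniform $L_2$-near-epoch dependence with constants $\nu_m\to0$ means $\|W_i-W_i^{(m)}\|_2\le\nu_m$ for every $i\in\mathbb N$ and $m\in\mathbb N_0$. Independent copies: for each $j$ let $(W_j^*,W_j^{*(m)})$ be distributed as $(W_j,W_j^{(m)})$ and independent of $\{W_i\}$ and of the $W_i^{(m)}$. "Centred in the independent-copy sense" means $E[\varphi(W_i,W_j^* )]=0$ for all $i\ne j$. The first-order projection (for sample size $n$) is $\varphi_i^{(1)}(w)=\frac1{n-1}\sum_{j\in[n]\setminus\{i\}}E[\varphi(w,W_j^* )]$. Order-2 kernel perturbation condition. A held-fixed argument $Z$ (relative to $i\ne j$ and $m$) is any of $W_j$, $W_j^{(m)}$, or the independent copies $W_j^*$, $W_j^{*(m)}$. One of the following holds. (A) Expected-Hölder branch: there are $C<\infty$, $\alpha\in(0,1]$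 such that, uniformly over $i\ne j$, $m\in\mathbb N_0$ and held-fixed $Z$, $\|\varphi(W_i,Z)-\varphi(W_i^{(m)},Z)\|_2\le C\|W_i-W_i^{(m)}\|_2^\alpha$. In this case $\rho_m:=\nu_m^\alpha$. (B) Data-dependent modulus branch: there is a measurable $L(w,\tilde w,z)\in[0,\infty)$ such that, uniformly over the same $i,j,m,Z$, $|\varphi(W_i,Z)-\varphi(W_i^{(m)},Z)|\le L(W_i,W_i^{(m)},Z)\,\|W_i-W_i^{(m)}\|$; there is $\delta>0$ such that $E[L(W_i,W_i^{(m)},Z)1\{L(W_i,W_i^{(m)},Z)>M\}]=O(M^{-\delta})$ as $M\to\infty$, uniformly over the same choices; and for some $r>2$, $\sup_{i\ne j,\,m}\big\|\max\{|\varphi(W_i,W_j)|,|\varphi(W_i^{(m)},W_j)|,|\varphi(W_i^{(m)},W_j^{(m)})|\}\big\|_r<\infty$, with the same moment bound when the second arguments $W_j,W_j^{(m)}$ are replaced by the independent copies $W_j^*,W_j^{*(m)}$. In this case, with these $\delta,r$, $\tau:=(1+\delta)(r-2)/(2r)$, $\beta:=\tau/(1+\tau)$ and $\rho_m:=\nu_m^\beta$. *)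

theory Defs
  imports "HOL-Probability.Probability" "HOL-Library.Landau_Symbols"
begin

(* Extended-valued, so that an infinite moment is not read as 0. *)
definition Lp_norm :: "'a measure \<Rightarrow> real \<Rightarrow> ('a \<Rightarrow> 'b::euclidean_space) \<Rightarrow> ennreal" where
  "Lp_norm M p X =
    (let I = (\<integral>\<^sup>+ \<omega>. ennreal (norm (X \<omega>) powr p) \<partial>M)
     in if I = \<top> then \<top> else ennreal (enn2real I powr (1 / p)))"

(* The library's conditional expectation is real-valued; here it is taken coordinatewise. *)
definition vec_cond_exp ::
    "'a measure \<Rightarrow> 'a measure \<Rightarrow> ('a \<Rightarrow> 'b::euclidean_space) \<Rightarrow> 'a \<Rightarrow> 'b" where
  "vec_cond_exp M F X = (\<lambda>\<omega>. \<Sum>b\<in>Basis. real_cond_exp M F (\<lambda>\<omega>'. X \<omega>' \<bullet> b) \<omega> *\<^sub>R b)"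

definition op_little :: "'a measure \<Rightarrow> (nat \<Rightarrow> 'a \<Rightarrow> real) \<Rightarrow> (nat \<Rightarrow> real) \<Rightarrow> bool" where
  "op_little M X a \<longleftrightarrow>
    (\<forall>\<epsilon>>0. (\<lambda>n. measure M {\<omega>\<in>space M. \<bar>X n \<omega>\<bar> > \<epsilon> * a n}) \<longlonglongrightarrow> 0)"

definition op_big :: "'a measure \<Rightarrow> (nat \<Rightarrow> 'a \<Rightarrow> real) \<Rightarrow> (nat \<Rightarrow> real) \<Rightarrow> bool" where
  "op_big M X a \<longleftrightarrow>
    (\<forall>\<epsilon>>0. \<exists>K. \<forall>\<^sub>F n in sequentially. measure M {\<omega>\<in>space M. \<bar>X n \<omega>\<bar> > K * a n} \<le> \<epsilon>)"

definition iid_base :: "'a measure \<Rightarrow> 'e measure \<Rightarrow> (int \<Rightarrow> 'a \<Rightarrow> 'e) \<Rightarrow> bool" where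
  "iid_base M N \<E> \<longleftrightarrow>
    prob_space.indep_vars M (\<lambda>_. N) \<E> UNIV \<and> (\<forall>s t. distr M N (\<E> s) = distr M N (\<E> t))"

definition base_sigma ::
    "'a measure \<Rightarrow> 'e measure \<Rightarrow> (int \<Rightarrow> 'a \<Rightarrow> 'e) \<Rightarrow> int \<Rightarrow> int \<Rightarrow> 'a measure" where
  "base_sigma M N \<E> a b =
    sigma (space M) (\<Union>t\<in>{a..b}. {\<E> t -` A \<inter> space M |A. A \<in> sets N})"

(* floor (m/2) = m div 2 and ceiling (m/2) = (m + 1) div 2 *)
definition ned_approx ::
    "'a measure \<Rightarrow> 'e measure \<Rightarrow> (int \<Rightarrow> 'a \<Rightarrow> 'e) \<Rightarrow> (nat \<Rightarrow> 'a \<Rightarrow> 'w::euclidean_space)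
      \<Rightarrow> nat \<Rightarrow> nat \<Rightarrow> 'a \<Rightarrow> 'w" where
  "ned_approx M N \<E> W i m =
    vec_cond_exp M
      (base_sigma M N \<E> (int i - int (m div 2)) (int i + int ((m + 1) div 2))) (W i)"

(* Time indices i, j start at 1 throughout. Integrability of W i is what makes the
   conditional expectations in ned_approx meaningful. *)
definition uniformly_L2_NED ::
    "'a measure \<Rightarrow> 'e measure \<Rightarrow> (int \<Rightarrow> 'a \<Rightarrow> 'e) \<Rightarrow> (nat \<Rightarrow> 'a \<Rightarrow> 'w::euclidean_space)
      \<Rightarrow> (nat \<Rightarrow> real) \<Rightarrow> bool" where
  "uniformly_L2_NED M N \<E> W \<nu> \<longleftrightarrow>
    (\<exists>\<Psi>. \<forall>i\<ge>1. \<Psi> i \<in> measurable (PiM UNIV (\<lambda>_. N)) borel \<and>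
        (\<forall>\<omega>\<in>space M. W i \<omega> = \<Psi> i (\<lambda>t::int. \<E> (int i + t) \<omega>))) \<and>
    (\<forall>i\<ge>1. integrable M (W i)) \<and>
    (\<forall>m. 0 \<le> \<nu> m) \<and> \<nu> \<longlonglongrightarrow> 0 \<and>
    (\<forall>i\<ge>1. \<forall>m. Lp_norm M 2 (\<lambda>\<omega>. W i \<omega> - ned_approx M N \<E> W i m \<omega>) \<le> ennreal (\<nu> m))"

(* In the following, Wm i m stands for the m-window approximation of W i,
   Ws j for the independent copy of W j, and Wsm j m for that of Wm j m. *)

(* The independence clause also makes Ws j and Wsm j m measurable. The second system of
   events is the sigma-algebra generated jointly by all W i and all Wm i m. *)
definition independent_copies ::
    "'a measure \<Rightarrow> (nat \<Rightarrow> 'a \<Rightarrow> 'w::euclidean_space) \<Rightarrow> (nat \<Rightarrow> nat \<Rightarrow> 'a \<Rightarrow> 'w)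
      \<Rightarrow> (nat \<Rightarrow> 'a \<Rightarrow> 'w) \<Rightarrow> (nat \<Rightarrow> nat \<Rightarrow> 'a \<Rightarrow> 'w) \<Rightarrow> bool" where
  "independent_copies M W Wm Ws Wsm \<longleftrightarrow>
    (\<forall>j\<ge>1. \<forall>m.
      distr M borel (\<lambda>\<omega>. (Ws j \<omega>, Wsm j m \<omega>)) = distr M borel (\<lambda>\<omega>. (W j \<omega>, Wm j m \<omega>)) \<and>
      prob_space.indep_set M
        {(\<lambda>\<omega>. (Ws j \<omega>, Wsm j m \<omega>)) -` A \<inter> space M |A. A \<in> sets borel}
        {(\<lambda>\<omega>. (\<lambda>i\<in>{1..}. W i \<omega>, \<lambda>p\<in>{1..} \<times> UNIV. Wm (fst p) (snd p) \<omega>)) -` B \<inter> space M |B.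
          B \<in> sets (PiM {1..} (\<lambda>_. borel) \<Otimes>\<^sub>M PiM ({1..} \<times> UNIV) (\<lambda>_. borel))})"

definition centred_indep_copy ::
    "'a measure \<Rightarrow> ('w \<Rightarrow> 'w \<Rightarrow> real) \<Rightarrow> (nat \<Rightarrow> 'a \<Rightarrow> 'w) \<Rightarrow> (nat \<Rightarrow> 'a \<Rightarrow> 'w) \<Rightarrow> bool" where
  "centred_indep_copy M \<phi> W Ws \<longleftrightarrow>
    (\<forall>i\<ge>1. \<forall>j\<ge>1. i \<noteq> j \<longrightarrow>
      integrable M (\<lambda>\<omega>. \<phi> (W i \<omega>) (Ws j \<omega>)) \<and> (\<integral>\<omega>. \<phi> (W i \<omega>) (Ws j \<omega>) \<partial>M) = 0)"

definition first_proj ::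
    "'a measure \<Rightarrow> ('w \<Rightarrow> 'w \<Rightarrow> real) \<Rightarrow> (nat \<Rightarrow> 'a \<Rightarrow> 'w) \<Rightarrow> nat \<Rightarrow> nat \<Rightarrow> 'w \<Rightarrow> real" where
  "first_proj M \<phi> Ws n i w =
    1 / (real n - 1) * (\<Sum>j\<in>{1..n} - {i}. \<integral>\<omega>. \<phi> w (Ws j \<omega>) \<partial>M)"

definition U_stat ::
    "('w \<Rightarrow> 'w \<Rightarrow> real) \<Rightarrow> (nat \<Rightarrow> 'a \<Rightarrow> 'w) \<Rightarrow> nat \<Rightarrow> 'a \<Rightarrow> real" where
  "U_stat \<phi> W n \<omega> =
    1 / (real n * (real n - 1)) * (\<Sum>i\<in>{1..n}. \<Sum>j\<in>{1..n} - {i}. \<phi> (W i \<omega>) (W j \<omega>))"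

definition held_fixed ::
    "(nat \<Rightarrow> 'a \<Rightarrow> 'w) \<Rightarrow> (nat \<Rightarrow> nat \<Rightarrow> 'a \<Rightarrow> 'w) \<Rightarrow> (nat \<Rightarrow> 'a \<Rightarrow> 'w) \<Rightarrow> (nat \<Rightarrow> nat \<Rightarrow> 'a \<Rightarrow> 'w)
      \<Rightarrow> nat \<Rightarrow> nat \<Rightarrow> ('a \<Rightarrow> 'w) set" where
  "held_fixed W Wm Ws Wsm j m = {W j, Wm j m, Ws j, Wsm j m}"

definition expected_Hoelder ::
    "'a measure \<Rightarrow> ('w \<Rightarrow> 'w \<Rightarrow> real) \<Rightarrow> (nat \<Rightarrow> 'a \<Rightarrow> 'w::euclidean_space)
      \<Rightarrow> (nat \<Rightarrow> nat \<Rightarrow> 'a \<Rightarrow> 'w) \<Rightarrow> (nat \<Rightarrow> 'a \<Rightarrow> 'w) \<Rightarrow> (nat \<Rightarrow> nat \<Rightarrow> 'a \<Rightarrow> 'w) \<Rightarrow> real \<Rightarrow> bool" where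
  "expected_Hoelder M \<phi> W Wm Ws Wsm \<alpha> \<longleftrightarrow>
    0 < \<alpha> \<and> \<alpha> \<le> 1 \<and>
    (\<exists>C\<ge>0. \<forall>i\<ge>1. \<forall>j\<ge>1. \<forall>m. \<forall>Z\<in>held_fixed W Wm Ws Wsm j m. i \<noteq> j \<longrightarrow>
      Lp_norm M 2 (\<lambda>\<omega>. \<phi> (W i \<omega>) (Z \<omega>) - \<phi> (Wm i m \<omega>) (Z \<omega>))
        \<le> ennreal (C * enn2real (Lp_norm M 2 (\<lambda>\<omega>. W i \<omega> - Wm i m \<omega>)) powr \<alpha>))"

definition data_dependent_modulus ::
    "'a measure \<Rightarrow> ('w \<Rightarrow> 'w \<Rightarrow> real) \<Rightarrow> (nat \<Rightarrow> 'a \<Rightarrow> 'w::euclidean_space)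
      \<Rightarrow> (nat \<Rightarrow> nat \<Rightarrow> 'a \<Rightarrow> 'w) \<Rightarrow> (nat \<Rightarrow> 'a \<Rightarrow> 'w) \<Rightarrow> (nat \<Rightarrow> nat \<Rightarrow> 'a \<Rightarrow> 'w)
      \<Rightarrow> real \<Rightarrow> real \<Rightarrow> bool" where
  "data_dependent_modulus M \<phi> W Wm Ws Wsm \<delta> r \<longleftrightarrow>
    0 < \<delta> \<and> 2 < r \<and>
    (\<exists>L :: 'w \<Rightarrow> 'w \<Rightarrow> 'w \<Rightarrow> real.
      (\<lambda>(w, w', z). L w w' z) \<in> borel_measurable borel \<and>
      (\<forall>w w' z. 0 \<le> L w w' z) \<and>
      (\<forall>i\<ge>1. \<forall>j\<ge>1. \<forall>m. \<forall>Z\<in>held_fixed W Wm Ws Wsm j m. i \<noteq> j \<longrightarrow>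
        (AE \<omega> in M. \<bar>\<phi> (W i \<omega>) (Z \<omega>) - \<phi> (Wm i m \<omega>) (Z \<omega>)\<bar>
            \<le> L (W i \<omega>) (Wm i m \<omega>) (Z \<omega>) * norm (W i \<omega> - Wm i m \<omega>))) \<and>
      (\<exists>K B. \<forall>b\<ge>B. \<forall>i\<ge>1. \<forall>j\<ge>1. \<forall>m. \<forall>Z\<in>held_fixed W Wm Ws Wsm j m. i \<noteq> j \<longrightarrow>
        (\<integral>\<^sup>+ \<omega>. ennreal (L (W i \<omega>) (Wm i m \<omega>) (Z \<omega>)
            * (if L (W i \<omega>) (Wm i m \<omega>) (Z \<omega>) > b then 1 else 0)) \<partial>M)
          \<le> ennreal (K * b powr (- \<delta>)))) \<and>
    (SUP (i, j, m)\<in>{(i, j, m). 1 \<le> i \<and> 1 \<le> j \<and> i \<noteq> j}.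
      Lp_norm M r (\<lambda>\<omega>. Max {\<bar>\<phi> (W i \<omega>) (W j \<omega>)\<bar>, \<bar>\<phi> (Wm i m \<omega>) (W j \<omega>)\<bar>,
        \<bar>\<phi> (Wm i m \<omega>) (Wm j m \<omega>)\<bar>})) < \<top> \<and>
    (SUP (i, j, m)\<in>{(i, j, m). 1 \<le> i \<and> 1 \<le> j \<and> i \<noteq> j}.
      Lp_norm M r (\<lambda>\<omega>. Max {\<bar>\<phi> (W i \<omega>) (Ws j \<omega>)\<bar>, \<bar>\<phi> (Wm i m \<omega>) (Ws j \<omega>)\<bar>,
        \<bar>\<phi> (Wm i m \<omega>) (Wsm j m \<omega>)\<bar>})) < \<top>"

definition modulus_exponent :: "real \<Rightarrow> real \<Rightarrow> real" where
  "modulus_exponent \<delta> r = (let \<tau> = (1 + \<delta>) * (r - 2) / (2 * r) in \<tau> / (1 + \<tau>))"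

definition kernel_perturbation ::
    "'a measure \<Rightarrow> ('w \<Rightarrow> 'w \<Rightarrow> real) \<Rightarrow> (nat \<Rightarrow> 'a \<Rightarrow> 'w::euclidean_space)
      \<Rightarrow> (nat \<Rightarrow> nat \<Rightarrow> 'a \<Rightarrow> 'w) \<Rightarrow> (nat \<Rightarrow> 'a \<Rightarrow> 'w) \<Rightarrow> (nat \<Rightarrow> nat \<Rightarrow> 'a \<Rightarrow> 'w)
      \<Rightarrow> (nat \<Rightarrow> real) \<Rightarrow> (nat \<Rightarrow> real) \<Rightarrow> bool" where
  "kernel_perturbation M \<phi> W Wm Ws Wsm \<nu> \<rho> \<longleftrightarrow>
    (\<exists>\<alpha>. expected_Hoelder M \<phi> W Wm Ws Wsm \<alpha> \<and> (\<forall>m. \<rho> m = \<nu> m powr \<alpha>)) \<or>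
    (\<exists>\<delta> r. data_dependent_modulus M \<phi> W Wm Ws Wsm \<delta> r \<and>
      (\<forall>m. \<rho> m = \<nu> m powr modulus_exponent \<delta> r))"

definition kernel_unif_integrable ::
    "'a measure \<Rightarrow> ('w \<Rightarrow> 'w \<Rightarrow> real) \<Rightarrow> (nat \<Rightarrow> 'a \<Rightarrow> 'w) \<Rightarrow> (nat \<Rightarrow> nat \<Rightarrow> 'a \<Rightarrow> 'w)
      \<Rightarrow> real \<Rightarrow> bool" where
  "kernel_unif_integrable M \<phi> W Wm r \<longleftrightarrow>
    ((\<lambda>b::real. SUP (i, j)\<in>{1..} \<times> {1..}.
        \<integral>\<^sup>+ \<omega>. ennreal (\<bar>\<phi> (W i \<omega>) (W j \<omega>)\<bar> powr r
          * (if \<bar>\<phi> (W i \<omega>) (W j \<omega>)\<bar> > b then 1 else 0)) \<partial>M) \<longlongrightarrow> 0) at_top \<and>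
    ((\<lambda>b::real. SUP m. SUP (i, j)\<in>{1..} \<times> {1..}.
        \<integral>\<^sup>+ \<omega>. ennreal (\<bar>\<phi> (Wm i m \<omega>) (Wm j m \<omega>)\<bar> powr r
          * (if \<bar>\<phi> (Wm i m \<omega>) (Wm j m \<omega>)\<bar> > b then 1 else 0)) \<partial>M) \<longlongrightarrow> 0) at_top"

end

theory Submission
  imports Defs "HOL-Real_Asymp.Real_Asymp"
begin

text \<open>Independent copies are realised as the second coordinate of \<open>M \<Otimes>\<^sub>M M\<close>. Both branches of
  the perturbation condition give an \<open>L\<^sub>2\<close> error of order \<open>\<rho> k\<close> when the \<open>W i\<close> are replaced
  by their window approximations \<open>V i k\<close>; those are independent at lag larger than \<open>k\<close>.

  Subtracting projections from the kernel at window length \<open>m n\<close> leaves a completely degenerate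
  kernel. The covariance of its values at two far pairs vanishes as soon as one index is far from
  the three others, so the double sum has standard deviation of order \<open>n m\<close>, which is \<open>o(n\<^sup>3\<^sup>/\<^sup>2)\<close>;
  the near pairs and the replacement errors are negligible as well. The projections have
  covariances summable in the lag, since \<open>\<rho>\<close> is, hence a sum of variance \<open>O(n)\<close>.

  For the central limit theorem the kernel is truncated and the window length \<open>K\<close> is kept fixed.
  This gives bounded \<open>K\<close>-dependent summands, for which the characteristic function of the sum
  nearly solves the Gaussian differential equation. The remainder has variance \<open>n\<close> times a
  quantity that tends to \<open>0\<close> as \<open>K\<close> grows.\<close>

section \<open>Square-integrable bounds and decoupling\<close>

text \<open>The two growth conditions on the window come from one bound: after division by n (n - 1)
  the degenerate sum and the near pairs cost a multiple of m / n, and replacing \<open>W\<close> by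
  \<open>V\<close> costs a multiple of \<open>\<rho> m\<close>. Both must vanish after
  multiplication by sqrt n.

  A growing window would not do for the central limit theorem. The error of the characteristic
  function is of order n T^3 K^2 |s|^3 for summands bounded by T, while uniform integrability gives
  no rate for the truncation level T. Hence K is fixed first, then T, and n grows last. The
  discarded remainder must then be small uniformly in n. It is a sum of terms of size
  \<open>c K\<close> that can be approximated at lag k with error \<open>c k\<close>, where
  \<open>c\<close> is a summable majorant of the perturbation errors, so its variance per index is
  of order \<open>c K * (K * c K + c_sum)\<close>. This tends to 0 because \<open>K * c K\<close>
  stays bounded.

  The variances \<open>\<sigma> n\<close> need not converge. Each sum is therefore compared with the
  Gaussian law of its own variance, and the limit is taken only after normalisation.\<close>

abbreviation "borel2 \<equiv> borel \<Otimes>\<^sub>M borel"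

text \<open>The integral is extended-valued, so an infinite second moment is not read as 0, and
  measurability is part of the notion. The bound is on the norm and not on its square, so that
  bounds simply add under sums.\<close>

definition L2_le :: "'a measure \<Rightarrow> ('a \<Rightarrow> real) \<Rightarrow> real \<Rightarrow> bool" where
  "L2_le P X c \<longleftrightarrow>
    0 \<le> c \<and> X \<in> borel_measurable P \<and> (\<integral>\<^sup>+ w. ennreal ((X w)\<^sup>2) \<partial>P) \<le> ennreal (c\<^sup>2)"

lemma L2_leD [dest]:
  assumes "L2_le P X c"
  shows "0 \<le> c" "X \<in> borel_measurable P"
  using assms by (auto simp: L2_le_def)

lemma L2_le_square:
  assumes "L2_le P X c"
  shows "integrable P (\<lambda>w. (X w)\<^sup>2)" "(\<integral>w. (X w)\<^sup>2 \<partial>P) \<le> c\<^sup>2"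
proof -
  have [measurable]: "X \<in> borel_measurable P" using assms by auto
  have le: "(\<integral>\<^sup>+ w. ennreal ((X w)\<^sup>2) \<partial>P) \<le> ennreal (c\<^sup>2)"
    using assms by (simp add: L2_le_def)
  show int: "integrable P (\<lambda>w. (X w)\<^sup>2)"
    using le by (intro integrableI_nonneg) (auto intro: le_less_trans)
  have "ennreal (\<integral>w. (X w)\<^sup>2 \<partial>P) \<le> ennreal (c\<^sup>2)"
    using le nn_integral_eq_integral[OF int] by simp
  then show "(\<integral>w. (X w)\<^sup>2 \<partial>P) \<le> c\<^sup>2" by (simp add: ennreal_le_iff)
qed

lemma L2_leI:
  assumes "X \<in> borel_measurable P" "integrable P (\<lambda>w. (X w)\<^sup>2)"
    "(\<integral>w. (X w)\<^sup>2 \<partial>P) \<le> c\<^sup>2" "0 \<le> c"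
  shows "L2_le P X c"
  using assms nn_integral_eq_integral[OF assms(2)] by (auto simp: L2_le_def ennreal_le_iff)

lemma L2_le_mono:
  assumes "L2_le P X c" "Y \<in> borel_measurable P" "AE w in P. \<bar>Y w\<bar> \<le> \<bar>X w\<bar>" "c \<le> d"
  shows "L2_le P Y d"
proof -
  have "(\<integral>\<^sup>+ w. ennreal ((Y w)\<^sup>2) \<partial>P) \<le> (\<integral>\<^sup>+ w. ennreal ((X w)\<^sup>2) \<partial>P)"
    using assms(3) by (intro nn_integral_mono_AE) (auto elim!: eventually_mono intro!: ennreal_leI simp: abs_le_square_iff)
  also have "\<dots> \<le> ennreal (c\<^sup>2)" using assms(1) by (simp add: L2_le_def)
  also have "\<dots> \<le> ennreal (d\<^sup>2)"
    using assms(1,4) by (intro ennreal_leI power_mono) auto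
  finally show ?thesis using assms by (auto simp: L2_le_def)
qed

lemma L2_le_weaken: "L2_le P X c \<Longrightarrow> c \<le> d \<Longrightarrow> L2_le P X d"
  by (rule L2_le_mono) auto

lemma L2_le_mult:
  assumes "L2_le P X a" "L2_le P Y b"
  shows "integrable P (\<lambda>w. X w * Y w)" "(\<integral>w. \<bar>X w * Y w\<bar> \<partial>P) \<le> a * b"
    "\<bar>\<integral>w. X w * Y w \<partial>P\<bar> \<le> a * b"
proof -
  have [measurable]: "X \<in> borel_measurable P" "Y \<in> borel_measurable P" and ab: "0 \<le> a" "0 \<le> b"
    using assms by auto
  let ?I = "\<integral>\<^sup>+ w. ennreal \<bar>X w\<bar> * ennreal \<bar>Y w\<bar> \<partial>P"
  have "?I\<^sup>2 \<le> (\<integral>\<^sup>+ w. (ennreal \<bar>X w\<bar>)\<^sup>2 \<partial>P) * (\<integral>\<^sup>+ w. (ennreal \<bar>Y w\<bar>)\<^sup>2 \<partial>P)"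
    by (rule Cauchy_Schwarz_nn_integral) auto
  also have "\<dots> = (\<integral>\<^sup>+ w. ennreal ((X w)\<^sup>2) \<partial>P) * (\<integral>\<^sup>+ w. ennreal ((Y w)\<^sup>2) \<partial>P)"
    by (simp add: ennreal_power)
  also have "\<dots> \<le> ennreal (a\<^sup>2) * ennreal (b\<^sup>2)"
    using assms by (intro mult_mono) (auto simp: L2_le_def)
  also have "\<dots> = (ennreal (a * b))\<^sup>2"
    using ab by (simp add: ennreal_power ennreal_mult'' power_mult_distrib)
  finally have sq: "?I\<^sup>2 \<le> (ennreal (a * b))\<^sup>2" .
  \<comment> \<open>Square roots are taken in the extended reals: an infinite value of the integral
    would have an infinite square, against \<open>sq\<close>.\<close>
  have I: "?I \<le> ennreal (a * b)"
  proof (cases ?I)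
    case (real x)
    with sq ab show ?thesis
      by (simp add: ennreal_power ennreal_le_iff)
  next
    case top
    moreover have "(ennreal (a * b))\<^sup>2 = ennreal ((a * b)\<^sup>2)"
      using ab by (intro ennreal_power) auto
    ultimately show ?thesis using sq by (simp add: top_unique)
  qed
  then have I': "(\<integral>\<^sup>+ w. ennreal \<bar>X w * Y w\<bar> \<partial>P) \<le> ennreal (a * b)"
    by (simp add: abs_mult ennreal_mult)
  show int: "integrable P (\<lambda>w. X w * Y w)"
    using I' by (intro integrableI_bounded) (auto intro: le_less_trans)
  show *: "(\<integral>w. \<bar>X w * Y w\<bar> \<partial>P) \<le> a * b"
    using I' nn_integral_eq_integral[OF integrable_abs[OF int]] ab by (simp add: ennreal_le_iff)
  show "\<bar>\<integral>w. X w * Y w \<partial>P\<bar> \<le> a * b"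
    using integral_abs_bound[of P "\<lambda>w. X w * Y w"] * by linarith
qed

text \<open>Minkowski's inequality: expand the square and bound the cross term by
  Cauchy-Schwarz.\<close>

lemma L2_le_add:
  assumes "L2_le P X a" "L2_le P Y b"
  shows "L2_le P (\<lambda>w. X w + Y w) (a + b)"
proof (rule L2_leI)
  note X = L2_le_square[OF assms(1)] and Y = L2_le_square[OF assms(2)]
    and XY = L2_le_mult[OF assms]
  have eq: "(\<lambda>w. (X w + Y w)\<^sup>2) = (\<lambda>w. (X w)\<^sup>2 + (Y w)\<^sup>2 + 2 * (X w * Y w))"
    by (auto simp: power2_sum)
  show "integrable P (\<lambda>w. (X w + Y w)\<^sup>2)" unfolding eq using X Y XY by auto
  have "(\<integral>w. (X w + Y w)\<^sup>2 \<partial>P) = (\<integral>w. (X w)\<^sup>2 \<partial>P) + (\<integral>w. (Y w)\<^sup>2 \<partial>P) + 2 * (\<integral>w. X w * Y w \<partial>P)"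
    unfolding eq using X Y XY by (simp del: mult_numeral_left)
  also have "\<dots> \<le> a\<^sup>2 + b\<^sup>2 + 2 * (a * b)" using X Y XY by (auto simp: abs_le_iff)
  finally show "(\<integral>w. (X w + Y w)\<^sup>2 \<partial>P) \<le> (a + b)\<^sup>2" by (simp add: power2_sum)
  show "(\<lambda>w. X w + Y w) \<in> borel_measurable P" "0 \<le> a + b"
    using assms by (auto simp: L2_le_def)
qed

lemma L2_le_cmult:
  assumes "L2_le P X a"
  shows "L2_le P (\<lambda>w. k * X w) (\<bar>k\<bar> * a)"
proof (rule L2_leI)
  note X = L2_le_square[OF assms]
  show "integrable P (\<lambda>w. (k * X w)\<^sup>2)" using X by (auto simp: power_mult_distrib)
  show "(\<integral>w. (k * X w)\<^sup>2 \<partial>P) \<le> (\<bar>k\<bar> * a)\<^sup>2" using X by (auto simp: power_mult_distrib mult_left_mono)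
qed (use assms in auto)

lemma L2_le_uminus: "L2_le P X a \<Longrightarrow> L2_le P (\<lambda>w. - X w) a"
  using L2_le_cmult[of P X a "-1"] by simp

lemma L2_le_diff:
  "L2_le P X a \<Longrightarrow> L2_le P Y b \<Longrightarrow> L2_le P (\<lambda>w. X w - Y w) (a + b)"
  using L2_le_add[OF _ L2_le_uminus, of P X a Y b] by simp

lemma L2_le_zero [simp]: "0 \<le> c \<Longrightarrow> L2_le P (\<lambda>_. 0) c"
  by (simp add: L2_le_def)

lemma L2_le_sum:
  assumes "\<And>i. i \<in> I \<Longrightarrow> L2_le P (X i) (a i)"
  shows "L2_le P (\<lambda>w. \<Sum>i\<in>I. X i w) (\<Sum>i\<in>I. a i)"
  using assms by (induction I rule: infinite_finite_induct) (auto intro!: L2_le_add)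

lemma L2_le_distr:
  assumes [measurable]: "f \<in> measurable P Q" "F \<in> borel_measurable Q"
  shows "L2_le (distr P Q f) F c \<longleftrightarrow> L2_le P (\<lambda>w. F (f w)) c"
  by (simp add: L2_le_def nn_integral_distr)

context prob_space
begin

lemma L2_le_const: "\<bar>k\<bar> \<le> c \<Longrightarrow> L2_le M (\<lambda>_. k) c"
  by (auto simp: L2_le_def emeasure_space_1 abs_le_square_iff[symmetric] intro!: ennreal_leI)

lemma L2_le_bounded:
  assumes "X \<in> borel_measurable M" "\<And>w. w \<in> space M \<Longrightarrow> \<bar>X w\<bar> \<le> c" "0 \<le> c"
  shows "L2_le M X c"
  by (rule L2_le_mono[OF L2_le_const[of c c]]) (use assms in auto)

lemma L2_le_integrable:
  assumes "L2_le M X c"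
  shows "integrable M X" "(\<integral>w. \<bar>X w\<bar> \<partial>M) \<le> c" "\<bar>\<integral>w. X w \<partial>M\<bar> \<le> c"
  using L2_le_mult[OF assms L2_le_const[of 1 1]] by auto

lemma L2_le_centre:
  assumes "L2_le M X c"
  shows "L2_le M (\<lambda>w. X w - expectation X) (2 * c)"
  using L2_le_diff[OF assms L2_le_const[OF L2_le_integrable(3)[OF assms]]] by simp

lemma integral_square_le:
  assumes [measurable]: "f \<in> borel_measurable M"
  shows "ennreal ((\<integral>w. f w \<partial>M)\<^sup>2) \<le> (\<integral>\<^sup>+ w. ennreal ((f w)\<^sup>2) \<partial>M)"
proof (cases "(\<integral>\<^sup>+ w. ennreal ((f w)\<^sup>2) \<partial>M) = \<top>")
  case False
  define c where "c = enn2real (\<integral>\<^sup>+ w. ennreal ((f w)\<^sup>2) \<partial>M)"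
  have c: "(\<integral>\<^sup>+ w. ennreal ((f w)\<^sup>2) \<partial>M) = ennreal ((sqrt c)\<^sup>2)"
    using False by (auto simp: c_def less_top)
  then have "L2_le M f (sqrt c)" by (auto simp: L2_le_def c_def)
  from L2_le_integrable(3)[OF this] have "(\<integral>w. f w \<partial>M)\<^sup>2 \<le> (sqrt c)\<^sup>2"
    by (metis abs_ge_zero power2_abs power_mono)
  then show ?thesis unfolding c by (rule ennreal_leI)
qed simp

text \<open>Integrating out one of two independent variables is a contraction: Jensen's inequality
  in the second variable, then Tonelli. The bounds for the projections rest on this.\<close>

lemma L2_le_marginal:
  assumes "L2_le (N \<Otimes>\<^sub>M M) F c"
  shows "L2_le N (\<lambda>x. \<integral>y. F (x, y) \<partial>M) c"
proof -
  have [measurable]: "F \<in> borel_measurable (N \<Otimes>\<^sub>M M)" and c: "0 \<le> c" using assms by auto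
  have "(\<integral>\<^sup>+ x. ennreal ((\<integral>y. F (x, y) \<partial>M)\<^sup>2) \<partial>N) \<le> (\<integral>\<^sup>+ x. \<integral>\<^sup>+ y. ennreal ((F (x, y))\<^sup>2) \<partial>M \<partial>N)"
    by (intro nn_integral_mono integral_square_le) simp
  also have "\<dots> = (\<integral>\<^sup>+ z. ennreal ((F z)\<^sup>2) \<partial>(N \<Otimes>\<^sub>M M))"
    by (rule nn_integral_fst) simp
  also have "\<dots> \<le> ennreal (c\<^sup>2)" using assms by (simp add: L2_le_def)
  finally show ?thesis using c by (auto simp: L2_le_def)
qed

abbreviation "M2 \<equiv> M \<Otimes>\<^sub>M M"

text \<open>Independence is used in this form: the joint law is that of a pair living on two
  copies of the probability space. Unlike the library's \<open>indep_var\<close> it allows target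
  spaces of different types.\<close>

definition decoupled :: "'b measure \<Rightarrow> ('a \<Rightarrow> 'b) \<Rightarrow> 'c measure \<Rightarrow> ('a \<Rightarrow> 'c) \<Rightarrow> bool" where
  "decoupled S X T Y \<longleftrightarrow> X \<in> measurable M S \<and> Y \<in> measurable M T \<and>
    distr M (S \<Otimes>\<^sub>M T) (\<lambda>w. (X w, Y w)) = distr M2 (S \<Otimes>\<^sub>M T) (\<lambda>z. (X (fst z), Y (snd z)))"

text \<open>The joint law agrees with the product of the marginals on rectangles, and that product
  is the image of \<open>M2\<close> under the two maps.\<close>

lemma decoupledI:
  assumes [measurable]: "X \<in> measurable M S" "Y \<in> measurable M T"
    and ind: "\<And>A B. A \<in> sets S \<Longrightarrow> B \<in> sets T \<Longrightarrow>
      prob ((X -` A \<inter> space M) \<inter> (Y -` B \<inter> space M)) = prob (X -` A \<inter> space M) * prob (Y -` B \<inter> space M)"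
  shows "decoupled S X T Y"
proof -
  interpret X: prob_space "distr M S X" by (rule prob_space_distr) simp
  interpret Y: prob_space "distr M T Y" by (rule prob_space_distr) simp
  have "distr M S X \<Otimes>\<^sub>M distr M T Y = distr M (S \<Otimes>\<^sub>M T) (\<lambda>w. (X w, Y w))"
  proof (rule pair_measure_eqI)
    show "sigma_finite_measure (distr M S X)" "sigma_finite_measure (distr M T Y)" by unfold_locales
    fix A B assume "A \<in> sets (distr M S X)" "B \<in> sets (distr M T Y)"
    then have [measurable]: "A \<in> sets S" "B \<in> sets T" by auto
    have "(\<lambda>w. (X w, Y w)) -` (A \<times> B) \<inter> space M = (X -` A \<inter> space M) \<inter> (Y -` B \<inter> space M)" by auto
    then show "emeasure (distr M S X) A * emeasure (distr M T Y) B =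
        emeasure (distr M (S \<Otimes>\<^sub>M T) (\<lambda>w. (X w, Y w))) (A \<times> B)"
      using ind[of A B] by (simp add: emeasure_distr emeasure_eq_measure ennreal_mult)
  qed simp
  also have "distr M S X \<Otimes>\<^sub>M distr M T Y =
      distr M2 (S \<Otimes>\<^sub>M T) (\<lambda>(x, y). (X x, Y y))"
    by (rule pair_measure_distr) (auto simp: Y.sigma_finite_measure_axioms)
  finally show ?thesis by (simp add: decoupled_def split_beta')
qed

lemma decoupled_L2_le:
  assumes "decoupled S X T Y" and [measurable]: "F \<in> borel_measurable (S \<Otimes>\<^sub>M T)"
  shows "L2_le M (\<lambda>w. F (X w, Y w)) c \<longleftrightarrow> L2_le M2 (\<lambda>z. F (X (fst z), Y (snd z))) c"
proof -
  have [measurable]: "X \<in> measurable M S" "Y \<in> measurable M T"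
    and eq: "distr M (S \<Otimes>\<^sub>M T) (\<lambda>w. (X w, Y w)) = distr M2 (S \<Otimes>\<^sub>M T) (\<lambda>z. (X (fst z), Y (snd z)))"
    using assms(1) by (auto simp: decoupled_def)
  have "L2_le M (\<lambda>w. F (X w, Y w)) c \<longleftrightarrow> L2_le (distr M (S \<Otimes>\<^sub>M T) (\<lambda>w. (X w, Y w))) F c"
    by (subst L2_le_distr) auto
  then show ?thesis unfolding eq by (subst (asm) L2_le_distr) auto
qed

lemma decoupled_integral:
  fixes F :: "_ \<Rightarrow> 'd::{banach, second_countable_topology}"
  assumes "decoupled S X T Y" and [measurable]: "F \<in> borel_measurable (S \<Otimes>\<^sub>M T)"
  shows "(\<integral>w. F (X w, Y w) \<partial>M) = (\<integral>z. F (X (fst z), Y (snd z)) \<partial>M2)"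
    "integrable M (\<lambda>w. F (X w, Y w)) \<longleftrightarrow> integrable M2 (\<lambda>z. F (X (fst z), Y (snd z)))"
proof -
  have [measurable]: "X \<in> measurable M S" "Y \<in> measurable M T"
    and eq: "distr M (S \<Otimes>\<^sub>M T) (\<lambda>w. (X w, Y w)) = distr M2 (S \<Otimes>\<^sub>M T) (\<lambda>z. (X (fst z), Y (snd z)))"
    using assms(1) by (auto simp: decoupled_def)
  have "(\<integral>w. F (X w, Y w) \<partial>M) = (\<integral>p. F p \<partial>distr M (S \<Otimes>\<^sub>M T) (\<lambda>w. (X w, Y w)))"
    by (subst integral_distr) auto
  then show "(\<integral>w. F (X w, Y w) \<partial>M) = (\<integral>z. F (X (fst z), Y (snd z)) \<partial>M2)"
    unfolding eq by (subst (asm) integral_distr) auto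
  have "integrable M (\<lambda>w. F (X w, Y w)) \<longleftrightarrow> integrable (distr M (S \<Otimes>\<^sub>M T) (\<lambda>w. (X w, Y w))) F"
    by (subst integrable_distr_eq) auto
  then show "integrable M (\<lambda>w. F (X w, Y w)) \<longleftrightarrow> integrable M2 (\<lambda>z. F (X (fst z), Y (snd z)))"
    unfolding eq by (subst (asm) integrable_distr_eq) auto
qed

text \<open>The values lie in a general field because the factors are real in covariances and
  complex in characteristic functions.\<close>

lemma decoupled_mult:
  fixes f g :: "_ \<Rightarrow> 'd::{real_normed_field, banach, second_countable_topology}"
  assumes dec: "decoupled S X T Y" and [measurable]: "f \<in> borel_measurable S" "g \<in> borel_measurable T"
    and int: "integrable M (\<lambda>w. f (X w))" "integrable M (\<lambda>w. g (Y w))"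
  shows "(\<integral>w. f (X w) * g (Y w) \<partial>M) = (\<integral>w. f (X w) \<partial>M) * (\<integral>w. g (Y w) \<partial>M)"
proof -
  interpret P: pair_prob_space M M ..
  have [measurable]: "X \<in> measurable M S" "Y \<in> measurable M T"
    using dec by (auto simp: decoupled_def)
  have "(\<integral>w. f (X w) * g (Y w) \<partial>M) = (\<integral>z. f (X (fst z)) * g (Y (snd z)) \<partial>M2)"
    using decoupled_integral(1)[OF dec, of "\<lambda>p. f (fst p) * g (snd p)"] by simp
  also have "\<dots> = (\<integral>x. \<integral>y. f (X x) * g (Y y) \<partial>M \<partial>M)"
  proof (subst P.integral_fst'[symmetric])
    show "integrable M2 (\<lambda>z. f (X (fst z)) * g (Y (snd z)))"
      using int by (intro P.Fubini_integrable) (auto simp: norm_mult)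
  qed simp
  also have "\<dots> = (\<integral>w. f (X w) \<partial>M) * (\<integral>w. g (Y w) \<partial>M)" by simp
  finally show ?thesis .
qed

end

section \<open>Weakly dependent sums\<close>

text \<open>Written with sums, since a difference of natural numbers would truncate.\<close>

definition far :: "nat \<Rightarrow> nat \<Rightarrow> nat \<Rightarrow> bool" where
  "far k i j \<longleftrightarrow> i + k < j \<or> j + k < i"

lemma far_commute: "far k i j \<longleftrightarrow> far k j i"
  by (auto simp: far_def)

lemma card_near_le: "card {j\<in>A. \<not> far k i j} \<le> 2 * k + 1"
proof -
  have "card {j\<in>A. \<not> far k i j} \<le> card {i - k..i + k}"
    by (rule card_mono) (auto simp: far_def)
  then show ?thesis by simp
qed

text \<open>One of \<open>i - j\<close> and \<open>j - i\<close> is truncated to 0, so their sum is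
  the lag. The lag minus one is the largest \<open>k\<close> with \<open>far k i j\<close>. Each lag
  occurs at most twice, once on each side of \<open>i\<close>.\<close>

lemma sum_lag_le:
  fixes f :: "nat \<Rightarrow> real"
  assumes "\<And>k. 0 \<le> f k" "i \<in> {1..n}"
  shows "(\<Sum>j\<in>{1..n} - {i}. f ((i - j) + (j - i) - 1)) \<le> 2 * (\<Sum>k<n. f k)"
proof -
  define g where "g = (\<lambda>j. f ((i - j) + (j - i) - 1))"
  have split: "{1..n} - {i} = {1..<i} \<union> {i<..n}" using assms(2) by auto
  have "sum g ({1..n} - {i}) = sum g {1..<i} + sum g {i<..n}"
    unfolding split by (rule sum.union_disjoint) auto
  moreover have "sum g {1..<i} = sum f ((\<lambda>j. i - j - 1) ` {1..<i})"
    by (subst sum.reindex) (auto simp: inj_on_def g_def)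
  moreover have "sum f ((\<lambda>j. i - j - 1) ` {1..<i}) \<le> sum f {..<n}"
    using assms by (intro sum_mono2) auto
  moreover have "sum g {i<..n} = sum f ((\<lambda>j. j - i - 1) ` {i<..n})"
    by (subst sum.reindex) (auto simp: inj_on_def g_def)
  moreover have "sum f ((\<lambda>j. j - i - 1) ` {i<..n}) \<le> sum f {..<n}"
    using assms by (intro sum_mono2) auto
  ultimately show ?thesis by (simp add: g_def)
qed

lemma (in prob_space) expectation_sum_square:
  fixes Y :: "'i \<Rightarrow> 'a \<Rightarrow> real"
  assumes YY: "\<And>i j. i \<in> I \<Longrightarrow> j \<in> I \<Longrightarrow> integrable M (\<lambda>w. Y i w * Y j w)"
  shows "expectation (\<lambda>w. (\<Sum>i\<in>I. Y i w)\<^sup>2) = (\<Sum>i\<in>I. \<Sum>j\<in>I. expectation (\<lambda>w. Y i w * Y j w))"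
    and "integrable M (\<lambda>w. (\<Sum>i\<in>I. Y i w)\<^sup>2)"
proof -
  show "expectation (\<lambda>w. (\<Sum>i\<in>I. Y i w)\<^sup>2) = (\<Sum>i\<in>I. \<Sum>j\<in>I. expectation (\<lambda>w. Y i w * Y j w))"
    unfolding power2_eq_square sum_product
    by (subst Bochner_Integration.integral_sum, (intro Bochner_Integration.integrable_sum YY; assumption),
        rule sum.cong[OF refl], rule Bochner_Integration.integral_sum, rule YY)
  show "integrable M (\<lambda>w. (\<Sum>i\<in>I. Y i w)\<^sup>2)"
    unfolding power2_eq_square sum_product by (intro Bochner_Integration.integrable_sum YY)
qed

text \<open>The covariance of \<open>Y i\<close> and \<open>Y j\<close> is split by replacing first
  \<open>Y i\<close> and then \<open>Y j\<close> by its approximation. Since \<open>Y\<close> is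
  centred, the mean of \<open>Z i k\<close> is at most \<open>a k\<close> in absolute value. With
  \<open>a k \<le> b\<close> the three parts a b + (b + a) a + a a stay below 4 a b. The level
  \<open>k\<close> is chosen for each pair separately, as the lag minus one, so the variance per
  index involves the sum of all \<open>a k\<close>; 8 is twice 4, for the two sides of
  \<open>i\<close>.\<close>

lemma (in prob_space) L2_le_sum_approximable:
  fixes Y :: "nat \<Rightarrow> 'a \<Rightarrow> real" and Z :: "nat \<Rightarrow> nat \<Rightarrow> 'a \<Rightarrow> real"
  assumes Y: "\<And>i. i \<in> {1..n} \<Longrightarrow> L2_le M (Y i) b"
    and mean: "\<And>i. i \<in> {1..n} \<Longrightarrow> expectation (Y i) = 0"
    and approx: "\<And>i k. i \<in> {1..n} \<Longrightarrow> L2_le M (\<lambda>w. Y i w - Z i k w) (a k)"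
    and a: "\<And>k. 0 \<le> a k" "\<And>k. a k \<le> b"
    and uncorr: "\<And>i j k. i \<in> {1..n} \<Longrightarrow> j \<in> {1..n} \<Longrightarrow> far k i j \<Longrightarrow>
      expectation (\<lambda>w. Z i k w * Z j k w) = expectation (Z i k) * expectation (Z j k)"
  shows "L2_le M (\<lambda>w. \<Sum>i\<in>{1..n}. Y i w) (sqrt (real n * (b\<^sup>2 + 8 * b * (\<Sum>k<n. a k))))"
proof -
  have b: "0 \<le> b" using a[of 0] by simp
  have cov: "expectation (\<lambda>w. Y i w * Y j w) \<le> 4 * b * a k"
    if ij: "i \<in> {1..n}" "j \<in> {1..n}" "far k i j" for i j k
  proof -
    have Z: "L2_le M (Z i k) (b + a k)" if "i \<in> {1..n}" for i
      using L2_le_diff[OF Y[OF that] approx[OF that, of k]] by simp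
    have EZ: "\<bar>expectation (Z i k)\<bar> \<le> a k" if "i \<in> {1..n}" for i
    proof -
      have "expectation (\<lambda>w. Y i w - Z i k w) = - expectation (Z i k)"
        using L2_le_integrable(1)[OF Y[OF that]] L2_le_integrable(1)[OF Z[OF that]] mean[OF that] by simp
      then show ?thesis using L2_le_integrable(3)[OF approx[OF that, of k]] by simp
    qed
    note p1 = L2_le_mult[OF approx[OF ij(1), of k] Y[OF ij(2)]]
    note p2 = L2_le_mult[OF Z[OF ij(1)] approx[OF ij(2), of k]]
    note p3 = L2_le_mult[OF Z[OF ij(1)] Z[OF ij(2)]]
    have "expectation (\<lambda>w. Y i w * Y j w) = expectation (\<lambda>w. ((Y i w - Z i k w) * Y j w +
        Z i k w * (Y j w - Z j k w)) + Z i k w * Z j k w)"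
      by (intro Bochner_Integration.integral_cong) (auto simp: algebra_simps)
    also have "\<dots> = expectation (\<lambda>w. (Y i w - Z i k w) * Y j w) +
        expectation (\<lambda>w. Z i k w * (Y j w - Z j k w)) + expectation (\<lambda>w. Z i k w * Z j k w)"
      using p1(1) p2(1) p3(1)
      by (simp only: Bochner_Integration.integral_add Bochner_Integration.integrable_add)
    also have "\<dots> \<le> a k * b + (b + a k) * a k + a k * a k"
    proof -
      have "expectation (Z i k) * expectation (Z j k) \<le> a k * a k"
        by (rule order_trans[OF abs_ge_self])
          (auto simp: abs_mult intro!: mult_mono EZ ij a)
      then show ?thesis using p1(3) p2(3) uncorr[OF ij] by linarith
    qed
    also have "\<dots> \<le> 4 * b * a k"
      using mult_right_mono[OF a(2)[of k] a(1)[of k]] by (simp add: algebra_simps)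
    finally show ?thesis .
  qed
  have row: "(\<Sum>j\<in>{1..n}. expectation (\<lambda>w. Y i w * Y j w)) \<le> b\<^sup>2 + 8 * b * (\<Sum>k<n. a k)"
    if i: "i \<in> {1..n}" for i
  proof -
    have "(\<Sum>j\<in>{1..n}. expectation (\<lambda>w. Y i w * Y j w)) =
        expectation (\<lambda>w. Y i w * Y i w) + (\<Sum>j\<in>{1..n} - {i}. expectation (\<lambda>w. Y i w * Y j w))"
      by (rule sum.remove) (use i in auto)
    also have "\<dots> \<le> b\<^sup>2 + (\<Sum>j\<in>{1..n} - {i}. 4 * b * a ((i - j) + (j - i) - 1))"
    proof (intro add_mono sum_mono)
      show "expectation (\<lambda>w. Y i w * Y i w) \<le> b\<^sup>2"
        using L2_le_square(2)[OF Y[OF i]] by (simp add: power2_eq_square)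
      fix j assume "j \<in> {1..n} - {i}"
      then show "expectation (\<lambda>w. Y i w * Y j w) \<le> 4 * b * a ((i - j) + (j - i) - 1)"
        using i by (intro cov) (auto simp: far_def)
    qed
    also have "\<dots> \<le> b\<^sup>2 + 2 * (\<Sum>k<n. 4 * b * a k)"
      using sum_lag_le[of "\<lambda>k. 4 * b * a k", OF _ i] a(1) b by auto
    also have "(\<Sum>k<n. 4 * b * a k) = 4 * b * (\<Sum>k<n. a k)" by (simp add: sum_distrib_left)
    finally show ?thesis by (simp add: algebra_simps)
  qed
  note YY = L2_le_mult(1)[OF Y Y]
  have "expectation (\<lambda>w. (\<Sum>i\<in>{1..n}. Y i w)\<^sup>2) =
      (\<Sum>i\<in>{1..n}. \<Sum>j\<in>{1..n}. expectation (\<lambda>w. Y i w * Y j w))"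
    by (rule expectation_sum_square(1)[OF YY])
  also have "\<dots> \<le> (\<Sum>i\<in>{1..n}. b\<^sup>2 + 8 * b * (\<Sum>k<n. a k))"
    by (intro sum_mono row)
  finally have le: "expectation (\<lambda>w. (\<Sum>i\<in>{1..n}. Y i w)\<^sup>2) \<le> real n * (b\<^sup>2 + 8 * b * (\<Sum>k<n. a k))"
    by simp
  have nonneg: "0 \<le> real n * (b\<^sup>2 + 8 * b * (\<Sum>k<n. a k))"
    using a(1) b by (auto intro!: mult_nonneg_nonneg add_nonneg_nonneg sum_nonneg)
  show ?thesis
  proof (rule L2_leI)
    show "(\<lambda>w. \<Sum>i\<in>{1..n}. Y i w) \<in> borel_measurable M"
      by (intro borel_measurable_sum) (use Y in blast)
    show "integrable M (\<lambda>w. (\<Sum>i\<in>{1..n}. Y i w)\<^sup>2)"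
      by (rule expectation_sum_square(2)[OF YY])
  qed (use le nonneg in auto)
qed

section \<open>Characteristic functions of bounded m-dependent sums\<close>

lemma norm_iexp_minus_one_le: "cmod (iexp x - 1) \<le> \<bar>x\<bar>"
  using iexp_approx1[of x 0] by simp

lemma norm_iexp_minus_linear_le: "cmod (iexp x - 1 - \<i> * x) \<le> x\<^sup>2 / 2"
  using iexp_approx1[of x 1] by (simp add: numeral_2_eq_2 diff_diff_eq)

lemma norm_iexp_diff_le: "cmod (iexp x - iexp y) \<le> \<bar>x - y\<bar>"
proof -
  have "iexp x - iexp y = iexp y * (iexp (x - y) - 1)"
    by (simp add: algebra_simps exp_add[symmetric])
  then show ?thesis using norm_iexp_minus_one_le[of "x - y"] by (simp add: norm_mult)
qed

lemma (in prob_space) norm_integral_le_bound: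
  fixes f :: "'a \<Rightarrow> complex"
  assumes [measurable]: "f \<in> borel_measurable M" and b: "\<And>w. w \<in> space M \<Longrightarrow> cmod (f w) \<le> B"
  shows "cmod (\<integral>w. f w \<partial>M) \<le> B"
proof -
  have int: "integrable M f" by (rule integrable_const_bound[of _ B]) (auto intro!: AE_I2 b)
  have "cmod (\<integral>w. f w \<partial>M) \<le> (\<integral>w. cmod (f w) \<partial>M)" by (rule integral_norm_bound)
  also have "\<dots> \<le> (\<integral>w. B \<partial>M)" using int b by (intro integral_mono) auto
  finally show ?thesis by (simp add: prob_space)
qed

lemma (in prob_space) norm_integral_diff_le_bound:
  fixes f g :: "'a \<Rightarrow> complex"
  assumes [measurable]: "integrable M f" "integrable M g"
    and b: "\<And>w. w \<in> space M \<Longrightarrow> cmod (f w - g w) \<le> B"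
  shows "cmod ((\<integral>w. f w \<partial>M) - (\<integral>w. g w \<partial>M)) \<le> B"
proof -
  have "cmod (\<integral>w. f w - g w \<partial>M) \<le> B"
    by (rule norm_integral_le_bound) (use assms in auto)
  then show ?thesis using assms by simp
qed

text \<open>Arbitrary separated index sets, not only a past and a future: removing a neighbourhood
  of \<open>j\<close> leaves indices on both of its sides.\<close>

definition (in prob_space) m_dependent :: "nat \<Rightarrow> nat \<Rightarrow> (nat \<Rightarrow> 'a \<Rightarrow> real) \<Rightarrow> bool" where
  "m_dependent K n X \<longleftrightarrow> (\<forall>I J. I \<subseteq> {1..n} \<longrightarrow> J \<subseteq> {1..n} \<longrightarrow> (\<forall>i\<in>I. \<forall>j\<in>J. far K i j) \<longrightarrow>
    decoupled (PiM I (\<lambda>_. borel)) (\<lambda>w. \<lambda>i\<in>I. X i w) (PiM J (\<lambda>_. borel)) (\<lambda>w. \<lambda>j\<in>J. X j w))"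

context prob_space
begin

lemma m_dependentD:
  assumes "m_dependent K n X" "I \<subseteq> {1..n}" "J \<subseteq> {1..n}" "\<And>i j. i \<in> I \<Longrightarrow> j \<in> J \<Longrightarrow> far K i j"
  shows "decoupled (PiM I (\<lambda>_. borel)) (\<lambda>w. \<lambda>i\<in>I. X i w) (PiM J (\<lambda>_. borel)) (\<lambda>w. \<lambda>j\<in>J. X j w)"
  using assms by (auto simp: m_dependent_def)

context
  fixes X :: "nat \<Rightarrow> 'a \<Rightarrow> real" and n K :: nat and c :: real
  assumes X_meas [measurable]: "\<And>i. i \<in> {1..n} \<Longrightarrow> X i \<in> borel_measurable M"
    and X_bound: "\<And>i w. i \<in> {1..n} \<Longrightarrow> w \<in> space M \<Longrightarrow> \<bar>X i w\<bar> \<le> c"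
    and X_mean: "\<And>i. i \<in> {1..n} \<Longrightarrow> expectation (X i) = 0"
    and X_dep: "m_dependent K n X" and c_nonneg: "0 \<le> c"
begin

private abbreviation "S w \<equiv> \<Sum>i\<in>{1..n}. X i w"

private definition "psi s = (\<integral>w. iexp (s * S w) \<partial>M)"

private definition "trimmed k j w = (\<Sum>i\<in>{i\<in>{1..n}. far k j i}. X i w)"

private lemma trimmed_meas [measurable]: "trimmed k j \<in> borel_measurable M"
  unfolding trimmed_def by measurable

private lemma sum_near_le:
  assumes "w \<in> space M"
  shows "\<bar>\<Sum>i\<in>{i\<in>{1..n}. \<not> far k j i}. X i w\<bar> \<le> real (2 * k + 1) * c"
proof -
  have "\<bar>\<Sum>i\<in>{i\<in>{1..n}. \<not> far k j i}. X i w\<bar> \<le> (\<Sum>i\<in>{i\<in>{1..n}. \<not> far k j i}. c)"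
    by (rule order_trans[OF sum_abs], rule sum_mono) (use X_bound assms in auto)
  also have "\<dots> \<le> real (2 * k + 1) * c"
    using card_near_le[of "{1..n}" k j] c_nonneg by (simp only: sum_constant) (intro mult_right_mono, auto)
  finally show ?thesis .
qed

private lemma S_split: "S w = trimmed k j w + (\<Sum>i\<in>{i\<in>{1..n}. \<not> far k j i}. X i w)"
  unfolding trimmed_def by (subst sum.union_disjoint[symmetric]) (auto intro!: sum.cong)

private lemma trimmed_diff:
  "w \<in> space M \<Longrightarrow> \<bar>S w - trimmed k j w\<bar> \<le> real (2 * k + 1) * c"
  using sum_near_le[of w k j] S_split[of w k j] by simp

private lemma integrable_bounded_iexp:
  assumes [measurable]: "f \<in> borel_measurable M" "g \<in> borel_measurable M"
    and "\<And>w. w \<in> space M \<Longrightarrow> \<bar>f w\<bar> \<le> B"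
  shows "integrable M (\<lambda>w. complex_of_real (f w) * iexp (g w))"
  by (rule integrable_const_bound[of _ B]) (use assms in \<open>auto simp: norm_mult\<close>)

private lemma trimmed_indep1:
  assumes j: "j \<in> {1..n}"
  shows "(\<integral>w. complex_of_real (X j w) * iexp (s * trimmed K j w) \<partial>M) = 0"
proof -
  let ?J = "{i\<in>{1..n}. far K j i}"
  have "decoupled (PiM {j} (\<lambda>_. borel)) (\<lambda>w. \<lambda>i\<in>{j}. X i w) (PiM ?J (\<lambda>_. borel)) (\<lambda>w. \<lambda>j\<in>?J. X j w)"
    by (rule m_dependentD[OF X_dep]) (use j in auto)
  moreover have "(\<lambda>x. complex_of_real (x j)) \<in> borel_measurable (PiM {j} (\<lambda>_. borel :: real measure))"
    "(\<lambda>x. iexp (s * (\<Sum>i\<in>?J. x i))) \<in> borel_measurable (PiM ?J (\<lambda>_. borel :: real measure))"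
    by measurable
  moreover have "integrable M (\<lambda>w. complex_of_real ((\<lambda>i\<in>{j}. X i w) j))"
    using integrable_bounded_iexp[of "X j" "\<lambda>_. 0" c] X_bound j by simp
  moreover have "integrable M (\<lambda>w. iexp (s * (\<Sum>i\<in>?J. (\<lambda>i\<in>?J. X i w) i)))"
    using integrable_bounded_iexp[of "\<lambda>_. 1" "\<lambda>w. s * trimmed K j w" 1] by (simp add: trimmed_def)
  ultimately have "(\<integral>w. complex_of_real ((\<lambda>i\<in>{j}. X i w) j) * iexp (s * (\<Sum>i\<in>?J. (\<lambda>i\<in>?J. X i w) i)) \<partial>M) =
      (\<integral>w. complex_of_real ((\<lambda>i\<in>{j}. X i w) j) \<partial>M) * (\<integral>w. iexp (s * (\<Sum>i\<in>?J. (\<lambda>i\<in>?J. X i w) i)) \<partial>M)"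
    by (rule decoupled_mult[where f = "\<lambda>x. complex_of_real (x j)" and g = "\<lambda>x. iexp (s * (\<Sum>i\<in>?J. x i))"])
  then show ?thesis using X_mean[OF j] by (simp add: trimmed_def)
qed

text \<open>If \<open>k\<close> is within \<open>K\<close> of \<open>j\<close>, an index farther
  than \<open>2 * K\<close> from \<open>j\<close> is farther than \<open>K\<close> from both. Hence
  the whole product \<open>X j * X k\<close> is independent of the sum trimmed at
  \<open>2 * K\<close>.\<close>

private lemma trimmed_indep2:
  assumes j: "j \<in> {1..n}" and k: "k \<in> {1..n}" "\<not> far K j k"
  shows "(\<integral>w. complex_of_real (X j w * X k w) * iexp (s * trimmed (2 * K) j w) \<partial>M) =
    expectation (\<lambda>w. X j w * X k w) * (\<integral>w. iexp (s * trimmed (2 * K) j w) \<partial>M)"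
proof -
  let ?J = "{i\<in>{1..n}. far (2 * K) j i}"
  have "\<forall>i\<in>{j, k}. \<forall>l\<in>?J. far K i l" using k by (auto simp: far_def)
  then have "decoupled (PiM {j, k} (\<lambda>_. borel)) (\<lambda>w. \<lambda>i\<in>{j, k}. X i w) (PiM ?J (\<lambda>_. borel)) (\<lambda>w. \<lambda>j\<in>?J. X j w)"
    by (intro m_dependentD[OF X_dep]) (use j k(1) in auto)
  moreover have "(\<lambda>x. complex_of_real (x j * x k)) \<in> borel_measurable (PiM {j, k} (\<lambda>_. borel :: real measure))"
    "(\<lambda>x. iexp (s * (\<Sum>i\<in>?J. x i))) \<in> borel_measurable (PiM ?J (\<lambda>_. borel :: real measure))"
    by measurable
  moreover have "integrable M (\<lambda>w. complex_of_real ((\<lambda>i\<in>{j, k}. X i w) j * (\<lambda>i\<in>{j, k}. X i w) k))"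
  proof -
    have "\<And>w. w \<in> space M \<Longrightarrow> \<bar>X j w * X k w\<bar> \<le> c * c"
      using X_bound j k c_nonneg by (auto simp: abs_mult intro!: mult_mono)
    then show ?thesis
      using integrable_bounded_iexp[of "\<lambda>w. X j w * X k w" "\<lambda>_. 0" "c * c"] j k(1) by simp
  qed
  moreover have "integrable M (\<lambda>w. iexp (s * (\<Sum>i\<in>?J. (\<lambda>i\<in>?J. X i w) i)))"
    using integrable_bounded_iexp[of "\<lambda>_. 1" "\<lambda>w. s * trimmed (2 * K) j w" 1] by (simp add: trimmed_def)
  ultimately have "(\<integral>w. complex_of_real ((\<lambda>i\<in>{j, k}. X i w) j * (\<lambda>i\<in>{j, k}. X i w) k) * iexp (s * (\<Sum>i\<in>?J. (\<lambda>i\<in>?J. X i w) i)) \<partial>M) =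
      (\<integral>w. complex_of_real ((\<lambda>i\<in>{j, k}. X i w) j * (\<lambda>i\<in>{j, k}. X i w) k) \<partial>M) * (\<integral>w. iexp (s * (\<Sum>i\<in>?J. (\<lambda>i\<in>?J. X i w) i)) \<partial>M)"
    by (rule decoupled_mult[where f = "\<lambda>x. complex_of_real (x j * x k)" and g = "\<lambda>x. iexp (s * (\<Sum>i\<in>?J. x i))"])
  moreover have "(\<integral>w. complex_of_real (X j w * X k w) \<partial>M) = complex_of_real (expectation (\<lambda>w. X j w * X k w))"
    by (rule integral_complex_of_real)
  ultimately show ?thesis by (simp add: trimmed_def del: of_real_mult)
qed

text \<open>Write S = T + D, where D collects the indices near \<open>j\<close>, and expand exp(i s
  D) to first order. The constant term vanishes, because \<open>X j\<close> is centred and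
  independent of T. The linear term is - s X_j D exp(i s T). There T is replaced by the shorter sum
  T2, which is independent of X_j D, and after factorisation T2 is replaced by S. Each replacement
  costs one more factor |s| times the size of the removed block.\<close>

private lemma char_ode_summand:
  assumes j: "j \<in> {1..n}"
  shows "cmod ((\<integral>w. \<i> * X j w * iexp (s * S w) \<partial>M) +
      s * (\<Sum>k | k \<in> {1..n} \<and> \<not> far K j k. expectation (\<lambda>w. X j w * X k w)) * psi s)
    \<le> 5 * c ^ 3 * s\<^sup>2 * (2 * real K + 1)\<^sup>2"
proof -
  \<comment> \<open>\<open>p\<close> and \<open>q\<close> bound the number of indices within
    \<open>K\<close> and \<open>2 * K\<close> of \<open>j\<close>.\<close>
  define p where "p = 2 * real K + 1"
  define q where "q = 4 * real K + 1"
  define D where "D w = (\<Sum>i\<in>{i\<in>{1..n}. \<not> far K j i}. X i w)" for w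
  define T where "T = trimmed K j"
  define T2 where "T2 = trimmed (2 * K) j"
  have p: "1 \<le> p" "0 \<le> q" "q \<le> 2 * p" by (auto simp: p_def q_def)
  have [measurable]: "D \<in> borel_measurable M" "T \<in> borel_measurable M" "T2 \<in> borel_measurable M" "X j \<in> borel_measurable M"
    using j unfolding D_def T_def T2_def by measurable
  have D: "\<bar>D w\<bar> \<le> p * c" if "w \<in> space M" for w
    using sum_near_le[OF that, of K j] by (simp add: D_def p_def add.commute)
  have S: "S w = T w + D w" for w using S_split[of w K j] by (simp add: D_def T_def)
  have S_T2: "\<bar>S w - T2 w\<bar> \<le> q * c" if "w \<in> space M" for w
    using trimmed_diff[OF that, of "2 * K" j] by (simp add: T2_def q_def add.commute)
  have T_T2: "\<bar>T w - T2 w\<bar> \<le> q * c" if "w \<in> space M" for w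
  proof -
    \<comment> \<open>The difference is a sum over the ring between the two neighbourhoods; it is
      counted by the whole larger one.\<close>
    have "T w = T2 w + (\<Sum>i | i \<in> {1..n} \<and> far K j i \<and> \<not> far (2 * K) j i. X i w)"
      unfolding T_def T2_def trimmed_def
      by (subst sum.union_disjoint[symmetric]) (auto intro!: sum.cong simp: far_def)
    moreover have "\<bar>\<Sum>i | i \<in> {1..n} \<and> far K j i \<and> \<not> far (2 * K) j i. X i w\<bar> \<le>
        (\<Sum>i | i \<in> {1..n} \<and> far K j i \<and> \<not> far (2 * K) j i. c)"
      by (rule order_trans[OF sum_abs], rule sum_mono) (use X_bound that in auto)
    moreover have "\<dots> \<le> (\<Sum>i | i \<in> {1..n} \<and> \<not> far (2 * K) j i. c)"
      using c_nonneg by (intro sum_mono2) auto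
    moreover have "\<dots> \<le> q * c"
      using card_near_le[of "{1..n}" "2 * K" j] c_nonneg unfolding sum_constant q_def
      by (intro mult_right_mono) auto
    ultimately show ?thesis by linarith
  qed
  have Xj: "\<bar>X j w\<bar> \<le> c" if "w \<in> space M" for w using X_bound[OF j that] .
  have XD: "\<bar>X j w * D w\<bar> \<le> p * c\<^sup>2" if "w \<in> space M" for w
    using mult_mono[OF Xj[OF that] D[OF that]] c_nonneg by (simp add: abs_mult power2_eq_square mult_ac)
  have int1: "integrable M (\<lambda>w. \<i> * (X j w * iexp (s * S w)))"
    and int2: "integrable M (\<lambda>w. \<i> * (X j w * iexp (s * T w)))"
    and int3: "integrable M (\<lambda>w. s * ((X j w * D w) * iexp (s * T w)))"
    and int4: "integrable M (\<lambda>w. s * ((X j w * D w) * iexp (s * T2 w)))"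
    and int5: "integrable M (\<lambda>w. iexp (s * T2 w))"
    and int6: "integrable M (\<lambda>w. iexp (s * S w))"
    using integrable_bounded_iexp[of "X j" "\<lambda>w. s * S w" c] integrable_bounded_iexp[of "X j" "\<lambda>w. s * T w" c]
      integrable_bounded_iexp[of "\<lambda>w. X j w * D w" "\<lambda>w. s * T w" "p * c\<^sup>2"]
      integrable_bounded_iexp[of "\<lambda>w. X j w * D w" "\<lambda>w. s * T2 w" "p * c\<^sup>2"]
      integrable_bounded_iexp[of "\<lambda>_. 1" "\<lambda>w. s * T2 w" 1] integrable_bounded_iexp[of "\<lambda>_. 1" "\<lambda>w. s * S w" 1]
      Xj XD by (auto simp del: of_real_mult of_real_sum simp flip: of_real_mult)
  define A1 where "A1 = (\<integral>w. \<i> * (X j w * iexp (s * S w)) \<partial>M)"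
  define A2 where "A2 = (\<integral>w. s * ((X j w * D w) * iexp (s * T w)) \<partial>M)"
  define A3 where "A3 = (\<integral>w. s * ((X j w * D w) * iexp (s * T2 w)) \<partial>M)"
  define v where "v = (\<Sum>k | k \<in> {1..n} \<and> \<not> far K j k. expectation (\<lambda>w. X j w * X k w))"
  have zero: "(\<integral>w. \<i> * (X j w * iexp (s * T w)) \<partial>M) = 0"
    using trimmed_indep1[OF j, of s] by (simp add: T_def)
  have E1: "cmod (A1 + A2) \<le> c * (s\<^sup>2 * (p * c)\<^sup>2 / 2)"
  proof -
    have "cmod (A1 - (\<integral>w. \<i> * (X j w * iexp (s * T w)) - s * ((X j w * D w) * iexp (s * T w)) \<partial>M))
      \<le> c * (s\<^sup>2 * (p * c)\<^sup>2 / 2)"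
      unfolding A1_def
    proof (rule norm_integral_diff_le_bound)
      fix w assume w: "w \<in> space M"
      have "\<i> * (X j w * iexp (s * S w)) - (\<i> * (X j w * iexp (s * T w)) - s * ((X j w * D w) * iexp (s * T w)))
        = \<i> * X j w * iexp (s * T w) * (iexp (s * D w) - 1 - \<i> * (s * D w))"
        unfolding S by (simp add: algebra_simps exp_add)
      then have "cmod (\<i> * (X j w * iexp (s * S w)) - (\<i> * (X j w * iexp (s * T w)) - s * ((X j w * D w) * iexp (s * T w))))
        = \<bar>X j w\<bar> * cmod (iexp (s * D w) - 1 - \<i> * (s * D w))"
        by (simp add: norm_mult)
      also have "\<dots> \<le> c * ((s * D w)\<^sup>2 / 2)"
        using norm_iexp_minus_linear_le[of "s * D w"] Xj[OF w] c_nonneg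
        by (intro mult_mono) (auto simp del: of_real_mult simp flip: of_real_mult)
      also have "\<dots> \<le> c * (s\<^sup>2 * (p * c)\<^sup>2 / 2)"
        using D[OF w] c_nonneg p by (auto simp: power_mult_distrib intro!: mult_left_mono abs_le_square_iff[THEN iffD1])
          (metis D abs_ge_zero power2_abs power_mono power_mult_distrib w)
      finally show "cmod (\<i> * (X j w * iexp (s * S w)) - (\<i> * (X j w * iexp (s * T w)) - s * ((X j w * D w) * iexp (s * T w))))
        \<le> c * (s\<^sup>2 * (p * c)\<^sup>2 / 2)" .
    qed (use int1 int2 int3 in auto)
    then show ?thesis using int2 int3 zero by (simp add: A2_def)
  qed
  have E2: "cmod (A2 - A3) \<le> \<bar>s\<bar> * (p * c\<^sup>2 * (\<bar>s\<bar> * (q * c)))"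
    unfolding A2_def A3_def
  proof (rule norm_integral_diff_le_bound[OF int3 int4])
    fix w assume w: "w \<in> space M"
    have "cmod (s * ((X j w * D w) * iexp (s * T w)) - s * ((X j w * D w) * iexp (s * T2 w)))
      = \<bar>s\<bar> * (\<bar>X j w * D w\<bar> * cmod (iexp (s * T w) - iexp (s * T2 w)))"
      by (simp add: norm_mult abs_mult flip: right_diff_distrib)
    also have "\<dots> \<le> \<bar>s\<bar> * (p * c\<^sup>2 * (\<bar>s\<bar> * (q * c)))"
    proof (intro mult_left_mono mult_mono XD w)
      have "cmod (iexp (s * T w) - iexp (s * T2 w)) \<le> \<bar>s\<bar> * \<bar>T w - T2 w\<bar>"
        using norm_iexp_diff_le[of "s * T w" "s * T2 w"] by (simp flip: abs_mult right_diff_distrib)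
      also have "\<dots> \<le> \<bar>s\<bar> * (q * c)" using T_T2[OF w] by (intro mult_left_mono) auto
      finally show "cmod (iexp (s * T w) - iexp (s * T2 w)) \<le> \<bar>s\<bar> * (q * c)" .
    qed (use p c_nonneg in auto)
    finally show "cmod (s * ((X j w * D w) * iexp (s * T w)) - s * ((X j w * D w) * iexp (s * T2 w)))
      \<le> \<bar>s\<bar> * (p * c\<^sup>2 * (\<bar>s\<bar> * (q * c)))" .
  qed
  have A3: "A3 = s * v * (\<integral>w. iexp (s * T2 w) \<partial>M)"
  proof -
    have "A3 = s * (\<integral>w. (X j w * D w) * iexp (s * T2 w) \<partial>M)"
      by (simp add: A3_def)
    also have "\<dots> = s * (\<integral>w. (\<Sum>k | k \<in> {1..n} \<and> \<not> far K j k. (X j w * X k w) * iexp (s * T2 w)) \<partial>M)"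
      by (simp add: D_def sum_distrib_left sum_distrib_right mult.assoc)
    also have "\<dots> = s * (\<Sum>k | k \<in> {1..n} \<and> \<not> far K j k. (\<integral>w. complex_of_real (X j w * X k w) * iexp (s * T2 w) \<partial>M))"
    proof (subst Bochner_Integration.integral_sum)
      fix k assume k: "k \<in> {k. k \<in> {1..n} \<and> \<not> far K j k}"
      have "\<bar>X j w * X k w\<bar> \<le> c * c" if "w \<in> space M" for w
        using X_bound[of j w] X_bound[of k w] j k that c_nonneg by (auto simp: abs_mult intro!: mult_mono)
      then show "integrable M (\<lambda>w. complex_of_real (X j w * X k w) * iexp (s * T2 w))"
        using k by (intro integrable_bounded_iexp[of _ _ "c * c"]) auto
    qed simp
    also have "\<dots> = s * (\<Sum>k | k \<in> {1..n} \<and> \<not> far K j k. expectation (\<lambda>w. X j w * X k w) * (\<integral>w. iexp (s * T2 w) \<partial>M))"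
      unfolding T2_def by (intro arg_cong2[where f="(*)"] refl sum.cong trimmed_indep2 j) auto
    finally show ?thesis by (simp add: v_def sum_distrib_right mult.assoc)
  qed
  have v: "\<bar>v\<bar> \<le> p * c\<^sup>2"
  proof -
    have "v = expectation (\<lambda>w. X j w * D w)"
    proof -
      have "integrable M (\<lambda>w. X j w * X k w)" if "k \<in> {1..n}" for k
        using that X_bound j c_nonneg by (intro integrable_const_bound[of _ "c * c"]) (auto simp: abs_mult intro!: mult_mono)
      then show ?thesis by (simp add: v_def D_def sum_distrib_left)
    qed
    also have "\<bar>\<dots>\<bar> \<le> p * c\<^sup>2"
      using L2_le_integrable(3)[OF L2_le_bounded[of "\<lambda>w. X j w * D w"]] XD p c_nonneg by auto
    finally show ?thesis .
  qed
  have E3: "cmod (A3 - s * v * psi s) \<le> \<bar>s\<bar> * (p * c\<^sup>2) * (\<bar>s\<bar> * (q * c))"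
  proof -
    have "cmod ((\<integral>w. iexp (s * T2 w) \<partial>M) - psi s) \<le> \<bar>s\<bar> * (q * c)"
      unfolding psi_def
    proof (rule norm_integral_diff_le_bound[OF int5 int6])
      fix w assume w: "w \<in> space M"
      have "cmod (iexp (s * T2 w) - iexp (s * S w)) \<le> \<bar>s * T2 w - s * S w\<bar>"
        by (rule norm_iexp_diff_le)
      also have "\<dots> = \<bar>s\<bar> * \<bar>S w - T2 w\<bar>" by (simp add: abs_minus_commute flip: abs_mult right_diff_distrib)
      also have "\<dots> \<le> \<bar>s\<bar> * (q * c)" using S_T2[OF w] by (intro mult_left_mono) auto
      finally show "cmod (iexp (s * T2 w) - iexp (s * S w)) \<le> \<bar>s\<bar> * (q * c)" .
    qed
    then have "cmod (s * v) * cmod ((\<integral>w. iexp (s * T2 w) \<partial>M) - psi s) \<le> (\<bar>s\<bar> * (p * c\<^sup>2)) * (\<bar>s\<bar> * (q * c))"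
      using v p c_nonneg by (intro mult_mono) (auto simp: norm_mult abs_mult intro!: mult_left_mono)
    then show ?thesis unfolding A3 by (simp add: norm_mult right_diff_distrib[symmetric] flip: mult.assoc)
  qed
  have "cmod (A1 + s * v * psi s) \<le> cmod (A1 + A2) + cmod (A2 - A3) + cmod (A3 - s * v * psi s)"
    using norm_triangle_ineq4[of "A1 + A2" "(A2 - A3) + (A3 - s * v * psi s)"]
      norm_triangle_ineq[of "A2 - A3" "A3 - s * v * psi s"] by (simp add: algebra_simps)
  \<comment> \<open>Half of p^2 is the Taylor remainder and each of the two replacements costs p q.
    With q \<le> 2 p the total is at most 9/2 p^2.\<close>
  also have "\<dots> \<le> c ^ 3 * s\<^sup>2 * (p\<^sup>2 / 2 + 2 * (p * q))"
    using E1 E2 E3 by (simp add: field_simps power2_eq_square power3_eq_cube)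
  also have "\<dots> \<le> c ^ 3 * s\<^sup>2 * (5 * p\<^sup>2)"
  proof (rule mult_left_mono)
    have "p * q \<le> p * (2 * p)" using p by (intro mult_left_mono) auto
    then have "p * q \<le> 2 * p\<^sup>2" by (simp add: power2_eq_square)
    moreover have "0 \<le> p\<^sup>2" by simp
    ultimately show "p\<^sup>2 / 2 + 2 * (p * q) \<le> 5 * p\<^sup>2" by linarith
  qed (use c_nonneg in auto)
  finally show ?thesis by (simp add: A1_def v_def p_def mult_ac)
qed

private lemma far_uncorrelated:
  assumes "j \<in> {1..n}" "k \<in> {1..n}" "far K j k"
  shows "expectation (\<lambda>w. X j w * X k w) = 0"
proof -
  have "decoupled (PiM {j} (\<lambda>_. borel)) (\<lambda>w. \<lambda>i\<in>{j}. X i w) (PiM {k} (\<lambda>_. borel)) (\<lambda>w. \<lambda>j\<in>{k}. X j w)"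
    by (rule m_dependentD[OF X_dep]) (use assms in auto)
  moreover have "(\<lambda>x. x j) \<in> borel_measurable (PiM {j} (\<lambda>_. borel :: real measure))"
    "(\<lambda>x. x k) \<in> borel_measurable (PiM {k} (\<lambda>_. borel :: real measure))"
    by measurable
  moreover have "integrable M (\<lambda>w. (\<lambda>i\<in>{j}. X i w) j)" "integrable M (\<lambda>w. (\<lambda>i\<in>{k}. X i w) k)"
    using assms by (auto intro!: integrable_const_bound[of _ c] AE_I2 X_bound)
  ultimately have "expectation (\<lambda>w. (\<lambda>i\<in>{j}. X i w) j * (\<lambda>i\<in>{k}. X i w) k) =
      expectation (\<lambda>w. (\<lambda>i\<in>{j}. X i w) j) * expectation (\<lambda>w. (\<lambda>i\<in>{k}. X i w) k)"
    by (rule decoupled_mult[where f = "\<lambda>x. x j" and g = "\<lambda>x. x k"])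
  then show ?thesis using X_mean assms by simp
qed

private definition "var_S = expectation (\<lambda>w. (S w)\<^sup>2)"

text \<open>Far pairs are uncorrelated, so the local sums that appear as coefficients in
  \<open>char_ode_summand\<close> add up to the full variance. This closes the differential
  equation.\<close>

private lemma var_S_eq:
  "var_S = (\<Sum>j\<in>{1..n}. \<Sum>k | k \<in> {1..n} \<and> \<not> far K j k. expectation (\<lambda>w. X j w * X k w))"
proof -
  have int: "integrable M (\<lambda>w. X j w * X k w)" if "j \<in> {1..n}" "k \<in> {1..n}" for j k
    using that X_bound c_nonneg by (intro integrable_const_bound[of _ "c * c"]) (auto simp: abs_mult intro!: mult_mono)
  have "var_S = (\<Sum>j\<in>{1..n}. \<Sum>k\<in>{1..n}. expectation (\<lambda>w. X j w * X k w))"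
    unfolding var_S_def by (rule expectation_sum_square(1)[OF int])
  also have "\<dots> = (\<Sum>j\<in>{1..n}. \<Sum>k | k \<in> {1..n} \<and> \<not> far K j k. expectation (\<lambda>w. X j w * X k w))"
    using far_uncorrelated by (intro sum.cong refl sum.mono_neutral_right) auto
  finally show ?thesis .
qed

private definition "dpsi s = (\<integral>w. \<i> * S w * iexp (s * S w) \<partial>M)"

private lemma S_bound: "w \<in> space M \<Longrightarrow> \<bar>S w\<bar> \<le> n * c"
  by (rule order_trans[OF sum_abs], rule order_trans[OF sum_mono[of _ _ "\<lambda>_. c"]]) (auto intro: X_bound)

private lemma dpsi_bound: "cmod (dpsi s + s * var_S * psi s) \<le> n * (5 * c ^ 3 * s\<^sup>2 * (2 * real K + 1)\<^sup>2)"
proof -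
  have "dpsi s = (\<integral>w. (\<Sum>j\<in>{1..n}. \<i> * X j w * iexp (s * S w)) \<partial>M)"
    by (simp add: dpsi_def sum_distrib_left sum_distrib_right)
  also have "\<dots> = (\<Sum>j\<in>{1..n}. \<integral>w. \<i> * X j w * iexp (s * S w) \<partial>M)"
  proof (rule Bochner_Integration.integral_sum)
    fix j assume j: "j \<in> {1..n}"
    show "integrable M (\<lambda>w. \<i> * X j w * iexp (s * S w))"
      by (rule integrable_const_bound[of _ c]) (use j X_bound in \<open>auto simp: norm_mult\<close>)
  qed
  finally have "dpsi s + s * var_S * psi s = (\<Sum>j\<in>{1..n}. (\<integral>w. \<i> * X j w * iexp (s * S w) \<partial>M) +
      s * (\<Sum>k | k \<in> {1..n} \<and> \<not> far K j k. expectation (\<lambda>w. X j w * X k w)) * psi s)"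
    unfolding var_S_eq by (simp add: sum.distrib sum_distrib_left[symmetric] sum_distrib_right[symmetric])
  then show ?thesis
    using sum_norm_bound[of "{1..n}" "\<lambda>j. (\<integral>w. \<i> * X j w * iexp (s * S w) \<partial>M) +
      s * (\<Sum>k | k \<in> {1..n} \<and> \<not> far K j k. expectation (\<lambda>w. X j w * X k w)) * psi s"
      "5 * c ^ 3 * s\<^sup>2 * (2 * real K + 1)\<^sup>2"] char_ode_summand by simp
qed

text \<open>As S is bounded, the second-order remainder of the exponential is at most a constant
  times (t - s)^2, uniformly on the space. Integrating this bound gives the derivative.\<close>

private lemma psi_deriv: "(psi has_vector_derivative dpsi s) (at s)"
  unfolding has_vector_derivative_def has_derivative_at_alt
proof (intro conjI allI impI)
  show "bounded_linear (\<lambda>x. x *\<^sub>R dpsi s)" by (rule bounded_linear_scaleR_left)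
  fix e :: real assume e: "0 < e"
  define B where "B = (n * c)\<^sup>2 / 2"
  have B: "0 \<le> B" by (simp add: B_def)
  have int: "integrable M (\<lambda>w. iexp (t * S w))" "integrable M (\<lambda>w. \<i> * S w * iexp (t * S w))" for t
    using integrable_bounded_iexp[of "\<lambda>_. 1" "\<lambda>w. t * S w" 1]
      integrable_bounded_iexp[of S "\<lambda>w. t * S w" "n * c"] S_bound by (auto simp: mult.assoc)
  have *: "cmod (psi t - psi s - (t - s) *\<^sub>R dpsi s) \<le> (t - s)\<^sup>2 * B" for t
  proof -
    have "cmod ((\<integral>w. iexp (t * S w) \<partial>M) - (\<integral>w. iexp (s * S w) + (t - s) * (\<i> * S w * iexp (s * S w)) \<partial>M)) \<le> (t - s)\<^sup>2 * B"
    proof (rule norm_integral_diff_le_bound)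
      fix w assume w: "w \<in> space M"
      have "iexp (t * S w) - (iexp (s * S w) + (t - s) * (\<i> * S w * iexp (s * S w)))
        = iexp (s * S w) * (iexp ((t - s) * S w) - 1 - \<i> * ((t - s) * S w))"
        by (simp add: algebra_simps exp_add[symmetric] del: of_real_sum)
      then have "cmod (iexp (t * S w) - (iexp (s * S w) + (t - s) * (\<i> * S w * iexp (s * S w)))) \<le> ((t - s) * S w)\<^sup>2 / 2"
        using norm_iexp_minus_linear_le[of "(t - s) * S w"]
        by (simp add: norm_mult del: of_real_mult of_real_sum of_real_diff)
      also have "\<dots> \<le> (t - s)\<^sup>2 * B"
      proof -
        have "(S w)\<^sup>2 \<le> (n * c)\<^sup>2"
          using power_mono[OF S_bound[OF w] abs_ge_zero, of 2] by simp
        from mult_left_mono[OF this, of "(t - s)\<^sup>2"] show ?thesis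
          by (simp add: B_def power_mult_distrib)
      qed
      finally show "cmod (iexp (t * S w) - (iexp (s * S w) + (t - s) * (\<i> * S w * iexp (s * S w)))) \<le> (t - s)\<^sup>2 * B" .
    qed (use int in auto)
    then show ?thesis using int by (simp add: psi_def dpsi_def scaleR_conv_of_real diff_diff_eq)
  qed
  show "\<exists>d>0. \<forall>t. norm (t - s) < d \<longrightarrow> norm (psi t - psi s - (t - s) *\<^sub>R dpsi s) \<le> e * norm (t - s)"
  \<comment> \<open>The summand 1 keeps the quotient defined when B is 0.\<close>
  proof (intro exI[of _ "e / (B + 1)"] conjI allI impI)
    fix t assume t: "norm (t - s) < e / (B + 1)"
    have "(t - s)\<^sup>2 * B = \<bar>t - s\<bar> * (\<bar>t - s\<bar> * B)"
      by (simp add: power2_eq_square flip: mult.assoc abs_mult)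
    also have "\<dots> \<le> \<bar>t - s\<bar> * e"
      using t B by (intro mult_left_mono) (auto simp: field_simps)
    finally show "norm (psi t - psi s - (t - s) *\<^sub>R dpsi s) \<le> e * norm (t - s)"
      using *[of t] by (simp add: mult.commute)
  qed (use e B in auto)
qed

text \<open>Tikhomirov's variant of Stein's method: the characteristic function of \<open>S\<close> nearly solves
  the differential equation \<open>\<psi>' = - s Var(S) \<psi>\<close> of the Gaussian one.\<close>

lemma char_m_dependent_sum:
  "cmod ((\<integral>w. iexp (s * (\<Sum>i\<in>{1..n}. X i w)) \<partial>M) -
      exp (- (s\<^sup>2 * expectation (\<lambda>w. (\<Sum>i\<in>{1..n}. X i w)\<^sup>2) / 2)))
    \<le> 5 * real n * c ^ 3 * (2 * real K + 1)\<^sup>2 * \<bar>s\<bar> ^ 3"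
proof -
  define v where "v = var_S"
  have v: "0 \<le> v" by (simp add: v_def var_S_def)
  \<comment> \<open>Integrating factor: for an exact solution of the Gaussian equation f would be
    constantly 1. Its distance from 1 at \<open>s\<close> is at most |s| times a bound of its
    derivative on the segment from 0 to \<open>s\<close>.\<close>
  define f where "f u = psi u * complex_of_real (exp (v * u\<^sup>2 / 2))" for u
  define B where "B = 5 * real n * c ^ 3 * (2 * real K + 1)\<^sup>2 * s\<^sup>2 * exp (v * s\<^sup>2 / 2)"
  have "norm (f s - f 0) \<le> B * norm (s - 0)"
  proof (rule differentiable_bound[where S = "closed_segment 0 s" and f = f and
        f' = "\<lambda>u h. h *\<^sub>R ((dpsi u + u * v * psi u) * complex_of_real (exp (v * u\<^sup>2 / 2)))"])
    fix u assume u: "u \<in> closed_segment 0 s"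
    have "((\<lambda>u. complex_of_real (exp (v * u\<^sup>2 / 2))) has_vector_derivative complex_of_real (exp (v * u\<^sup>2 / 2) * (v * u))) (at u)"
      by (auto intro!: derivative_eq_intros)
    from has_vector_derivative_mult[OF psi_deriv this]
    have "(f has_vector_derivative (dpsi u + u * v * psi u) * complex_of_real (exp (v * u\<^sup>2 / 2))) (at u)"
      unfolding f_def by (simp add: algebra_simps)
    then show "(f has_derivative (\<lambda>h. h *\<^sub>R ((dpsi u + u * v * psi u) * complex_of_real (exp (v * u\<^sup>2 / 2))))) (at u within closed_segment 0 s)"
      by (auto simp: has_vector_derivative_def intro: has_derivative_at_withinI)
    have us: "u\<^sup>2 \<le> s\<^sup>2"
      using u by (auto simp: closed_segment_eq_real_ivl abs_le_square_iff[symmetric] split: if_splits)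
    have "cmod (dpsi u + u * v * psi u) * exp (v * u\<^sup>2 / 2) \<le> (n * (5 * c ^ 3 * u\<^sup>2 * (2 * real K + 1)\<^sup>2)) * exp (v * s\<^sup>2 / 2)"
      using dpsi_bound[of u] us v by (intro mult_mono) (auto simp: v_def[symmetric] mult_left_mono c_nonneg intro: order_trans[OF norm_ge_zero])
    also have "\<dots> \<le> (n * (5 * c ^ 3 * s\<^sup>2 * (2 * real K + 1)\<^sup>2)) * exp (v * s\<^sup>2 / 2)"
      using us c_nonneg by (intro mult_right_mono mult_left_mono) auto
    also have "\<dots> = B" by (simp add: B_def)
    finally have "norm ((dpsi u + u * v * psi u) * complex_of_real (exp (v * u\<^sup>2 / 2))) \<le> B"
      by (simp add: norm_mult)
    then show "onorm (\<lambda>h. h *\<^sub>R ((dpsi u + u * v * psi u) * complex_of_real (exp (v * u\<^sup>2 / 2)))) \<le> B"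
      by (intro onorm_le) (simp only: norm_scaleR real_norm_def mult.commute[of B] mult_left_mono abs_ge_zero)
  qed auto
  moreover have "f 0 = 1" by (simp add: f_def psi_def prob_space)
  ultimately have "cmod (f s - 1) \<le> B * \<bar>s\<bar>" by simp
  \<comment> \<open>Multiplying back cancels the factor exp(v s^2 / 2) contained in
    \<open>B\<close>, so the final bound is free of the variance.\<close>
  moreover have "psi s - exp (- (s\<^sup>2 * v / 2)) = (f s - 1) * complex_of_real (exp (- (s\<^sup>2 * v / 2)))"
  proof -
    have "complex_of_real (exp (v * s\<^sup>2 / 2)) * complex_of_real (exp (- (s\<^sup>2 * v / 2))) = 1"
      unfolding of_real_mult[symmetric] exp_add[symmetric] by (simp add: mult.commute)
    then show ?thesis by (simp add: f_def left_diff_distrib mult.assoc)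
  qed
  ultimately have "cmod (psi s - exp (- (s\<^sup>2 * v / 2))) \<le> B * \<bar>s\<bar> * exp (- (s\<^sup>2 * v / 2))"
    by (simp add: norm_mult mult_right_mono)
  also have "\<dots> = 5 * real n * c ^ 3 * (2 * real K + 1)\<^sup>2 * (s\<^sup>2 * \<bar>s\<bar>) * (exp (v * s\<^sup>2 / 2) * exp (- (s\<^sup>2 * v / 2)))"
    by (simp add: B_def)
  also have "exp (v * s\<^sup>2 / 2) * exp (- (s\<^sup>2 * v / 2)) = 1" unfolding exp_add[symmetric] by (simp add: mult.commute)
  also have "s\<^sup>2 * \<bar>s\<bar> = \<bar>s\<bar> ^ 3" by (simp add: power2_eq_square power3_eq_cube abs_mult[symmetric])
  finally show ?thesis by (simp add: psi_def v_def var_S_def)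
qed

end

end

section \<open>Degenerate part of the U-statistic\<close>

context prob_space
begin

lemma distr_pair_swap_self: "distr M2 M2 (\<lambda>z. (snd z, fst z)) = M \<Otimes>\<^sub>M M"
proof -
  interpret P: pair_prob_space M M ..
  show ?thesis using P.distr_pair_swap by (simp add: split_beta')
qed

text \<open>The perturbation hypotheses change the first argument of the kernel only. Exchanging the
  coordinates and using symmetry transfers them to the second.\<close>

lemma L2_le_swap:
  assumes "L2_le M2 F c"
  shows "L2_le M2 (\<lambda>z. F (snd z, fst z)) c"
proof -
  have [measurable]: "F \<in> borel_measurable M2" using assms by auto
  have "L2_le (distr M2 M2 (\<lambda>z. (snd z, fst z))) F c"
    using assms by (simp add: distr_pair_swap_self)
  then show ?thesis by (subst (asm) L2_le_distr) auto
qed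

lemma integral_pair_swap:
  fixes F :: "'a \<times> 'a \<Rightarrow> real"
  assumes [measurable]: "F \<in> borel_measurable M2"
  shows "(\<integral>z. F (snd z, fst z) \<partial>M2) = (\<integral>z. F z \<partial>M2)"
proof -
  have "(\<integral>z. F z \<partial>M2) = (\<integral>z. F z \<partial>distr M2 M2 (\<lambda>z. (snd z, fst z)))"
    by (simp add: distr_pair_swap_self)
  also have "\<dots> = (\<integral>z. F (snd z, fst z) \<partial>M2)"
    by (subst integral_distr) auto
  finally show ?thesis by simp
qed

lemma prob_space_pair: "prob_space M2"
proof -
  interpret P: pair_prob_space M M ..
  show ?thesis by unfold_locales
qed

text \<open>Each of the \<open>card F\<close> rows of the covariance matrix has at most
  \<open>c\<close> nonzero entries, each bounded by \<open>b * b\<close> through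
  Cauchy-Schwarz.\<close>

lemma L2_le_sum_sparse:
  fixes D :: "'i \<Rightarrow> 'a \<Rightarrow> real"
  assumes fin: "finite F" and D: "\<And>p. p \<in> F \<Longrightarrow> L2_le M (D p) b" and b: "0 \<le> b"
    and sparse: "\<And>p. p \<in> F \<Longrightarrow> card {q\<in>F. expectation (\<lambda>w. D p w * D q w) \<noteq> 0} \<le> c"
  shows "L2_le M (\<lambda>w. \<Sum>p\<in>F. D p w) (sqrt (real (card F) * real c) * b)"
proof (rule L2_leI)
  note DD = L2_le_mult[OF D D]
  have "expectation (\<lambda>w. (\<Sum>p\<in>F. D p w)\<^sup>2) = (\<Sum>p\<in>F. \<Sum>q\<in>F. expectation (\<lambda>w. D p w * D q w))"
    by (rule expectation_sum_square(1)[OF DD(1)])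
  also have "\<dots> \<le> (\<Sum>p\<in>F. real c * (b * b))"
  proof (rule sum_mono)
    fix p assume p: "p \<in> F"
    let ?Q = "{q\<in>F. expectation (\<lambda>w. D p w * D q w) \<noteq> 0}"
    have "(\<Sum>q\<in>F. expectation (\<lambda>w. D p w * D q w)) = (\<Sum>q\<in>?Q. expectation (\<lambda>w. D p w * D q w))"
      using fin by (intro sum.mono_neutral_right) auto
    also have "\<dots> \<le> (\<Sum>q\<in>?Q. b * b)"
      using DD(3)[OF p] by (intro sum_mono) (auto simp: abs_le_iff)
    also have "\<dots> \<le> real c * (b * b)"
      using sparse[OF p] b by (simp only: sum_constant) (intro mult_right_mono, auto)
    finally show "(\<Sum>q\<in>F. expectation (\<lambda>w. D p w * D q w)) \<le> real c * (b * b)" .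
  qed
  finally show "expectation (\<lambda>w. (\<Sum>p\<in>F. D p w)\<^sup>2) \<le> (sqrt (real (card F) * real c) * b)\<^sup>2"
    by (simp add: power_mult_distrib power2_eq_square[of b] mult.assoc)
  show "(\<lambda>w. \<Sum>p\<in>F. D p w) \<in> borel_measurable M"
    by (intro borel_measurable_sum) (use D in blast)
  show "integrable M (\<lambda>w. (\<Sum>p\<in>F. D p w)\<^sup>2)"
    by (rule expectation_sum_square(2)[OF DD(1)])
qed (use b in simp)

text \<open>Linearity of the inner integral holds only where both sections are integrable, hence
  almost everywhere; elsewhere the integral has its default value 0.\<close>

lemma L2_le_marginal_diff:
  assumes F: "L2_le M2 F b" and G: "L2_le M2 G c"
    and FG: "L2_le M2 (\<lambda>z. F z - G z) d"
  shows "L2_le M (\<lambda>x. (\<integral>y. F (x, y) \<partial>M) - (\<integral>y. G (x, y) \<partial>M)) d"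
proof (rule L2_le_mono[OF L2_le_marginal[OF FG]])
  interpret P: pair_prob_space M M ..
  have [measurable]: "F \<in> borel_measurable M2" "G \<in> borel_measurable M2"
    using F G by auto
  show "(\<lambda>x. (\<integral>y. F (x, y) \<partial>M) - (\<integral>y. G (x, y) \<partial>M)) \<in> borel_measurable M" by measurable
  show "AE x in M. \<bar>(\<integral>y. F (x, y) \<partial>M) - (\<integral>y. G (x, y) \<partial>M)\<bar> \<le> \<bar>\<integral>y. F (x, y) - G (x, y) \<partial>M\<bar>"
    using P.AE_integrable_fst'[OF prob_space.L2_le_integrable(1)[OF prob_space_pair F]]
      P.AE_integrable_fst'[OF prob_space.L2_le_integrable(1)[OF prob_space_pair G]]
    by eventually_elim simp
qed simp

end

section \<open>Windows of the base sequence and bounds for the kernel\<close>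

definition base_algebra :: "'a measure \<Rightarrow> 'e measure \<Rightarrow> (int \<Rightarrow> 'a \<Rightarrow> 'e) \<Rightarrow> int set \<Rightarrow> 'a measure" where
  "base_algebra M N \<E> A = sigma (space M) (\<Union>t\<in>A. {\<E> t -` B \<inter> space M |B. B \<in> sets N})"

text \<open>In \<open>base_algebra\<close> the index set is arbitrary because unions of windows
  occur, both for several kernel arguments at once and for the blocks in
  \<open>m_dependent\<close>.\<close>

lemma base_sigma_eq: "base_sigma M N \<E> s t = base_algebra M N \<E> {s..t}"
  by (simp add: base_sigma_def base_algebra_def)

definition window :: "nat \<Rightarrow> nat \<Rightarrow> int set" where
  "window i k = {int i - int (k div 2)..int i + int ((k + 1) div 2)}"

lemma window_mono: "k \<le> l \<Longrightarrow> window i k \<subseteq> window i l"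
  by (auto simp: window_def)

text \<open>The right half of one window and the left half of the other have total length
  \<open>(k + 1) div 2 + k div 2 = k\<close>, so a lag larger than \<open>k\<close> separates
  them.\<close>

lemma window_disjoint: "far k i j \<Longrightarrow> window i k \<inter> window j k = {}"
  by (auto simp: window_def far_def)

lemma space_base_algebra [simp]: "space (base_algebra M N \<E> A) = space M"
  unfolding base_algebra_def by (rule space_measure_of) auto

lemma sets_base_algebra:
  "sets (base_algebra M N \<E> A) = sigma_sets (space M) (\<Union>t\<in>A. {\<E> t -` B \<inter> space M |B. B \<in> sets N})"
  unfolding base_algebra_def by (rule sets_measure_of) auto

lemma measurable_base_algebra_mono:
  assumes "A \<subseteq> A'" "f \<in> measurable (base_algebra M N \<E> A) Q"
  shows "f \<in> measurable (base_algebra M N \<E> A') Q"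
proof -
  have "sets (base_algebra M N \<E> A) \<subseteq> sets (base_algebra M N \<E> A')"
    unfolding sets_base_algebra using assms(1) by (intro sigma_sets_mono') auto
  then show ?thesis using assms(2) by (auto simp: measurable_def)
qed

lemma (in prob_space) measurable_from_base_algebra:
  assumes base: "indep_vars (\<lambda>_. N) \<E> UNIV" and f: "f \<in> measurable (base_algebra M N \<E> A) Q"
  shows "f \<in> measurable M Q"
proof -
  have "sets (base_algebra M N \<E> A) \<subseteq> sets M"
    unfolding sets_base_algebra using base
    by (intro sets.sigma_sets_subset) (auto simp: indep_vars_def2 intro: measurable_sets)
  then show ?thesis using f by (auto simp: measurable_def)
qed

definition proj :: "'a measure \<Rightarrow> ('w \<Rightarrow> 'w \<Rightarrow> real) \<Rightarrow> ('a \<Rightarrow> 'w) \<Rightarrow> 'w \<Rightarrow> real" where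
  "proj M f Z x = (\<integral>w. f x (Z w) \<partial>M)"

text \<open>Only the consequences of near-epoch dependence that enter variances are kept:
  \<open>V i k\<close> is measurable for its window and costs \<open>a k\<close> in either argument.
  Independent copies are already coordinates of \<open>M2\<close>. The moment bound concerns the
  joint law on \<open>M\<close>; it passes to the product law only at far lag.\<close>

locale ned_kernel = prob_space M for M :: "'a measure" +
  fixes N :: "'e measure" and \<E> :: "int \<Rightarrow> 'a \<Rightarrow> 'e"
    and W :: "nat \<Rightarrow> 'a \<Rightarrow> 'w::euclidean_space" and V :: "nat \<Rightarrow> nat \<Rightarrow> 'a \<Rightarrow> 'w"
    and \<phi> :: "'w \<Rightarrow> 'w \<Rightarrow> real" and a :: "nat \<Rightarrow> real" and B :: real
  assumes base: "indep_vars (\<lambda>_. N) \<E> UNIV"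
    and W_meas [measurable]: "\<And>i. 1 \<le> i \<Longrightarrow> W i \<in> borel_measurable M"
    and V_window: "\<And>i k. 1 \<le> i \<Longrightarrow> V i k \<in> borel_measurable (base_algebra M N \<E> (window i k))"
    and kernel_meas: "case_prod \<phi> \<in> borel_measurable borel2"
    and kernel_sym: "\<And>x y. \<phi> x y = \<phi> y x"
    and pert_W: "\<And>i j k. 1 \<le> i \<Longrightarrow> 1 \<le> j \<Longrightarrow> i \<noteq> j \<Longrightarrow>
      L2_le M (\<lambda>w. \<phi> (W i w) (W j w) - \<phi> (V i k w) (W j w)) (a k)"
    and pert_V: "\<And>i j k. 1 \<le> i \<Longrightarrow> 1 \<le> j \<Longrightarrow> i \<noteq> j \<Longrightarrow>
      L2_le M (\<lambda>w. \<phi> (W i w) (V j k w) - \<phi> (V i k w) (V j k w)) (a k)"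
    and pert_W_copy: "\<And>i j k. 1 \<le> i \<Longrightarrow> 1 \<le> j \<Longrightarrow> i \<noteq> j \<Longrightarrow>
      L2_le M2 (\<lambda>z. \<phi> (W i (fst z)) (W j (snd z)) - \<phi> (V i k (fst z)) (W j (snd z))) (a k)"
    and pert_V_copy: "\<And>i j k. 1 \<le> i \<Longrightarrow> 1 \<le> j \<Longrightarrow> i \<noteq> j \<Longrightarrow>
      L2_le M2 (\<lambda>z. \<phi> (W i (fst z)) (V j k (snd z)) - \<phi> (V i k (fst z)) (V j k (snd z))) (a k)"
    and bound_V: "\<And>i j k. 1 \<le> i \<Longrightarrow> 1 \<le> j \<Longrightarrow> i \<noteq> j \<Longrightarrow> L2_le M (\<lambda>w. \<phi> (V i k w) (V j k w)) B"
    and kernel_centred: "\<And>i j. 1 \<le> i \<Longrightarrow> 1 \<le> j \<Longrightarrow> i \<noteq> j \<Longrightarrow>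
      (\<integral>z. \<phi> (W i (fst z)) (W j (snd z)) \<partial>M2) = 0"
begin

abbreviation "\<F> \<equiv> base_algebra M N \<E>"

sublocale P: pair_prob_space M M ..

lemma kernel_comp [measurable (raw)]:
  "f \<in> borel_measurable Q \<Longrightarrow> g \<in> borel_measurable Q \<Longrightarrow> (\<lambda>x. \<phi> (f x) (g x)) \<in> borel_measurable Q"
  using measurable_compose[OF measurable_Pair kernel_meas, of f Q g] by simp

lemmas measurable_base_algebra = measurable_from_base_algebra[OF base]

lemma V_meas [measurable]: "1 \<le> i \<Longrightarrow> V i k \<in> borel_measurable M"
  by (rule measurable_base_algebra[OF V_window])

lemma decoupled_base:
  assumes disj: "A \<inter> A' = {}"
    and X: "X \<in> measurable (\<F> A) S" and Y: "Y \<in> measurable (\<F> A') T"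
  shows "decoupled S X T Y"
proof (rule decoupledI)
  let ?E = "\<lambda>t. {\<E> t -` B \<inter> space M |B. B \<in> sets N}"
  have "indep_sets (\<lambda>b. sigma_sets (space M) (\<Union>t\<in>case_bool A A' b. ?E t)) UNIV"
  proof (rule indep_sets_collect_sigma)
    show "indep_sets ?E (\<Union>b\<in>UNIV. case_bool A A' b)"
      using base unfolding indep_vars_def2 by (auto intro: indep_sets_mono_index)
    show "Int_stable (?E t)" for t
    proof (rule Int_stableI)
      fix C D assume "C \<in> ?E t" "D \<in> ?E t"
      then obtain C' D' where "C = \<E> t -` C' \<inter> space M" "D = \<E> t -` D' \<inter> space M" "C' \<in> sets N" "D' \<in> sets N"
        by blast
      then have "C \<inter> D = \<E> t -` (C' \<inter> D') \<inter> space M" "C' \<inter> D' \<in> sets N" by auto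
      then show "C \<inter> D \<in> ?E t" by blast
    qed
    show "disjoint_family_on (case_bool A A') UNIV"
      using disj by (auto simp: disjoint_family_on_def split: bool.split)
  qed
  also have "(\<lambda>b. sigma_sets (space M) (\<Union>t\<in>case_bool A A' b. ?E t)) =
      case_bool (sets (\<F> A)) (sets (\<F> A'))"
    by (auto simp: sets_base_algebra fun_eq_iff split: bool.split)
  finally have ind: "indep_set (sets (\<F> A)) (sets (\<F> A'))"
    by (simp add: indep_set_def)
  fix C D assume "C \<in> sets S" "D \<in> sets T"
  then have "X -` C \<inter> space M \<in> sets (\<F> A)" "Y -` D \<inter> space M \<in> sets (\<F> A')"
    using measurable_sets[OF X] measurable_sets[OF Y] by auto
  then show "prob ((X -` C \<inter> space M) \<inter> (Y -` D \<inter> space M)) = prob (X -` C \<inter> space M) * prob (Y -` D \<inter> space M)"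
    by (rule indep_setD[OF ind])
qed (use X Y in \<open>auto intro: measurable_base_algebra\<close>)

lemma V_decoupled:
  "1 \<le> i \<Longrightarrow> 1 \<le> j \<Longrightarrow> far k i j \<Longrightarrow> decoupled borel (V i k) borel (V j k)"
  by (rule decoupled_base[OF window_disjoint V_window V_window])

lemma a_nonneg: "0 \<le> a k"
  using pert_W[of 1 2] by auto

lemma B_nonneg: "0 \<le> B"
  using bound_V[of 1 2] by auto

lemma bound_V_copy_far:
  assumes "1 \<le> i" "1 \<le> j" "far k i j"
  shows "L2_le M2 (\<lambda>z. \<phi> (V i k (fst z)) (V j k (snd z))) B"
proof -
  have "i \<noteq> j" using assms by (auto simp: far_def)
  then show ?thesis
    using decoupled_L2_le[OF V_decoupled[OF assms], of "\<lambda>p. \<phi> (fst p) (snd p)" B] bound_V[of i j k] assms by simp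
qed

text \<open>The arguments are changed one at a time. For the second one the hypothesis for the
  exchanged indices is used, after a swap of the coordinates.\<close>

lemma kernel_copy_diff:
  assumes ij: "1 \<le> i" "1 \<le> j" "i \<noteq> j"
  shows "L2_le M2 (\<lambda>z. \<phi> (W i (fst z)) (W j (snd z)) - \<phi> (V i k (fst z)) (V j k (snd z))) (2 * a k)"
proof -
  have "L2_le M2 (\<lambda>z. \<phi> (W j (snd z)) (V i k (fst z)) - \<phi> (V j k (snd z)) (V i k (fst z))) (a k)"
    using L2_le_swap[OF pert_V_copy[of j i k]] ij by simp
  from L2_le_add[OF pert_W_copy[OF ij, of k] this] show ?thesis
    by (simp add: kernel_sym[of _ "V i k _"])
qed

lemma kernel_diff:
  assumes ij: "1 \<le> i" "1 \<le> j" "i \<noteq> j"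
  shows "L2_le M (\<lambda>w. \<phi> (W i w) (W j w) - \<phi> (V i k w) (V j k w)) (2 * a k)"
  using L2_le_add[OF pert_W[OF ij, of k] pert_V[of j i k]] ij
  by (simp add: kernel_sym[of _ "V i k _"])

text \<open>\<open>B\<close> plus the error of passing from \<open>V i 0\<close> to
  \<open>W i\<close> in both arguments.\<close>

definition B1 :: real where "B1 = B + 2 * a 0"

lemma B_le_B1: "B \<le> B1" "0 \<le> B1"
  using a_nonneg[of 0] B_nonneg by (auto simp: B1_def)

lemma bound_W:
  assumes ij: "1 \<le> i" "1 \<le> j" "i \<noteq> j"
  shows "L2_le M (\<lambda>w. \<phi> (W i w) (W j w)) B1"
  using L2_le_add[OF bound_V[OF ij, of 0] kernel_diff[OF ij, of 0]] by (simp add: B1_def)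

text \<open>At level 0 a window is a single time and \<open>far 0 i j\<close> just means that
  \<open>i\<close> and \<open>j\<close> differ. So the joint bound at level 0 becomes a bound under
  the product law for every such pair.\<close>

lemma bound_W_copy:
  assumes ij: "1 \<le> i" "1 \<le> j" "i \<noteq> j"
  shows "L2_le M2 (\<lambda>z. \<phi> (W i (fst z)) (W j (snd z))) B1"
  using L2_le_add[OF bound_V_copy_far[of i j 0] kernel_copy_diff[OF ij, of 0]] ij
  by (simp add: B1_def far_def neq_iff)

section \<open>Projections and the completely degenerate kernel\<close>

lemma proj_meas [measurable (raw)]:
  assumes [measurable]: "f \<in> borel_measurable Q" "Z \<in> borel_measurable M"
  shows "(\<lambda>x. proj M \<phi> Z (f x)) \<in> borel_measurable Q"
  unfolding proj_def by measurable

lemma proj_W_bound: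
  assumes ij: "1 \<le> i" "1 \<le> j" "i \<noteq> j"
  shows "L2_le M (\<lambda>w. proj M \<phi> (W j) (W i w)) B1"
  using L2_le_marginal[OF bound_W_copy[OF ij]] by (simp add: proj_def)

lemma proj_V_bound:
  assumes ij: "1 \<le> i" "1 \<le> j" "far k i j"
  shows "L2_le M (\<lambda>w. proj M \<phi> (V j k) (V i k w)) B"
  using L2_le_marginal[OF bound_V_copy_far[OF ij]] by (simp add: proj_def)

lemma proj_diff:
  assumes ij: "1 \<le> i" "1 \<le> j" "far k i j"
  shows "L2_le M (\<lambda>w. proj M \<phi> (W j) (W i w) - proj M \<phi> (V j k) (V i k w)) (2 * a k)"
proof -
  have "i \<noteq> j" using ij by (auto simp: far_def)
  from L2_le_marginal_diff[OF bound_W_copy[OF ij(1,2) this] bound_V_copy_far[OF ij] kernel_copy_diff[OF ij(1,2) this]]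
  show ?thesis by (simp add: proj_def)
qed

text \<open>The kernel is centred at \<open>W\<close> only. Replacing \<open>W\<close> by
  \<open>V\<close> leaves this mean, which \<open>theta_bound\<close> shows to be of the order of
  the replacement error.\<close>

definition theta :: "nat \<Rightarrow> nat \<Rightarrow> nat \<Rightarrow> real" where
  "theta k i j = (\<integral>z. \<phi> (V i k (fst z)) (V j k (snd z)) \<partial>M2)"

lemma theta_sym: "1 \<le> i \<Longrightarrow> 1 \<le> j \<Longrightarrow> theta k i j = theta k j i"
  using integral_pair_swap[of "\<lambda>z. \<phi> (V i k (fst z)) (V j k (snd z))"]
  by (simp add: theta_def kernel_sym[of _ "V i k _"])

lemma theta_bound:
  assumes ij: "1 \<le> i" "1 \<le> j" "far k i j"
  shows "\<bar>theta k i j\<bar> \<le> B" "\<bar>theta k i j\<bar> \<le> 2 * a k"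
proof -
  have ne: "i \<noteq> j" using ij by (auto simp: far_def)
  note int = prob_space.L2_le_integrable[OF prob_space_pair]
  show "\<bar>theta k i j\<bar> \<le> B" unfolding theta_def by (rule int(3)[OF bound_V_copy_far[OF ij]])
  have "(\<integral>z. \<phi> (W i (fst z)) (W j (snd z)) - \<phi> (V i k (fst z)) (V j k (snd z)) \<partial>M2) = - theta k i j"
    using int(1)[OF bound_V_copy_far[OF ij]] int(1)[OF bound_W_copy[OF ij(1,2) ne]] kernel_centred[OF ij(1,2) ne]
    by (simp add: theta_def)
  then show "\<bar>theta k i j\<bar> \<le> 2 * a k"
    using int(3)[OF kernel_copy_diff[OF ij(1,2) ne, of k]] by simp
qed

text \<open>The second-order term of Hoeffding's decomposition for independent arguments distributed
  as \<open>V i k\<close> and \<open>V j k\<close>. It depends on the indices because the sequence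
  need not be stationary.\<close>

definition degen :: "nat \<Rightarrow> nat \<Rightarrow> nat \<Rightarrow> 'w \<Rightarrow> 'w \<Rightarrow> real" where
  "degen k i j x y = \<phi> x y - proj M \<phi> (V j k) x - proj M \<phi> (V i k) y + theta k i j"

lemma degen_sym: "1 \<le> i \<Longrightarrow> 1 \<le> j \<Longrightarrow> degen k i j x y = degen k j i y x"
  by (simp add: degen_def theta_sym[of i j] kernel_sym[of x y])

lemma degen_meas [measurable (raw)]:
  assumes [measurable]: "f \<in> borel_measurable Q" "g \<in> borel_measurable Q" and ij: "1 \<le> i" "1 \<le> j"
  shows "(\<lambda>x. degen k i j (f x) (g x)) \<in> borel_measurable Q"
  unfolding degen_def using ij by measurable

text \<open>This holds for every \<open>y\<close>: when the section of the kernel at \<open>y\<close> is not integrable, both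
  the integral and \<open>proj M \<phi> (V i k) y\<close> are \<open>0\<close>.\<close>

lemma degen_section:
  assumes ij: "1 \<le> i" "1 \<le> j" "far k i j"
  shows "(\<integral>w. degen k i j (V i k w) y \<partial>M) = 0"
proof -
  have [measurable]: "V i k \<in> borel_measurable M" "V j k \<in> borel_measurable M" using ij by auto
  have "(\<integral>w. proj M \<phi> (V j k) (V i k w) \<partial>M) = theta k i j"
    unfolding theta_def proj_def
    by (subst P.integral_fst'[symmetric, OF prob_space.L2_le_integrable(1)[OF prob_space_pair bound_V_copy_far[OF ij]]]) simp
  moreover have hint: "integrable M (\<lambda>w. proj M \<phi> (V j k) (V i k w))"
    by (rule L2_le_integrable(1)[OF proj_V_bound[OF ij]])
  moreover have sec: "(\<integral>w. \<phi> (V i k w) y \<partial>M) = proj M \<phi> (V i k) y"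
    by (simp add: proj_def kernel_sym[of y])
  ultimately show ?thesis
  proof (cases "integrable M (\<lambda>w. \<phi> (V i k w) y)")
    case True
    then show ?thesis
      using \<open>(\<integral>w. proj M \<phi> (V j k) (V i k w) \<partial>M) = theta k i j\<close> hint sec
      by (simp add: degen_def prob_space)
  next
    case False
    have "\<not> integrable M (\<lambda>w. degen k i j (V i k w) y)"
    proof
      assume "integrable M (\<lambda>w. degen k i j (V i k w) y)"
      then have "integrable M (\<lambda>w. degen k i j (V i k w) y + (proj M \<phi> (V j k) (V i k w) + (proj M \<phi> (V i k) y - theta k i j)))"
        using hint by (intro Bochner_Integration.integrable_add) auto
      then show False using False by (simp add: degen_def)
    qed
    then show ?thesis by (rule not_integrable_integral_eq)
  qed
qed

lemma degen_bound:
  assumes ij: "1 \<le> i" "1 \<le> j" "far k i j"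
  shows "L2_le M (\<lambda>w. degen k i j (V i k w) (V j k w)) (4 * B)"
proof -
  have ne: "i \<noteq> j" using ij by (auto simp: far_def)
  show ?thesis
    using L2_le_add[OF L2_le_diff[OF L2_le_diff[OF bound_V[OF ij(1,2) ne, of k] proj_V_bound[OF ij]]
        proj_V_bound[of j i k]] L2_le_const[OF theta_bound(1)[OF ij]]] ij
    by (simp add: degen_def far_commute)
qed

text \<open>The index \<open>l\<close> is far from the other three, so \<open>V l k\<close> is
  independent of the remaining variables together and can be integrated first. Only the second
  factor contains it, and that integral vanishes by \<open>degen_section\<close>. The index
  \<open>l'\<close> may coincide with \<open>i\<close> or \<open>j\<close>.\<close>

lemma degen_uncorrelated:
  assumes pos: "1 \<le> i" "1 \<le> j" "1 \<le> l" "1 \<le> l'" and far: "far k i j" "far k l l'" "far k l i" "far k l j"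
  shows "expectation (\<lambda>w. degen k i j (V i k w) (V j k w) * degen k l l' (V l k w) (V l' k w)) = 0"
proof -
  define Y where "Y = (\<lambda>w. (V i k w, V j k w, V l' k w))"
  define F where "F = (\<lambda>p::'w \<times> 'w \<times> 'w \<times> 'w. degen k i j (fst (snd p)) (fst (snd (snd p))) * degen k l l' (fst p) (snd (snd (snd p))))"
  have [measurable]: "V i k \<in> borel_measurable M" "V j k \<in> borel_measurable M" "V l k \<in> borel_measurable M" "V l' k \<in> borel_measurable M"
    using pos by auto
  have dec: "decoupled borel (V l k) (borel \<Otimes>\<^sub>M borel \<Otimes>\<^sub>M borel) Y"
  proof (rule decoupled_base)
    show "window l k \<inter> (window i k \<union> window j k \<union> window l' k) = {}"
      using window_disjoint far by blast
    have "V i k \<in> borel_measurable (\<F> (window i k \<union> window j k \<union> window l' k))"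
      "V j k \<in> borel_measurable (\<F> (window i k \<union> window j k \<union> window l' k))"
      "V l' k \<in> borel_measurable (\<F> (window i k \<union> window j k \<union> window l' k))"
      using pos by (auto intro: measurable_base_algebra_mono[OF _ V_window])
    then show "Y \<in> measurable (\<F> (window i k \<union> window j k \<union> window l' k)) (borel \<Otimes>\<^sub>M borel \<Otimes>\<^sub>M borel)"
      unfolding Y_def by measurable
  qed (rule V_window[OF pos(3)])
  have Fm: "F \<in> borel_measurable (borel \<Otimes>\<^sub>M borel \<Otimes>\<^sub>M borel \<Otimes>\<^sub>M borel)"
    unfolding F_def using pos by measurable
  note eq = decoupled_integral[OF dec Fm]
  \<comment> \<open>Fubini needs the product to be integrable. The variables of the two factors may
    overlap, so this comes from Cauchy-Schwarz.\<close>
  have "integrable M (\<lambda>w. F (V l k w, Y w))"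
    using L2_le_mult(1)[OF degen_bound[OF pos(1,2) far(1)] degen_bound[OF pos(3,4) far(2)]]
    by (simp add: F_def Y_def)
  then have int: "integrable M2 (\<lambda>(x, y). F (V l k x, Y y))"
    using eq(2) by (simp add: split_beta')
  have "expectation (\<lambda>w. degen k i j (V i k w) (V j k w) * degen k l l' (V l k w) (V l' k w)) =
      (\<integral>z. F (V l k (fst z), Y (snd z)) \<partial>M2)"
    unfolding eq(1)[symmetric] by (simp add: F_def Y_def)
  also have "\<dots> = (\<integral>y. \<integral>x. F (V l k x, Y y) \<partial>M \<partial>M)"
    using P.integral_snd[OF int] by (simp add: split_beta')
  also have "\<dots> = (\<integral>y. degen k i j (V i k y) (V j k y) * (\<integral>x. degen k l l' (V l k x) (V l' k y) \<partial>M) \<partial>M)"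
    by (simp add: F_def Y_def)
  also have "\<dots> = 0" using degen_section[OF pos(3,4) far(2)] by simp
  finally show ?thesis .
qed

text \<open>A pair (l, l') is correlated with (i, j) only if each of \<open>l\<close> and
  \<open>l'\<close> is near \<open>i\<close> or \<open>j\<close>: at most (4 k + 2)^2 possibilities
  for each of at most n^2 pairs. The square root of the product is n (4 k + 2).\<close>

lemma degen_sum_bound:
  "L2_le M (\<lambda>w. \<Sum>i\<in>{1..n}. \<Sum>j\<in>{j\<in>{1..n}. far k i j}. degen k i j (V i k w) (V j k w))
    (real n * (4 * real k + 2) * (4 * B))"
proof -
  define F where "F = Sigma {1..n} (\<lambda>i. {j\<in>{1..n}. far k i j})"
  define D where "D = (\<lambda>(i, j) w. degen k i j (V i k w) (V j k w))"
  have "L2_le M (\<lambda>w. \<Sum>p\<in>F. D p w) (sqrt (real (card F) * real ((4 * k + 2)\<^sup>2)) * (4 * B))"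
  proof (rule L2_le_sum_sparse)
    show "finite F" by (auto simp: F_def)
    show "L2_le M (D p) (4 * B)" if "p \<in> F" for p
      using that degen_bound by (auto simp: F_def D_def)
    fix p assume "p \<in> F"
    then obtain i j where p: "p = (i, j)" "i \<in> {1..n}" "j \<in> {1..n}" "far k i j" by (auto simp: F_def)
    define Q where "Q = {l\<in>{1..n}. \<not> far k i l} \<union> {l\<in>{1..n}. \<not> far k j l}"
    have "{q\<in>F. expectation (\<lambda>w. D p w * D q w) \<noteq> 0} \<subseteq> Q \<times> Q"
    proof
      fix q assume "q \<in> {q\<in>F. expectation (\<lambda>w. D p w * D q w) \<noteq> 0}"
      then obtain l l' where q: "q = (l, l')" "l \<in> {1..n}" "l' \<in> {1..n}" "far k l l'"
        and ne: "expectation (\<lambda>w. D p w * D q w) \<noteq> 0" by (auto simp: F_def)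
      have "\<not> (far k l i \<and> far k l j)"
        using degen_uncorrelated[of i j l l' k] p q ne by (auto simp: D_def)
      \<comment> \<open>The same argument with \<open>l\<close> and \<open>l'\<close> exchanged,
        which \<open>degen_sym\<close> permits.\<close>
      moreover have "\<not> (far k l' i \<and> far k l' j)"
        using degen_uncorrelated[of i j l' l k] p q ne
        by (auto simp: D_def degen_sym[of l l'] far_commute[of k l l'])
      ultimately show "q \<in> Q \<times> Q" using q by (auto simp: Q_def far_commute)
    qed
    then have "card {q\<in>F. expectation (\<lambda>w. D p w * D q w) \<noteq> 0} \<le> card (Q \<times> Q)"
      by (rule card_mono[rotated]) (simp add: Q_def)
    also have "\<dots> \<le> (4 * k + 2)\<^sup>2"
    proof -
      have "card Q \<le> (2 * k + 1) + (2 * k + 1)"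
        unfolding Q_def by (rule order_trans[OF card_Un_le]) (intro add_mono card_near_le)
      then have Q: "card Q \<le> 4 * k + 2" by simp
      show ?thesis unfolding card_cartesian_product power2_eq_square by (rule mult_le_mono[OF Q Q])
    qed
    finally show "card {q\<in>F. expectation (\<lambda>w. D p w * D q w) \<noteq> 0} \<le> (4 * k + 2)\<^sup>2" .
  qed (use B_nonneg in simp)
  moreover have "sqrt (real (card F) * real ((4 * k + 2)\<^sup>2)) * (4 * B) \<le> real n * (4 * real k + 2) * (4 * B)"
  proof (rule mult_right_mono)
    have "card F \<le> card ({1..n} \<times> {1..n})" by (rule card_mono) (auto simp: F_def)
    then have "real (card F) \<le> (real n)\<^sup>2"
      by (simp add: power2_eq_square flip: of_nat_mult)
    then have "sqrt (real (card F) * (4 * real k + 2)\<^sup>2) \<le> sqrt ((real n)\<^sup>2 * (4 * real k + 2)\<^sup>2)"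
      by (intro real_sqrt_le_mono mult_right_mono) auto
    then show "sqrt (real (card F) * real ((4 * k + 2)\<^sup>2)) \<le> real n * (4 * real k + 2)"
      by (simp add: real_sqrt_mult add.commute)
  qed (use B_nonneg in simp)
  ultimately have "L2_le M (\<lambda>w. \<Sum>p\<in>F. D p w) (real n * (4 * real k + 2) * (4 * B))"
    by (rule L2_le_weaken)
  moreover have "(\<Sum>i\<in>{1..n}. \<Sum>j\<in>{j\<in>{1..n}. far k i j}. degen k i j (V i k w) (V j k w)) = (\<Sum>p\<in>F. D p w)" for w
    unfolding F_def by (subst sum.Sigma) (auto simp: D_def intro!: sum.cong)
  ultimately show ?thesis by simp
qed

section \<open>Distance of the U-statistic from its projection\<close>

definition kproj :: "nat \<Rightarrow> nat \<Rightarrow> 'w \<Rightarrow> real" where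
  "kproj n i x = 1 / (real n - 1) * (\<Sum>j\<in>{1..n} - {i}. proj M \<phi> (W j) x)"

definition ksum :: "nat \<Rightarrow> 'a \<Rightarrow> real" where
  "ksum n w = (\<Sum>i\<in>{1..n}. kproj n i (W i w))"

text \<open>After removal of both projections, a far pair differs from its degenerate kernel by a
  multiple of \<open>a k\<close>. A near pair is merely bounded, but there are at most
  \<open>2 * k + 1\<close> of them for each \<open>i\<close>. The degenerate kernels are summed with
  \<open>degen_sum_bound\<close>, where cancellation saves a factor of order n / k.\<close>

lemma U_stat_projection:
  assumes n: "2 \<le> n"
  shows "L2_le M (\<lambda>w. U_stat \<phi> W n w - 2 / real n * ksum n w)
    (11 * (2 * real k + 1) * B1 / (real n - 1) + 8 * a k)"
proof -
  define p where "p i j w = \<phi> (W i w) (W j w) - proj M \<phi> (W j) (W i w) - proj M \<phi> (W i) (W j w)" for i j w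
  define q where "q i j w = degen k i j (V i k w) (V j k w)" for i j w
  define Fa where "Fa i = {j\<in>{1..n}. far k i j}" for i
  define Ne where "Ne i = {j\<in>{1..n} - {i}. \<not> far k i j}" for i
  have split: "{1..n} - {i} = Fa i \<union> Ne i" if "i \<in> {1..n}" for i
    by (auto simp: Fa_def Ne_def far_def)
  have fin: "finite (Fa i)" "finite (Ne i)" "Fa i \<inter> Ne i = {}" for i
    by (auto simp: Fa_def Ne_def)
  have near: "L2_le M (p i j) (3 * B1)" if "i \<in> {1..n}" "j \<in> Ne i" for i j
  proof -
    have ij: "1 \<le> i" "1 \<le> j" "i \<noteq> j" using that by (auto simp: Ne_def)
    have "L2_le M (p i j) (B1 + B1 + B1)" unfolding p_def
      by (intro L2_le_diff bound_W proj_W_bound) (use ij in auto)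
    then show ?thesis by simp
  qed
  \<comment> \<open>Four contributions of \<open>2 * a k\<close>: the kernel, the two projections,
    and \<open>theta\<close>, which has no counterpart in \<open>p\<close>.\<close>
  have far: "L2_le M (\<lambda>w. p i j w - q i j w) (8 * a k)" if "i \<in> {1..n}" "j \<in> Fa i" for i j
  proof -
    have ij: "1 \<le> i" "1 \<le> j" "far k i j" "far k j i" "i \<noteq> j"
      using that by (auto simp: Fa_def far_commute) (auto simp: far_def)
    show ?thesis
      using L2_le_diff[OF L2_le_diff[OF L2_le_diff[OF kernel_diff[OF ij(1,2,5), of k] proj_diff[OF ij(1,2,3)]]
        proj_diff[OF ij(2,1,4)]] L2_le_const[OF theta_bound(2)[OF ij(1,2,3)]]]
      by (simp add: p_def q_def degen_def algebra_simps)
  qed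
  define S where "S w = (\<Sum>i\<in>{1..n}. \<Sum>j\<in>{1..n} - {i}. p i j w)" for w
  have S_eq: "S w = (\<Sum>i\<in>{1..n}. \<Sum>j\<in>Fa i. p i j w - q i j w) +
      (\<Sum>i\<in>{1..n}. \<Sum>j\<in>Ne i. p i j w) + (\<Sum>i\<in>{1..n}. \<Sum>j\<in>Fa i. q i j w)" for w
  proof -
    have "S w = (\<Sum>i\<in>{1..n}. (\<Sum>j\<in>Fa i. p i j w) + (\<Sum>j\<in>Ne i. p i j w))"
      unfolding S_def by (intro sum.cong refl) (simp only: split sum.union_disjoint fin)
    then show ?thesis by (simp add: sum.distrib sum_subtractf)
  qed
  have L: "L2_le M S ((\<Sum>i\<in>{1..n}. \<Sum>j\<in>Fa i. 8 * a k) + (\<Sum>i\<in>{1..n}. \<Sum>j\<in>Ne i. 3 * B1) + real n * (4 * real k + 2) * (4 * B))"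
    unfolding S_eq
  proof (intro L2_le_add)
    show "L2_le M (\<lambda>w. \<Sum>i\<in>{1..n}. \<Sum>j\<in>Fa i. q i j w) (real n * (4 * real k + 2) * (4 * B))"
      unfolding Fa_def q_def by (rule degen_sum_bound)
  qed (intro L2_le_sum near far; assumption)+
  have "(\<Sum>i\<in>{1..n}. \<Sum>j\<in>Fa i. 8 * a k) \<le> (\<Sum>i\<in>{1..n}. (real n - 1) * (8 * a k))"
  proof (rule sum_mono)
    fix i assume i: "i \<in> {1..n}"
    have "card (Fa i) \<le> card ({1..n} - {i})" using i by (intro card_mono) (auto simp: Fa_def far_def)
    also have "\<dots> = n - 1" using i by simp
    finally have "real (card (Fa i)) \<le> real n - 1" using n by linarith
    then show "(\<Sum>j\<in>Fa i. 8 * a k) \<le> (real n - 1) * (8 * a k)"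
      using a_nonneg[of k] by (simp only: sum_constant) (intro mult_right_mono, auto)
  qed
  moreover have "(\<Sum>i\<in>{1..n}. \<Sum>j\<in>Ne i. 3 * B1) \<le> (\<Sum>i\<in>{1..n}. (2 * real k + 1) * (3 * B1))"
  proof (rule sum_mono)
    fix i assume i: "i \<in> {1..n}"
    have "real (card (Ne i)) \<le> 2 * real k + 1"
      using card_near_le[of "{1..n} - {i}" k i] by (simp add: Ne_def)
    then show "(\<Sum>j\<in>Ne i. 3 * B1) \<le> (2 * real k + 1) * (3 * B1)"
      using B_le_B1 by (simp only: sum_constant) (intro mult_right_mono, auto)
  qed
  moreover have "real n * (4 * real k + 2) * (4 * B) \<le> real n * (4 * real k + 2) * (4 * B1)"
    using B_le_B1 by (intro mult_left_mono) auto
  ultimately have "L2_le M S (real n * ((real n - 1) * (8 * a k)) + real n * ((2 * real k + 1) * (3 * B1)) + real n * (4 * real k + 2) * (4 * B1))"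
    using L2_le_weaken[OF L] by (simp only: sum_constant card_atLeastAtMost diff_Suc_1 add_mono)
  \<comment> \<open>Since 4 k + 2 = 2 (2 k + 1), the constant is 11 = 3 + 8: the bound
    \<open>3 * B1\<close> for near pairs, and 2 times \<open>4 * B1\<close> from the degenerate
    sum.\<close>
  moreover have "real n * ((real n - 1) * (8 * a k)) + real n * ((2 * real k + 1) * (3 * B1)) + real n * (4 * real k + 2) * (4 * B1) =
      real n * ((real n - 1) * (8 * a k) + 11 * (2 * real k + 1) * B1)"
    by (simp add: algebra_simps)
  ultimately have "L2_le M (\<lambda>w. 1 / (real n * (real n - 1)) * S w)
      (\<bar>1 / (real n * (real n - 1))\<bar> * (real n * ((real n - 1) * (8 * a k) + 11 * (2 * real k + 1) * B1)))"
    by (metis L2_le_cmult)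
  also have "\<bar>1 / (real n * (real n - 1))\<bar> * (real n * ((real n - 1) * (8 * a k) + 11 * (2 * real k + 1) * B1)) =
      11 * (2 * real k + 1) * B1 / (real n - 1) + 8 * a k"
    using n by (simp add: field_simps)
  also have "(\<lambda>w. 1 / (real n * (real n - 1)) * S w) =
      (\<lambda>w. U_stat \<phi> W n w - 2 / real n * ksum n w)"
  proof
    fix w
    \<comment> \<open>Exchanging the order of summation turns one projection sum into the other,
      whence the factor 2 in front of \<open>ksum\<close>.\<close>
    define G where "G = (\<Sum>i\<in>{1..n}. \<Sum>j\<in>{1..n} - {i}. proj M \<phi> (W j) (W i w))"
    have "(\<Sum>i\<in>{1..n}. \<Sum>j\<in>{1..n} - {i}. proj M \<phi> (W i) (W j w)) =
        (\<Sum>i\<in>{1..n}. \<Sum>j | j \<in> {1..n} \<and> j \<noteq> i. proj M \<phi> (W i) (W j w))"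
      by (intro sum.cong refl) auto
    also have "\<dots> = (\<Sum>j\<in>{1..n}. \<Sum>i | i \<in> {1..n} \<and> j \<noteq> i. proj M \<phi> (W i) (W j w))"
      by (rule sum.swap_restrict) auto
    also have "\<dots> = G"
      unfolding G_def by (intro sum.cong refl) auto
    finally have G2: "(\<Sum>i\<in>{1..n}. \<Sum>j\<in>{1..n} - {i}. proj M \<phi> (W i) (W j w)) = G" .
    have S: "S w = (\<Sum>i\<in>{1..n}. \<Sum>j\<in>{1..n} - {i}. \<phi> (W i w) (W j w)) - G - G"
      unfolding S_def p_def sum_subtractf G2 by (simp add: G_def)
    have K: "ksum n w = 1 / (real n - 1) * G"
      unfolding ksum_def kproj_def G_def by (rule sum_distrib_left[symmetric])
    show "1 / (real n * (real n - 1)) * S w =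
        U_stat \<phi> W n w - 2 / real n * ksum n w"
      unfolding U_stat_def K S by (simp add: diff_divide_distrib)
  qed
  finally show ?thesis .
qed

end

section \<open>Projections and the central limit theorem\<close>

definition clamp :: "real \<Rightarrow> real \<Rightarrow> real" where
  "clamp T x = max (- T) (min T x)"

lemma clamp_meas [measurable]: "clamp T \<in> borel_measurable borel"
  unfolding clamp_def[abs_def] by measurable

lemma abs_clamp_le: "0 \<le> T \<Longrightarrow> \<bar>clamp T x\<bar> \<le> T"
  by (auto simp: clamp_def)

text \<open>The truncation error lives on the tail event, which is what uniform integrability
  controls.\<close>

lemma abs_diff_clamp_le: "\<bar>x - clamp T x\<bar> \<le> \<bar>if \<bar>x\<bar> > T then x else 0\<bar>" if "0 \<le> T"
  using that by (auto simp: clamp_def)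

text \<open>The errors \<open>a\<close> need not be monotone and may vanish, so a positive
  decreasing majorant \<open>c\<close> takes their place. \<open>c_rate\<close> serves the first
  \<open>K\<close> lags in \<open>q_err\<close>, where the approximation error does not yet decay.
  The truncation level is uniform in the indices and in the window length.\<close>

locale ned_kernel_rate = ned_kernel +
  fixes c :: "nat \<Rightarrow> real" and C0 :: real
  assumes a_le: "\<And>k. a k \<le> c k" and c_pos: "\<And>k. 0 < c k" and c_antimono: "\<And>k l. k \<le> l \<Longrightarrow> c l \<le> c k"
    and c_summable: "summable c" and c_rate: "\<And>k. real k * c k \<le> C0"
    and truncation: "\<And>e. 0 < e \<Longrightarrow> \<exists>T\<ge>0. \<forall>i j k. 1 \<le> i \<longrightarrow> 1 \<le> j \<longrightarrow> i \<noteq> j \<longrightarrow>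
      L2_le M (\<lambda>w. \<phi> (V i k w) (V j k w) - clamp T (\<phi> (V i k w) (V j k w))) e"
begin

lemma L2_le_average:
  assumes "2 \<le> n" "i \<in> {1..n}" "\<And>j. j \<in> {1..n} - {i} \<Longrightarrow> L2_le M (f j) b"
  shows "L2_le M (\<lambda>w. 1 / (real n - 1) * (\<Sum>j\<in>{1..n} - {i}. f j w)) b"
proof -
  have "L2_le M (\<lambda>w. \<Sum>j\<in>{1..n} - {i}. f j w) (\<Sum>j\<in>{1..n} - {i}. b)"
    by (rule L2_le_sum) (use assms in auto)
  also have "(\<Sum>j\<in>{1..n} - {i}. b) = (real n - 1) * b"
    using assms by (simp add: of_nat_diff)
  finally have "L2_le M (\<lambda>w. 1 / (real n - 1) * (\<Sum>j\<in>{1..n} - {i}. f j w)) (\<bar>1 / (real n - 1)\<bar> * ((real n - 1) * b))"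
    by (rule L2_le_cmult)
  then show ?thesis using assms(1) by simp
qed

lemma kproj_meas [measurable (raw)]:
  assumes [measurable]: "f \<in> borel_measurable Q"
  shows "(\<lambda>x. kproj n i (f x)) \<in> borel_measurable Q"
  unfolding kproj_def by measurable

lemma kproj_W_bound: "2 \<le> n \<Longrightarrow> i \<in> {1..n} \<Longrightarrow> L2_le M (\<lambda>w. kproj n i (W i w)) B1"
  unfolding kproj_def by (rule L2_le_average) (auto intro!: proj_W_bound)

text \<open>The error is \<open>a k\<close> and not twice that: only the argument is replaced, while
  the integrated variable stays \<open>W j\<close>.\<close>

lemma kproj_diff:
  assumes n: "2 \<le> n" and i: "i \<in> {1..n}"
  shows "L2_le M (\<lambda>w. kproj n i (W i w) - kproj n i (V i k w)) (a k)"
proof -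
  have "L2_le M (\<lambda>w. proj M \<phi> (W j) (W i w) - proj M \<phi> (W j) (V i k w)) (a k)" if "j \<in> {1..n} - {i}" for j
  proof -
    have ij: "1 \<le> i" "1 \<le> j" "i \<noteq> j" using i that by auto
    have "L2_le M2 (\<lambda>z. \<phi> (V i k (fst z)) (W j (snd z))) (B1 + a k)"
      using L2_le_diff[OF bound_W_copy[OF ij] pert_W_copy[OF ij, of k]] by simp
    from L2_le_marginal_diff[OF bound_W_copy[OF ij] this pert_W_copy[OF ij]]
    show ?thesis by (simp add: proj_def)
  qed
  from L2_le_average[OF n i this] show ?thesis
    by (simp only: kproj_def sum_subtractf right_diff_distrib)
qed

lemma kproj_mean:
  assumes n: "2 \<le> n" and i: "i \<in> {1..n}"
  shows "expectation (\<lambda>w. kproj n i (W i w)) = 0"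
proof -
  have "expectation (\<lambda>w. proj M \<phi> (W j) (W i w)) = 0" if "j \<in> {1..n} - {i}" for j
  proof -
    have ij: "1 \<le> i" "1 \<le> j" "i \<noteq> j" using i that by auto
    have "expectation (\<lambda>w. proj M \<phi> (W j) (W i w)) = (\<integral>z. \<phi> (W i (fst z)) (W j (snd z)) \<partial>M2)"
      unfolding proj_def
      by (subst P.integral_fst'[symmetric, OF prob_space.L2_le_integrable(1)[OF prob_space_pair bound_W_copy[OF ij]]]) simp
    then show ?thesis using kernel_centred[OF ij] by simp
  qed
  moreover have "integrable M (\<lambda>w. proj M \<phi> (W j) (W i w))" if "j \<in> {1..n} - {i}" for j
    using L2_le_integrable(1)[OF proj_W_bound] i that by auto
  ultimately show ?thesis by (simp add: kproj_def)
qed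

lemma kproj_V_bound:
  assumes "2 \<le> n" "i \<in> {1..n}"
  shows "L2_le M (\<lambda>w. kproj n i (V i k w)) (B1 + a k)"
  using L2_le_diff[OF kproj_W_bound[OF assms] kproj_diff[OF assms, of k]] by simp

definition c_sum :: real where "c_sum = suminf c"

lemma sum_c_le: "(\<Sum>k<n. c k) \<le> c_sum"
  unfolding c_sum_def using c_summable c_pos by (intro sum_le_suminf) (auto intro: less_imp_le)

lemma c_sum_nonneg: "0 \<le> c_sum"
  using sum_c_le[of 0] by simp

text \<open>The constant per index from \<open>L2_le_sum_approximable\<close> with b =
  \<open>B1 + c 0\<close>; the second summand ensures that every \<open>c k\<close> is at most
  b.\<close>

definition CS :: real where "CS = sqrt ((B1 + c 0)\<^sup>2 + 8 * (B1 + c 0) * c_sum)"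

lemma kproj_sum_bound:
  assumes n: "2 \<le> n"
  shows "L2_le M (ksum n) (sqrt (real n) * CS)"
proof -
  have "L2_le M (\<lambda>w. \<Sum>i\<in>{1..n}. kproj n i (W i w)) (sqrt (real n * ((B1 + c 0)\<^sup>2 + 8 * (B1 + c 0) * (\<Sum>k<n. c k))))"
  proof (rule L2_le_sum_approximable[where Z = "\<lambda>i k w. kproj n i (V i k w)"])
    fix i k assume i: "i \<in> {1..n}"
    show "L2_le M (\<lambda>w. kproj n i (W i w)) (B1 + c 0)"
      by (rule L2_le_weaken[OF kproj_W_bound[OF n i]]) (use c_pos[of 0] in simp)
    show "L2_le M (\<lambda>w. kproj n i (W i w) - kproj n i (V i k w)) (c k)"
      by (rule L2_le_weaken[OF kproj_diff[OF n i] a_le])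
    show "expectation (\<lambda>w. kproj n i (W i w)) = 0" by (rule kproj_mean[OF n i])
    fix j assume j: "j \<in> {1..n}" "far k i j"
    have ij: "1 \<le> i" "1 \<le> j" using i j by auto
    show "expectation (\<lambda>w. kproj n i (V i k w) * kproj n j (V j k w)) =
        expectation (\<lambda>w. kproj n i (V i k w)) * expectation (\<lambda>w. kproj n j (V j k w))"
      by (rule decoupled_mult[OF V_decoupled[OF ij j(2)]])
        (use L2_le_integrable(1)[OF kproj_V_bound[OF n]] i j in auto)
  next
    show "0 \<le> c k" for k using c_pos[of k] by simp
    show "c k \<le> B1 + c 0" for k using c_antimono[of 0 k] B_le_B1 by simp
  qed
  moreover have "sqrt (real n * ((B1 + c 0)\<^sup>2 + 8 * (B1 + c 0) * (\<Sum>k<n. c k))) \<le> sqrt (real n) * CS"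
    unfolding CS_def real_sqrt_mult[symmetric]
    using sum_c_le[of n] B_le_B1 c_pos[of 0]
    by (intro real_sqrt_le_mono mult_left_mono add_left_mono) auto
  ultimately show ?thesis unfolding ksum_def[abs_def] by (rule L2_le_weaken)
qed

section \<open>Truncated projections and approximation by m-dependent sums\<close>

abbreviation "cproj K T j \<equiv> proj M (\<lambda>x y. clamp T (\<phi> x y)) (V j K)"

text \<open>Only far \<open>j\<close> are kept, because the truncation error is known under the
  joint law, which is the product law at far lag only. The omitted terms contribute a fixed multiple
  of 1 / (n - 1), so the normalisation can stay the same.\<close>

definition tproj :: "nat \<Rightarrow> nat \<Rightarrow> real \<Rightarrow> nat \<Rightarrow> 'c \<Rightarrow> real" where
  "tproj n K T i x = 1 / (real n - 1) * (\<Sum>j\<in>{j\<in>{1..n}. far K i j}. cproj K T j x)"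

lemma tproj_meas [measurable (raw)]:
  assumes [measurable]: "f \<in> borel_measurable Q"
  shows "(\<lambda>x. tproj n K T i (f x)) \<in> borel_measurable Q"
  unfolding tproj_def proj_def by measurable

lemma tproj_bound:
  assumes n: "2 \<le> n" and i: "i \<in> {1..n}" and T: "0 \<le> T"
  shows "\<bar>tproj n K T i x\<bar> \<le> T"
proof -
  have "\<bar>cproj K T j x\<bar> \<le> T" if "1 \<le> j" for j
    unfolding proj_def using that by (intro L2_le_integrable(3) L2_le_bounded abs_clamp_le T) auto
  then have "\<bar>\<Sum>j\<in>{j\<in>{1..n}. far K i j}. cproj K T j x\<bar> \<le> (\<Sum>j\<in>{j\<in>{1..n}. far K i j}. T)"
    by (intro order_trans[OF sum_abs] sum_mono) auto
  also have "\<dots> \<le> (\<Sum>j\<in>{1..n} - {i}. T)"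
    using T by (intro sum_mono2) (auto simp: far_def)
  also have "\<dots> = (real n - 1) * T" using n i by (simp add: of_nat_diff)
  finally have "\<bar>\<Sum>j\<in>{j\<in>{1..n}. far K i j}. cproj K T j x\<bar> \<le> (real n - 1) * T" .
  then have "1 / (real n - 1) * \<bar>\<Sum>j\<in>{j\<in>{1..n}. far K i j}. cproj K T j x\<bar> \<le>
      1 / (real n - 1) * ((real n - 1) * T)"
    using n by (intro mult_left_mono) auto
  then show ?thesis using n by (simp add: tproj_def abs_mult)
qed

lemma proj_clamp_diff:
  assumes T: "0 \<le> T"
    and trunc: "L2_le M (\<lambda>w. \<phi> (V i K w) (V j K w) - clamp T (\<phi> (V i K w) (V j K w))) e"
    and ij: "1 \<le> i" "1 \<le> j" "far K i j"
  shows "L2_le M (\<lambda>w. proj M \<phi> (W j) (W i w) - cproj K T j (V i K w)) (2 * a K + e)"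
proof -
  have [measurable]: "V i K \<in> borel_measurable M" "V j K \<in> borel_measurable M" using ij by auto
  have "L2_le M2 (\<lambda>z. \<phi> (V i K (fst z)) (V j K (snd z)) - clamp T (\<phi> (V i K (fst z)) (V j K (snd z)))) e"
    using decoupled_L2_le[OF V_decoupled[OF ij], of "\<lambda>p. \<phi> (fst p) (snd p) - clamp T (\<phi> (fst p) (snd p))" e] trunc
    by simp
  from L2_le_marginal_diff[OF bound_V_copy_far[OF ij] _ this]
  have "L2_le M (\<lambda>w. proj M \<phi> (V j K) (V i K w) - cproj K T j (V i K w)) e"
    if "L2_le M2 (\<lambda>z. clamp T (\<phi> (V i K (fst z)) (V j K (snd z)))) T"
    using that by (simp add: proj_def)
  moreover have "L2_le M2 (\<lambda>z. clamp T (\<phi> (V i K (fst z)) (V j K (snd z)))) T"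
    by (intro prob_space.L2_le_bounded[OF prob_space_pair] abs_clamp_le T) auto
  ultimately have "L2_le M (\<lambda>w. proj M \<phi> (V j K) (V i K w) - cproj K T j (V i K w)) e"
    by blast
  from L2_le_add[OF proj_diff[OF ij] this] show ?thesis by simp
qed

text \<open>Each far term costs \<open>2 * a K\<close> for the window and \<open>e\<close> for the
  truncation, and these costs are averaged. At most \<open>2 * K + 1\<close> near terms are dropped,
  each of size \<open>B1\<close>.\<close>

lemma kproj_tproj_diff:
  assumes n: "2 \<le> n" and i: "i \<in> {1..n}" and T: "0 \<le> T" and e: "0 \<le> e"
    and trunc: "\<And>i j. 1 \<le> i \<Longrightarrow> 1 \<le> j \<Longrightarrow> i \<noteq> j \<Longrightarrow>
      L2_le M (\<lambda>w. \<phi> (V i K w) (V j K w) - clamp T (\<phi> (V i K w) (V j K w))) e"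
  shows "L2_le M (\<lambda>w. kproj n i (W i w) - tproj n K T i (V i K w))
    (2 * a K + e + (2 * real K + 1) * B1 / (real n - 1))"
proof -
  define Fa where "Fa = {j\<in>{1..n}. far K i j}"
  define Ne where "Ne = {j\<in>{1..n} - {i}. \<not> far K i j}"
  have split: "{1..n} - {i} = Fa \<union> Ne" by (auto simp: Fa_def Ne_def far_def)
  have fin: "finite Fa" "finite Ne" "Fa \<inter> Ne = {}" by (auto simp: Fa_def Ne_def)
  define p where "p j w = proj M \<phi> (W j) (W i w)" for j w
  define q where "q j w = cproj K T j (V i K w)" for j w
  have "L2_le M (\<lambda>w. (\<Sum>j\<in>Fa. p j w - q j w) + (\<Sum>j\<in>Ne. p j w)) ((\<Sum>j\<in>Fa. 2 * a K + e) + (\<Sum>j\<in>Ne. B1))"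
  proof (intro L2_le_add L2_le_sum)
    fix j assume "j \<in> Fa"
    then have ij: "1 \<le> i" "1 \<le> j" "far K i j" "i \<noteq> j" using i by (auto simp: Fa_def) (auto simp: far_def)
    show "L2_le M (\<lambda>w. p j w - q j w) (2 * a K + e)"
      unfolding p_def q_def by (rule proj_clamp_diff[OF T trunc[OF ij(1,2,4)] ij(1-3)])
  next
    fix j assume "j \<in> Ne"
    then show "L2_le M (p j) B1"
      unfolding p_def using i by (intro proj_W_bound) (auto simp: Ne_def)
  qed
  moreover have "(\<Sum>j\<in>Fa. 2 * a K + e) + (\<Sum>j\<in>Ne. B1) \<le> (real n - 1) * (2 * a K + e) + (2 * real K + 1) * B1"
  proof (rule add_mono)
    have "card Fa \<le> card ({1..n} - {i})" using i by (intro card_mono) (auto simp: Fa_def far_def)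
    also have "\<dots> = n - 1" using i by simp
    finally have "real (card Fa) \<le> real n - 1" using n by linarith
    then show "(\<Sum>j\<in>Fa. 2 * a K + e) \<le> (real n - 1) * (2 * a K + e)"
      using a_nonneg[of K] e by (simp only: sum_constant) (intro mult_right_mono, auto)
    have "real (card Ne) \<le> 2 * real K + 1"
      using card_near_le[of "{1..n} - {i}" K i] by (simp add: Ne_def)
    then show "(\<Sum>j\<in>Ne. B1) \<le> (2 * real K + 1) * B1"
      using B_le_B1 by (simp only: sum_constant) (intro mult_right_mono, auto)
  qed
  ultimately have "L2_le M (\<lambda>w. (\<Sum>j\<in>Fa. p j w - q j w) + (\<Sum>j\<in>Ne. p j w)) ((real n - 1) * (2 * a K + e) + (2 * real K + 1) * B1)"
    by (rule L2_le_weaken)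
  then have "L2_le M (\<lambda>w. 1 / (real n - 1) * ((\<Sum>j\<in>Fa. p j w - q j w) + (\<Sum>j\<in>Ne. p j w)))
      (\<bar>1 / (real n - 1)\<bar> * ((real n - 1) * (2 * a K + e) + (2 * real K + 1) * B1))"
    by (rule L2_le_cmult)
  moreover have "\<bar>1 / (real n - 1)\<bar> * ((real n - 1) * (2 * a K + e) + (2 * real K + 1) * B1) =
      2 * a K + e + (2 * real K + 1) * B1 / (real n - 1)"
  proof -
    have "real n - 1 > 0" using n by simp
    then show ?thesis by (simp add: add_divide_distrib)
  qed
  moreover have "1 / (real n - 1) * ((\<Sum>j\<in>Fa. p j w - q j w) + (\<Sum>j\<in>Ne. p j w)) =
      kproj n i (W i w) - tproj n K T i (V i K w)" for w
    unfolding kproj_def tproj_def Fa_def[symmetric] split sum.union_disjoint[OF fin] p_def q_def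
    by (simp add: sum_subtractf right_diff_distrib distrib_left)
  ultimately show ?thesis by simp
qed

text \<open>The variance per index that \<open>L2_le_sum_approximable\<close> gives for the
  remainder, with b = \<open>8 * c K\<close>. The first \<open>K\<close> lags contribute b each, the
  later ones at most \<open>c_sum\<close> together.\<close>

definition q_err :: "nat \<Rightarrow> real" where
  "q_err K = (8 * c K)\<^sup>2 + 8 * (8 * c K) * (real K * (8 * c K) + c_sum)"

text \<open>A termwise bound on the remainder would lose a factor sqrt n. Instead the remainder is
  treated as a sum of approximable variables in its own right, so that both its small summands and
  its decaying covariances are used.\<close>

lemma m_dependent_approximation:
  "\<exists>T\<ge>0. \<forall>\<^sub>F n in sequentially. \<exists>X. (\<forall>i\<in>{1..n}. X i \<in> borel_measurable M \<and>
      (\<forall>w\<in>space M. \<bar>X i w\<bar> \<le> T) \<and> expectation (X i) = 0) \<and> m_dependent K n X \<and>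
      L2_le M (\<lambda>w. ksum n w - (\<Sum>i\<in>{1..n}. X i w)) (sqrt (real n) * sqrt (q_err K))"
  (is "\<exists>T\<ge>0. \<forall>\<^sub>F n in sequentially. ?P T n")
proof -
  obtain T where T: "0 \<le> T" and trunc: "\<And>i j. 1 \<le> i \<Longrightarrow> 1 \<le> j \<Longrightarrow> i \<noteq> j \<Longrightarrow>
      L2_le M (\<lambda>w. \<phi> (V i K w) (V j K w) - clamp T (\<phi> (V i K w) (V j K w))) (c K)"
    using truncation[OF c_pos[of K]] by blast
  have "(\<lambda>n. (2 * real K + 1) * B1 / (real n - 1)) \<longlonglongrightarrow> 0"
    by (rule tendsto_divide_0[OF tendsto_const]) real_asymp
  from order_tendstoD(2)[OF this c_pos[of K]]
  have ev: "\<forall>\<^sub>F n in sequentially. (2 * real K + 1) * B1 / (real n - 1) < c K \<and> 2 \<le> n"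
    by (rule eventually_conj) (rule eventually_ge_at_top)
  have "?P (2 * T) n"
    if n': "(2 * real K + 1) * B1 / (real n - 1) < c K \<and> 2 \<le> n" for n
  proof -
    have n: "2 \<le> n" using n' by simp
    define Y where "Y i w = tproj n K T i (V i K w)" for i w
    \<comment> \<open>Centring doubles the bound \<open>T\<close>, so the witness in the end is
      \<open>2 * T\<close>.\<close>
    define X where "X i w = Y i w - expectation (Y i)" for i w
    define D where "D i w = kproj n i (W i w) - X i w" for i w
    define b where "b = 8 * c K"
    have Y: "Y i \<in> borel_measurable M" "\<And>w. \<bar>Y i w\<bar> \<le> T" if "i \<in> {1..n}" for i
      using that tproj_bound[OF n that T] unfolding Y_def by auto
    have EY: "integrable M (Y i)" "\<bar>expectation (Y i)\<bar> \<le> T" if "i \<in> {1..n}" for i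
      using L2_le_integrable(1,3)[OF L2_le_bounded[of "Y i" T]] Y[OF that] T by auto
    have X: "X i \<in> borel_measurable M" "\<bar>X i w\<bar> \<le> 2 * T" "expectation (X i) = 0" "integrable M (X i)"
      if "i \<in> {1..n}" for i w
      using Y(1)[OF that] Y(2)[OF that, of w] EY[OF that] unfolding X_def by (auto simp: prob_space)
    have X_window: "X i \<in> borel_measurable (\<F> (window i K))" if "1 \<le> i" for i
      unfolding X_def Y_def using V_window[OF that] by measurable
    have dep: "m_dependent K n X"
      unfolding m_dependent_def
    proof (intro allI impI)
      fix I J assume IJ: "I \<subseteq> {1..n}" "J \<subseteq> {1..n}" "\<forall>i\<in>I. \<forall>j\<in>J. far K i j"
      show "decoupled (PiM I (\<lambda>_. borel)) (\<lambda>w. \<lambda>i\<in>I. X i w) (PiM J (\<lambda>_. borel)) (\<lambda>w. \<lambda>j\<in>J. X j w)"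
      proof (rule decoupled_base)
        show "(\<Union>i\<in>I. window i K) \<inter> (\<Union>j\<in>J. window j K) = {}"
          using window_disjoint IJ(3) by blast
        show "(\<lambda>w. \<lambda>i\<in>I. X i w) \<in> measurable (\<F> (\<Union>i\<in>I. window i K)) (PiM I (\<lambda>_. borel))"
          using IJ by (intro measurable_restrict measurable_base_algebra_mono[OF _ X_window]) auto
        show "(\<lambda>w. \<lambda>i\<in>J. X i w) \<in> measurable (\<F> (\<Union>i\<in>J. window i K)) (PiM J (\<lambda>_. borel))"
          using IJ by (intro measurable_restrict measurable_base_algebra_mono[OF _ X_window]) auto
      qed
    qed
    have D: "L2_le M (D i) b" if i: "i \<in> {1..n}" for i
    proof -
      note kt = kproj_tproj_diff[OF n i T less_imp_le[OF c_pos] trunc]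
      \<comment> \<open>Two units of \<open>c K\<close> for the windows, one for the truncation,
        chosen with error \<open>c K\<close>, and one for the near terms once n is large. Centring
        turns 4 into the 8 of \<open>b\<close>.\<close>
      have "L2_le M (\<lambda>w. kproj n i (W i w) - Y i w) (4 * c K)"
        unfolding Y_def by (rule L2_le_weaken[OF kt]) (use n' a_le[of K] in auto)
      from L2_le_centre[OF this] have "L2_le M (\<lambda>w. kproj n i (W i w) - Y i w -
          expectation (\<lambda>w. kproj n i (W i w) - Y i w)) b" by (simp add: b_def)
      moreover have "expectation (\<lambda>w. kproj n i (W i w) - Y i w) = - expectation (Y i)"
        using L2_le_integrable(1)[OF kproj_W_bound[OF n i]] EY(1)[OF i] kproj_mean[OF n i] by simp
      ultimately show ?thesis by (simp add: D_def[abs_def] X_def algebra_simps)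
    qed
    have "L2_le M (\<lambda>w. \<Sum>i\<in>{1..n}. D i w) (sqrt (real n * (b\<^sup>2 + 8 * b * (\<Sum>k<n. if k < K then b else c k))))"
    \<comment> \<open>Below level \<open>K\<close> the variable \<open>X i\<close> need not be
      measurable for the window of length \<open>k\<close>, and 0 is used as an approximation with
      error \<open>b\<close>. From \<open>K\<close> on the windows are nested, \<open>X i\<close> is
      kept, and only the argument of \<open>kproj\<close> is replaced, with error
      \<open>c k\<close>.\<close>
    proof (rule L2_le_sum_approximable[where Z = "\<lambda>i k w. if k < K then 0 else kproj n i (V i k w) - X i w"])
      fix i k assume i: "i \<in> {1..n}"
      show "L2_le M (D i) b" by (rule D[OF i])
      show "expectation (D i) = 0"
        unfolding D_def using L2_le_integrable(1)[OF kproj_W_bound[OF n i]] X(3,4)[OF i] kproj_mean[OF n i] by simp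
      show "L2_le M (\<lambda>w. D i w - (if k < K then 0 else kproj n i (V i k w) - X i w)) (if k < K then b else c k)"
        using D[OF i] L2_le_weaken[OF kproj_diff[OF n i] a_le, of k] by (auto simp: D_def[abs_def])
      fix j assume j: "j \<in> {1..n}" and far: "far k i j"
      show "expectation (\<lambda>w. (if k < K then 0 else kproj n i (V i k w) - X i w) * (if k < K then 0 else kproj n j (V j k w) - X j w)) =
          expectation (\<lambda>w. if k < K then 0 else kproj n i (V i k w) - X i w) * expectation (\<lambda>w. if k < K then 0 else kproj n j (V j k w) - X j w)"
      proof (cases "k < K")
        case False
        have meas: "(\<lambda>w. kproj n i (V i k w) - X i w) \<in> borel_measurable (\<F> (window i k))" if "1 \<le> i" for i
        proof -
          have [measurable]: "X i \<in> borel_measurable (\<F> (window i k))"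
            by (rule measurable_base_algebra_mono[OF window_mono X_window[OF that]]) (use False in simp)
          have [measurable]: "V i k \<in> borel_measurable (\<F> (window i k))" by (rule V_window[OF that])
          show ?thesis by measurable
        qed
        have int: "integrable M (\<lambda>w. kproj n i (V i k w) - X i w)" if "i \<in> {1..n}" for i
          using L2_le_integrable(1)[OF kproj_V_bound[OF n that]] X(4)[OF that] by simp
        have "decoupled borel (\<lambda>w. kproj n i (V i k w) - X i w) borel (\<lambda>w. kproj n j (V j k w) - X j w)"
          using i j by (intro decoupled_base[OF window_disjoint[OF far]] meas) auto
        from decoupled_mult[OF this, of "\<lambda>x. x" "\<lambda>x. x"] show ?thesis
          using int[OF i] int[OF j] False by simp
      qed simp
    next
      show "0 \<le> (if k < K then b else c k)" "(if k < K then b else c k) \<le> b" for k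
        using c_pos[of k] c_pos[of K] c_antimono[of K k] by (auto simp: b_def)
    qed
    moreover have "sqrt (real n * (b\<^sup>2 + 8 * b * (\<Sum>k<n. if k < K then b else c k))) \<le> sqrt (real n) * sqrt (q_err K)"
    proof -
      have "(\<Sum>k<n. if k < K then b else c k) \<le> (\<Sum>k<n. (if k < K then b else 0) + c k)"
        using c_pos c_pos[of K] by (intro sum_mono) (auto simp: b_def less_imp_le)
      also have "\<dots> = (\<Sum>k\<in>{..<n} \<inter> {..<K}. b) + (\<Sum>k<n. c k)"
        unfolding sum.distrib by (subst sum.inter_restrict) auto
      also have "\<dots> \<le> (\<Sum>k<K. b) + c_sum"
        using sum_c_le[of n] c_pos[of K] by (intro add_mono sum_mono2) (auto simp: b_def)
      finally have "(\<Sum>k<n. if k < K then b else c k) \<le> real K * b + c_sum" by simp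
      then have "b\<^sup>2 + 8 * b * (\<Sum>k<n. if k < K then b else c k) \<le> q_err K"
        unfolding q_err_def b_def[symmetric] using c_pos[of K] by (intro add_left_mono mult_left_mono) (auto simp: b_def)
      then show ?thesis unfolding real_sqrt_mult[symmetric] by (intro real_sqrt_le_mono mult_left_mono) auto
    qed
    ultimately have "L2_le M (\<lambda>w. \<Sum>i\<in>{1..n}. D i w) (sqrt (real n) * sqrt (q_err K))"
      by (rule L2_le_weaken)
    then show ?thesis
      using X dep by (intro exI[of _ X]) (auto simp: D_def ksum_def sum_subtractf)
  qed
  then have "\<forall>\<^sub>F n in sequentially. ?P (2 * T) n"
    by (rule eventually_mono[OF ev])
  with T show ?thesis by (intro exI[of _ "2 * T"]) simp
qed

text \<open>By \<open>c_rate\<close> the factor containing \<open>K * c K\<close> stays bounded,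
  while the prefactor \<open>c K\<close> tends to 0 by summability.\<close>

lemma q_err_tendsto: "q_err \<longlonglongrightarrow> 0"
proof (rule tendsto_sandwich[where f = "\<lambda>_. 0" and h = "\<lambda>K. (8 * c K)\<^sup>2 + 8 * (8 * c K) * (8 * C0 + c_sum)"])
  have c: "c \<longlonglongrightarrow> 0" using summable_LIMSEQ_zero[OF c_summable] .
  have "(\<lambda>K. (8 * c K)\<^sup>2 + 8 * (8 * c K) * (8 * C0 + c_sum)) \<longlonglongrightarrow> (8 * 0)\<^sup>2 + 8 * (8 * 0) * (8 * C0 + c_sum)"
    by (intro tendsto_intros c)
  then show "(\<lambda>K. (8 * c K)\<^sup>2 + 8 * (8 * c K) * (8 * C0 + c_sum)) \<longlonglongrightarrow> 0" by simp
  have nn: "0 \<le> c K" for K using c_pos[of K] by simp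
  show "\<forall>\<^sub>F K in sequentially. 0 \<le> q_err K"
    using nn c_sum_nonneg by (auto simp: q_err_def intro!: always_eventually add_nonneg_nonneg mult_nonneg_nonneg)
  have "q_err K \<le> (8 * c K)\<^sup>2 + 8 * (8 * c K) * (8 * C0 + c_sum)" for K
    unfolding q_err_def using nn[of K] c_rate[of K] by (intro add_left_mono mult_left_mono add_right_mono) auto
  then show "\<forall>\<^sub>F K in sequentially. q_err K \<le> (8 * c K)\<^sup>2 + 8 * (8 * c K) * (8 * C0 + c_sum)"
    by simp
qed simp

lemma U_stat_projection_rate:
  assumes m: "(\<lambda>n. real (m n) / sqrt (real n)) \<longlonglongrightarrow> 0" and am: "(\<lambda>n. sqrt (real n) * a (m n)) \<longlonglongrightarrow> 0"
  shows "\<exists>d. (\<forall>n\<ge>2. L2_le M (\<lambda>w. U_stat \<phi> W n w - 2 / real n * ksum n w) (d n)) \<and>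
    (\<lambda>n. sqrt (real n) * d n) \<longlonglongrightarrow> 0"
proof -
  define d where "d n = 11 * (2 * real (m n) + 1) * B1 / (real n - 1) + 8 * a (m n)" for n
  have d: "L2_le M (\<lambda>w. U_stat \<phi> W n w - 2 / real n * ksum n w) (d n)" if "2 \<le> n" for n
    unfolding d_def by (rule U_stat_projection[OF that])
  have r1: "(\<lambda>n. real n / (real n - 1)) \<longlonglongrightarrow> 1" and r2: "(\<lambda>n. sqrt (real n) / (real n - 1)) \<longlonglongrightarrow> 0"
    by real_asymp+
  have "(\<lambda>n. 22 * B1 * (real (m n) / sqrt (real n) * (real n / (real n - 1))) + 11 * B1 * (sqrt (real n) / (real n - 1)) +
      8 * (sqrt (real n) * a (m n))) \<longlonglongrightarrow> 22 * B1 * (0 * 1) + 11 * B1 * 0 + 8 * 0"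
    by (intro tendsto_intros m am r1 r2)
  also have "(\<lambda>n. 22 * B1 * (real (m n) / sqrt (real n) * (real n / (real n - 1))) + 11 * B1 * (sqrt (real n) / (real n - 1)) +
      8 * (sqrt (real n) * a (m n))) = (\<lambda>n. sqrt (real n) * d n)"
  proof
    fix n
    have "real (m n) / sqrt (real n) * (real n / (real n - 1)) = sqrt (real n) * real (m n) / (real n - 1)"
      by (metis (no_types, opaque_lifting) of_nat_0_le_iff real_div_sqrt times_divide_eq_left times_divide_eq_right mult.commute)
    then show "22 * B1 * (real (m n) / sqrt (real n) * (real n / (real n - 1))) + 11 * B1 * (sqrt (real n) / (real n - 1)) +
      8 * (sqrt (real n) * a (m n)) = sqrt (real n) * d n"
      by (simp add: d_def add_divide_distrib algebra_simps)
  qed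
  finally have "(\<lambda>n. sqrt (real n) * d n) \<longlonglongrightarrow> 0" by simp
  with d show ?thesis by blast
qed

section \<open>Limit of the characteristic functions\<close>

lemma norm_iexp_integral_diff_le:
  assumes [measurable]: "X \<in> borel_measurable M" "Y \<in> borel_measurable M" and XY: "L2_le M (\<lambda>w. X w - Y w) e"
  shows "cmod ((\<integral>w. iexp (s * X w) \<partial>M) - (\<integral>w. iexp (s * Y w) \<partial>M)) \<le> \<bar>s\<bar> * e"
proof -
  have int: "integrable M (\<lambda>w. iexp (s * X w))" "integrable M (\<lambda>w. iexp (s * Y w))"
    by (auto intro!: integrable_const_bound[of _ 1])
  have "cmod ((\<integral>w. iexp (s * X w) \<partial>M) - (\<integral>w. iexp (s * Y w) \<partial>M)) = cmod (\<integral>w. iexp (s * X w) - iexp (s * Y w) \<partial>M)"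
    using int by simp
  also have "\<dots> \<le> (\<integral>w. cmod (iexp (s * X w) - iexp (s * Y w)) \<partial>M)" by (rule integral_norm_bound)
  also have "\<dots> \<le> (\<integral>w. \<bar>s\<bar> * \<bar>X w - Y w\<bar> \<partial>M)"
  proof (rule integral_mono)
    show "integrable M (\<lambda>w. \<bar>s\<bar> * \<bar>X w - Y w\<bar>)" using L2_le_integrable(1)[OF XY] by auto
    show "cmod (iexp (s * X w) - iexp (s * Y w)) \<le> \<bar>s\<bar> * \<bar>X w - Y w\<bar>" for w
      using norm_iexp_diff_le[of "s * X w" "s * Y w"] by (simp add: right_diff_distrib[symmetric] abs_mult del: of_real_mult)
  qed (use int in auto)
  also have "\<dots> \<le> \<bar>s\<bar> * e" using L2_le_integrable(2)[OF XY] by (simp add: mult_left_mono)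
  finally show ?thesis .
qed

text \<open>Factor X^2 - Y^2 as (X - Y) (X + Y) and apply Cauchy-Schwarz.\<close>

lemma second_moment_diff_le:
  assumes X: "L2_le M X b" and XY: "L2_le M (\<lambda>w. X w - Y w) e" and Y: "Y \<in> borel_measurable M"
  shows "\<bar>expectation (\<lambda>w. (X w)\<^sup>2) - expectation (\<lambda>w. (Y w)\<^sup>2)\<bar> \<le> e * (2 * b + e)"
proof -
  have Y: "L2_le M Y (b + e)" using L2_le_diff[OF X XY] by simp
  have "L2_le M (\<lambda>w. X w + Y w) (2 * b + e)" using L2_le_add[OF X Y] by simp
  from L2_le_mult(3)[OF XY this] have "\<bar>expectation (\<lambda>w. (X w - Y w) * (X w + Y w))\<bar> \<le> e * (2 * b + e)" .
  also have "(\<lambda>w. (X w - Y w) * (X w + Y w)) = (\<lambda>w. (X w)\<^sup>2 - (Y w)\<^sup>2)"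
    by (auto simp: algebra_simps power2_eq_square)
  finally show ?thesis using L2_le_square(1)[OF X] L2_le_square(1)[OF Y] by simp
qed

lemma abs_exp_minus_diff_le: "\<bar>exp (- x) - exp (- y)\<bar> \<le> \<bar>x - y\<bar>" if "0 \<le> x" "0 \<le> y" for x y :: real
proof -
  have "exp (- x) - exp (- y) \<le> y - x" if "0 \<le> x" "x \<le> y" for x y :: real
  proof -
    have "exp (- x) - exp (- y) = exp (- x) * (1 - exp (x - y))" by (simp add: algebra_simps flip: exp_add)
    also have "\<dots> \<le> 1 * (y - x)"
    proof (rule mult_mono)
      show "1 - exp (x - y) \<le> y - x" using exp_ge_add_one_self[of "x - y"] by linarith
    qed (use that in auto)
    finally show ?thesis by simp
  qed
  from this[of x y] this[of y x] that show ?thesis by (cases "x \<le> y") auto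
qed

text \<open>Three errors: passing from \<open>ksum\<close> to the bounded sum, the error of
  \<open>char_m_dependent_sum\<close>, and the difference between the variance of the bounded sum
  and n times the square of \<open>\<sigma> n\<close>. The first and third are small for large
  \<open>K\<close>, uniformly in n; the second vanishes as n grows. The lower bound \<open>l\<close>
  keeps the normalised frequency at most |t| / (l sqrt n).\<close>

lemma char_kproj_sum:
  fixes \<sigma> :: "nat \<Rightarrow> real"
  assumes l: "0 < l" "\<And>n. 2 \<le> n \<Longrightarrow> l \<le> \<sigma> n"
    and var: "\<And>n. 2 \<le> n \<Longrightarrow> real n * (\<sigma> n)\<^sup>2 = expectation (\<lambda>w. (ksum n w)\<^sup>2)"
  shows "(\<lambda>n. \<integral>w. iexp (t / (\<sigma> n * sqrt (real n)) * ksum n w) \<partial>M)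
    \<longlonglongrightarrow> complex_of_real (exp (- (t\<^sup>2 / 2)))"
proof (rule tendstoI)
  fix e :: real assume e: "0 < e"
  have CS: "0 \<le> CS" using L2_leD(1)[OF kproj_sum_bound[of 2]] by (simp add: zero_le_mult_iff)
  have "(\<lambda>K. \<bar>t\<bar> / l * sqrt (q_err K) + t\<^sup>2 / (2 * l\<^sup>2) * (sqrt (q_err K) * (2 * CS + sqrt (q_err K))))
      \<longlonglongrightarrow> \<bar>t\<bar> / l * sqrt 0 + t\<^sup>2 / (2 * l\<^sup>2) * (sqrt 0 * (2 * CS + sqrt 0))"
    by (intro tendsto_intros q_err_tendsto)
  then have "(\<lambda>K. \<bar>t\<bar> / l * sqrt (q_err K) + t\<^sup>2 / (2 * l\<^sup>2) * (sqrt (q_err K) * (2 * CS + sqrt (q_err K)))) \<longlonglongrightarrow> 0"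
    by simp
  from order_tendstoD(2)[OF this, of "e / 2"] e
  \<comment> \<open>\<open>K\<close> is fixed before the truncation bound \<open>T\<close>, which
    depends on it, and both before n.\<close>
  obtain K where K: "\<bar>t\<bar> / l * sqrt (q_err K) + t\<^sup>2 / (2 * l\<^sup>2) * (sqrt (q_err K) * (2 * CS + sqrt (q_err K))) < e / 2"
    by (auto simp: eventually_sequentially)
  define Q where "Q = sqrt (q_err K)"
  obtain T where T: "0 \<le> T" and X_ev: "\<forall>\<^sub>F n in sequentially. \<exists>X. (\<forall>i\<in>{1..n}. X i \<in> borel_measurable M \<and>
      (\<forall>w\<in>space M. \<bar>X i w\<bar> \<le> T) \<and> expectation (X i) = 0) \<and> m_dependent K n X \<and>
      L2_le M (\<lambda>w. ksum n w - (\<Sum>i\<in>{1..n}. X i w)) (sqrt (real n) * Q)"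
    using m_dependent_approximation[of K] unfolding Q_def by blast
  \<comment> \<open>The error n T^3 (2 K + 1)^2 |s|^3 with |s| at most |t| / (l sqrt n) leaves this
    constant divided by sqrt n.\<close>
  define A where "A = 5 * T ^ 3 * (2 * real K + 1)\<^sup>2 * (\<bar>t\<bar> / l) ^ 3"
  have "(\<lambda>n. A * (1 / sqrt (real n))) \<longlonglongrightarrow> A * 0"
    by (intro tendsto_intros) real_asymp
  then have "(\<lambda>n. A * (1 / sqrt (real n))) \<longlonglongrightarrow> 0" by simp
  from order_tendstoD(2)[OF this, of "e / 2"] e
  have "\<forall>\<^sub>F n in sequentially. A * (1 / sqrt (real n)) < e / 2" by simp
  with X_ev eventually_ge_at_top[of "2::nat"]
  show "\<forall>\<^sub>F n in sequentially. dist (\<integral>w. iexp (t / (\<sigma> n * sqrt (real n)) * ksum n w) \<partial>M)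
    (complex_of_real (exp (- (t\<^sup>2 / 2)))) < e"
  proof eventually_elim
    case (elim n)
    have n: "2 \<le> n" and An: "A * (1 / sqrt (real n)) < e / 2" using elim by auto
    obtain X where X: "\<And>i. i \<in> {1..n} \<Longrightarrow> X i \<in> borel_measurable M"
      "\<And>i w. i \<in> {1..n} \<Longrightarrow> w \<in> space M \<Longrightarrow> \<bar>X i w\<bar> \<le> T" "\<And>i. i \<in> {1..n} \<Longrightarrow> expectation (X i) = 0"
      "m_dependent K n X"
      and diff: "L2_le M (\<lambda>w. ksum n w - (\<Sum>i\<in>{1..n}. X i w)) (sqrt (real n) * Q)"
      using elim by blast
    define G where "G w = ksum n w" for w
    define S where "S w = (\<Sum>i\<in>{1..n}. X i w)" for w
    define s where "s = t / (\<sigma> n * sqrt (real n))"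
    define v where "v = expectation (\<lambda>w. (S w)\<^sup>2)"
    have sn: "0 < sqrt (real n)" using n by simp
    have \<sigma>: "l \<le> \<sigma> n" "0 < \<sigma> n" using l(1) l(2)[OF n] by auto
    have s_le: "\<bar>s\<bar> \<le> \<bar>t\<bar> / l / sqrt (real n)"
      unfolding s_def using \<sigma> l(1) sn by (simp add: abs_mult divide_simps mult_left_mono)
    have G: "L2_le M G (sqrt (real n) * CS)" unfolding G_def by (rule kproj_sum_bound[OF n])
    have S_meas: "S \<in> borel_measurable M" unfolding S_def by (intro borel_measurable_sum X(1))
    have GS: "L2_le M (\<lambda>w. G w - S w) (sqrt (real n) * Q)" using diff by (simp add: G_def S_def)
    have Q: "0 \<le> Q" using L2_leD(1)[OF GS] sn by (simp add: zero_le_mult_iff)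
    have "cmod ((\<integral>w. iexp (s * G w) \<partial>M) - (\<integral>w. iexp (s * S w) \<partial>M)) \<le> \<bar>s\<bar> * (sqrt (real n) * Q)"
      by (rule norm_iexp_integral_diff_le[OF L2_leD(2)[OF G] S_meas GS])
    also have "\<dots> \<le> \<bar>t\<bar> / l / sqrt (real n) * (sqrt (real n) * Q)"
      using s_le Q by (intro mult_right_mono) auto
    also have "\<dots> = \<bar>t\<bar> / l * Q" using sn by simp
    finally have d1: "cmod ((\<integral>w. iexp (s * G w) \<partial>M) - (\<integral>w. iexp (s * S w) \<partial>M)) \<le> \<bar>t\<bar> / l * Q" .
    have "cmod ((\<integral>w. iexp (s * S w) \<partial>M) - exp (- (s\<^sup>2 * v / 2))) \<le> 5 * real n * T ^ 3 * (2 * real K + 1)\<^sup>2 * \<bar>s\<bar> ^ 3"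
      using char_m_dependent_sum[OF X T, of s] by (simp add: S_def v_def)
    also have "\<dots> \<le> 5 * real n * T ^ 3 * (2 * real K + 1)\<^sup>2 * (\<bar>t\<bar> / l / sqrt (real n)) ^ 3"
      using T s_le by (intro mult_left_mono power_mono) auto
    also have "\<dots> = A * (1 / sqrt (real n))"
    proof -
      have "sqrt (real n) ^ 3 = real n * sqrt (real n)"
        by (simp add: power3_eq_cube)
      then show ?thesis using sn n by (simp add: A_def power_divide power_mult_distrib)
    qed
    finally have d2: "cmod ((\<integral>w. iexp (s * S w) \<partial>M) - exp (- (s\<^sup>2 * v / 2))) \<le> A * (1 / sqrt (real n))" .
    have "\<bar>exp (- (s\<^sup>2 * v / 2)) - exp (- (t\<^sup>2 / 2))\<bar> \<le> \<bar>s\<^sup>2 * v / 2 - t\<^sup>2 / 2\<bar>"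
      by (rule abs_exp_minus_diff_le) (auto simp: v_def)
    also have "\<dots> = s\<^sup>2 / 2 * \<bar>real n * (\<sigma> n)\<^sup>2 - v\<bar>"
    proof -
      have "t\<^sup>2 = s\<^sup>2 * (real n * (\<sigma> n)\<^sup>2)"
        using \<sigma> n by (simp add: s_def power_divide power_mult_distrib)
      then have "s\<^sup>2 * v / 2 - t\<^sup>2 / 2 = - (s\<^sup>2 / 2 * (real n * (\<sigma> n)\<^sup>2 - v))"
        by (simp add: algebra_simps)
      then show ?thesis by (simp add: abs_mult)
    qed
    also have "\<dots> \<le> s\<^sup>2 / 2 * (sqrt (real n) * Q * (2 * (sqrt (real n) * CS) + sqrt (real n) * Q))"
      using second_moment_diff_le[OF G GS S_meas] var[OF n] by (intro mult_left_mono) (auto simp: v_def G_def)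
    also have "\<dots> = (s\<^sup>2 * real n) / 2 * (Q * (2 * CS + Q))"
    proof -
      have "sqrt (real n) * Q * (2 * (sqrt (real n) * CS) + sqrt (real n) * Q) = (sqrt (real n) * sqrt (real n)) * (Q * (2 * CS + Q))"
        by (simp only: algebra_simps)
      then show ?thesis by simp
    qed
    also have "\<dots> \<le> t\<^sup>2 / (2 * l\<^sup>2) * (Q * (2 * CS + Q))"
    proof (rule mult_right_mono)
      have "s\<^sup>2 \<le> (\<bar>t\<bar> / l / sqrt (real n))\<^sup>2"
        using s_le by (metis abs_ge_zero power2_abs power_mono)
      from mult_right_mono[OF this, of "real n"] have "s\<^sup>2 * real n \<le> t\<^sup>2 / l\<^sup>2"
        using n by (simp add: power_divide power_mult_distrib)
      then show "s\<^sup>2 * real n / 2 \<le> t\<^sup>2 / (2 * l\<^sup>2)" by simp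
    qed (use Q CS in auto)
    finally have d3: "\<bar>exp (- (s\<^sup>2 * v / 2)) - exp (- (t\<^sup>2 / 2))\<bar> \<le> t\<^sup>2 / (2 * l\<^sup>2) * (Q * (2 * CS + Q))" .
    then have d3': "cmod (complex_of_real (exp (- (s\<^sup>2 * v / 2))) - complex_of_real (exp (- (t\<^sup>2 / 2)))) \<le> t\<^sup>2 / (2 * l\<^sup>2) * (Q * (2 * CS + Q))"
      by (metis norm_of_real of_real_diff)
    have "dist (\<integral>w. iexp (s * G w) \<partial>M) (complex_of_real (exp (- (t\<^sup>2 / 2)))) \<le>
        dist (\<integral>w. iexp (s * G w) \<partial>M) (\<integral>w. iexp (s * S w) \<partial>M) +
        dist (\<integral>w. iexp (s * S w) \<partial>M) (complex_of_real (exp (- (s\<^sup>2 * v / 2)))) +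
        dist (complex_of_real (exp (- (s\<^sup>2 * v / 2)))) (complex_of_real (exp (- (t\<^sup>2 / 2))))"
      by metric
    also have "\<dots> < e"
      using d1 d2 d3' An K unfolding dist_norm Q_def by linarith
    finally show ?case by (simp add: s_def G_def)
  qed
qed

text \<open>Levy's continuity theorem. The factor sqrt n / (2 \<open>\<sigma> n\<close>) turns 2 / n
  times \<open>ksum\<close> into the normalised sum of \<open>char_kproj_sum\<close>. The remaining
  error is \<open>sqrt (real n) * d n\<close>, multiplied by |t| / (2 l).\<close>

lemma U_stat_clt:
  fixes \<sigma> :: "nat \<Rightarrow> real"
  assumes l: "0 < l" "\<And>n. 2 \<le> n \<Longrightarrow> l \<le> \<sigma> n"
    and var: "\<And>n. 2 \<le> n \<Longrightarrow> real n * (\<sigma> n)\<^sup>2 = expectation (\<lambda>w. (ksum n w)\<^sup>2)"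
    and m: "(\<lambda>n. real (m n) / sqrt (real n)) \<longlonglongrightarrow> 0" and am: "(\<lambda>n. sqrt (real n) * a (m n)) \<longlonglongrightarrow> 0"
  shows "weak_conv_m (\<lambda>n. distr M borel (\<lambda>w. inverse (2 * \<sigma> n) * sqrt (real n) * U_stat \<phi> W n w))
    std_normal_distribution"
proof (rule levy_continuity)
  have U_meas [measurable]: "U_stat \<phi> W n \<in> borel_measurable M" for n
    unfolding U_stat_def[abs_def] by (intro borel_measurable_times borel_measurable_const borel_measurable_sum) auto
  show "real_distribution (distr M borel (\<lambda>w. inverse (2 * \<sigma> n) * sqrt (real n) * U_stat \<phi> W n w))" for n
    by (rule real_distribution_distr) simp
  show "real_distribution std_normal_distribution" by (rule real_dist_normal_dist)
  fix t
  obtain d where d: "\<And>n. 2 \<le> n \<Longrightarrow>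
      L2_le M (\<lambda>w. U_stat \<phi> W n w - 2 / real n * ksum n w) (d n)"
    and d_lim: "(\<lambda>n. sqrt (real n) * d n) \<longlonglongrightarrow> 0"
    using U_stat_projection_rate[OF m am] by blast
  define f where "f n = (\<integral>w. iexp (t / (\<sigma> n * sqrt (real n)) * ksum n w) \<partial>M)" for n
  define g where "g n = char (distr M borel (\<lambda>w. inverse (2 * \<sigma> n) * sqrt (real n) * U_stat \<phi> W n w)) t" for n
  have f: "f \<longlonglongrightarrow> complex_of_real (exp (- (t\<^sup>2 / 2)))"
    unfolding f_def by (rule char_kproj_sum[OF l var])
  have bound: "norm (g n - f n) \<le> \<bar>t\<bar> / (2 * l) * (sqrt (real n) * d n)" if n: "2 \<le> n" for n
  proof -
    define H where "H w = 2 / real n * ksum n w" for w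
    define s where "s = t * (inverse (2 * \<sigma> n) * sqrt (real n))"
    have \<sigma>: "l \<le> \<sigma> n" "0 < \<sigma> n" using l(1) l(2)[OF n] by auto
    have H_meas: "H \<in> borel_measurable M"
      unfolding H_def by (intro borel_measurable_times borel_measurable_const L2_leD(2)[OF kproj_sum_bound[OF n]])
    have "g n = (\<integral>w. iexp (s * U_stat \<phi> W n w) \<partial>M)"
      unfolding g_def char_def s_def by (subst integral_distr) (auto simp: mult_ac)
    moreover have "f n = (\<integral>w. iexp (s * H w) \<partial>M)"
    proof -
      have "t * (inverse (2 * u) * r) * (2 / x) = t * (r / x) / u" for u r x :: real
        by (simp add: divide_simps)
      then have "s * (2 / real n) = t * (sqrt (real n) / real n) / \<sigma> n"
        unfolding s_def .
      also have "sqrt (real n) / real n = inverse (sqrt (real n))" by (rule sqrt_divide_self_eq) simp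
      finally have "s * (2 / real n) = t / (\<sigma> n * sqrt (real n))" by (simp add: divide_inverse mult_ac)
      then have "s * H w = t / (\<sigma> n * sqrt (real n)) * ksum n w" for w
        unfolding H_def mult.assoc[symmetric] by simp
      then show ?thesis by (simp add: f_def)
    qed
    ultimately have "norm (g n - f n) \<le> \<bar>s\<bar> * d n"
      using norm_iexp_integral_diff_le[OF U_meas[of n] H_meas, of "d n" s] d[OF n] by (simp add: H_def)
    also have "\<dots> \<le> \<bar>t\<bar> / (2 * l) * sqrt (real n) * d n"
    proof (rule mult_right_mono)
      have "\<bar>s\<bar> = \<bar>t\<bar> / (2 * \<sigma> n) * sqrt (real n)"
        using \<sigma> by (simp add: s_def abs_mult field_simps)
      also have "\<dots> \<le> \<bar>t\<bar> / (2 * l) * sqrt (real n)"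
        using \<sigma> l(1) by (intro mult_right_mono divide_left_mono) auto
      finally show "\<bar>s\<bar> \<le> \<bar>t\<bar> / (2 * l) * sqrt (real n)" .
    qed (use d[OF n] in auto)
    finally show ?thesis by (simp add: mult.assoc)
  qed
  have "(\<lambda>n. \<bar>t\<bar> / (2 * l) * (sqrt (real n) * d n)) \<longlonglongrightarrow> \<bar>t\<bar> / (2 * l) * 0"
    by (intro tendsto_intros d_lim)
  then have "(\<lambda>n. \<bar>t\<bar> / (2 * l) * (sqrt (real n) * d n)) \<longlonglongrightarrow> 0" by simp
  then have "(\<lambda>n. g n - f n) \<longlonglongrightarrow> 0"
    by (rule Lim_null_comparison[rotated]) (use bound in \<open>auto simp: eventually_sequentially\<close>)
  from tendsto_add[OF this f] show "(\<lambda>n. char (distr M borel (\<lambda>w. inverse (2 * \<sigma> n) * sqrt (real n) * U_stat \<phi> W n w)) t)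
      \<longlonglongrightarrow> char std_normal_distribution t"
    by (simp add: g_def char_std_normal_distribution)
qed

end

section \<open>Independent copies and the perturbation condition\<close>

lemma Lp_norm_2_L2_le:
  fixes X :: "'a \<Rightarrow> 'b::euclidean_space"
  assumes X: "X \<in> borel_measurable M" and le: "Lp_norm M 2 X \<le> ennreal c" and c: "0 \<le> c"
  shows "L2_le M (\<lambda>w. norm (X w)) c"
proof -
  define I where "I = (\<integral>\<^sup>+ w. ennreal (norm (X w) powr 2) \<partial>M)"
  have I: "I = (\<integral>\<^sup>+ w. ennreal ((norm (X w))\<^sup>2) \<partial>M)" by (simp add: I_def)
  have fin: "I \<noteq> \<top>" using le unfolding Lp_norm_def Let_def I_def[symmetric] by (auto simp: top_unique)
  then have "ennreal (enn2real I powr (1 / 2)) \<le> ennreal c"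
    using le unfolding Lp_norm_def Let_def I_def[symmetric] by simp
  then have "sqrt (enn2real I) \<le> c" using c by (simp add: powr_half_sqrt ennreal_le_iff)
  then have "enn2real I \<le> c\<^sup>2" using c by (simp add: real_sqrt_le_iff real_le_lsqrt sqrt_le_D)
  then have "I \<le> ennreal (c\<^sup>2)" using fin by (metis ennreal_enn2real ennreal_leI less_top)
  then show ?thesis using X c by (auto simp: L2_le_def I)
qed

lemma Lp_norm_bound:
  assumes le: "Lp_norm M r X \<le> S" and S: "S < \<top>" and r: "0 < r"
  shows "(\<integral>\<^sup>+ w. ennreal (norm (X w) powr r) \<partial>M) \<le> ennreal (enn2real S powr r)"
proof -
  define I where "I = (\<integral>\<^sup>+ w. ennreal (norm (X w) powr r) \<partial>M)"
  have fin: "I \<noteq> \<top>" using le S by (auto simp: Lp_norm_def I_def[symmetric] top_unique)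
  then have "ennreal (enn2real I powr (1 / r)) \<le> ennreal (enn2real S)"
    using le S by (simp add: Lp_norm_def I_def[symmetric])
  then have "enn2real I powr (1 / r) \<le> enn2real S" by (simp add: ennreal_le_iff)
  then have "(enn2real I powr (1 / r)) powr r \<le> enn2real S powr r" using r by (intro powr_mono2) auto
  then have "enn2real I \<le> enn2real S powr r" using r by (simp add: powr_powr)
  then have "I \<le> ennreal (enn2real S powr r)" using fin by (metis ennreal_enn2real ennreal_leI less_top)
  then show ?thesis by (simp add: I_def)
qed

lemma vec_cond_exp_measurable: "vec_cond_exp M F X \<in> borel_measurable F"
  unfolding vec_cond_exp_def by measurable

context prob_space
begin

lemma L2_le_abs: "L2_le M (\<lambda>w. \<bar>X w\<bar>) c \<Longrightarrow> X \<in> borel_measurable M \<Longrightarrow> L2_le M X c"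
  by (rule L2_le_mono) auto

lemma prob_gt_le_L2:
  assumes X: "L2_le M X c" and u: "0 < u"
  shows "prob {w\<in>space M. \<bar>X w\<bar> > u} \<le> (c / u)\<^sup>2"
proof -
  have [measurable]: "X \<in> borel_measurable M" using X by auto
  have "prob {w\<in>space M. \<bar>X w\<bar> > u} \<le> prob {w\<in>space M. (X w)\<^sup>2 \<ge> u\<^sup>2}"
    using u by (intro finite_measure_mono) (auto simp: abs_le_square_iff[symmetric])
  also have "\<dots> \<le> expectation (\<lambda>w. (X w)\<^sup>2) / u\<^sup>2"
    using u by (intro integral_Markov_inequality_measure[where A = "{}"] L2_le_square(1)[OF X]) auto
  also have "\<dots> \<le> c\<^sup>2 / u\<^sup>2" using L2_le_square(2)[OF X] by (intro divide_right_mono) auto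
  finally show ?thesis by (simp add: power_divide)
qed

text \<open>Only the law of an independent variable matters. So a copy may be replaced by the
  original variable, evaluated at the second coordinate.\<close>

lemma decoupled_distr_cong:
  assumes dec: "decoupled S X T Y" and eq: "distr M T Y = distr M T Y'" and Y': "Y' \<in> measurable M T"
  shows "distr M (S \<Otimes>\<^sub>M T) (\<lambda>w. (X w, Y w)) = distr M2 (S \<Otimes>\<^sub>M T) (\<lambda>z. (X (fst z), Y' (snd z)))"
proof -
  have [measurable]: "X \<in> measurable M S" "Y \<in> measurable M T" using dec by (auto simp: decoupled_def)
  interpret Y: prob_space "distr M T Y" by (rule prob_space_distr) simp
  have "distr M (S \<Otimes>\<^sub>M T) (\<lambda>w. (X w, Y w)) = distr M2 (S \<Otimes>\<^sub>M T) (\<lambda>(x, y). (X x, Y y))"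
    using dec by (simp add: decoupled_def split_beta')
  also have "\<dots> = distr M S X \<Otimes>\<^sub>M distr M T Y"
    by (rule pair_measure_distr[symmetric]) (auto simp: Y.sigma_finite_measure_axioms)
  also have "\<dots> = distr M S X \<Otimes>\<^sub>M distr M T Y'" by (simp only: eq)
  also have "\<dots> = distr M2 (S \<Otimes>\<^sub>M T) (\<lambda>(x, y). (X x, Y' y))"
    using Y.sigma_finite_measure_axioms Y' unfolding eq by (intro pair_measure_distr) auto
  finally show ?thesis by (simp add: split_beta')
qed

context
  fixes W :: "nat \<Rightarrow> 'a \<Rightarrow> 'w::euclidean_space" and V :: "nat \<Rightarrow> nat \<Rightarrow> 'a \<Rightarrow> 'w"
    and Ws :: "nat \<Rightarrow> 'a \<Rightarrow> 'w" and Wsm :: "nat \<Rightarrow> nat \<Rightarrow> 'a \<Rightarrow> 'w"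
  assumes copies: "independent_copies M W V Ws Wsm"
    and W_meas [measurable]: "\<And>i. 1 \<le> i \<Longrightarrow> W i \<in> borel_measurable M"
    and V_meas [measurable]: "\<And>i k. 1 \<le> i \<Longrightarrow> V i k \<in> borel_measurable M"
begin

text \<open>Measurability is contained in the independence clause, which makes the preimages
  events.\<close>

lemma copies_measurable:
  assumes "1 \<le> j"
  shows "Ws j \<in> borel_measurable M" "Wsm j k \<in> borel_measurable M"
proof -
  have "{(\<lambda>w. (Ws j w, Wsm j k w)) -` A \<inter> space M |A. A \<in> sets borel} \<subseteq> events" for k
    using copies assms unfolding independent_copies_def indep_sets2_eq by blast
  then have pair: "(\<lambda>w. (Ws j w, Wsm j k w)) \<in> borel_measurable M" for k
    by (intro measurableI) auto
  then have "(\<lambda>w. (Ws j w, Wsm j k w)) \<in> measurable M borel2" for k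
    by (simp add: borel_prod)
  from measurable_compose[OF this measurable_fst] measurable_compose[OF this measurable_snd]
  show "Ws j \<in> borel_measurable M" "Wsm j k \<in> borel_measurable M" by simp_all
qed

lemma copy_integral:
  assumes j: "1 \<le> j" and [measurable]: "f \<in> borel_measurable borel"
  shows "(\<integral>w. f (Ws j w) \<partial>M) = (\<integral>w. f (W j w) \<partial>M :: real)"
proof -
  note [measurable] = copies_measurable[OF j] W_meas[OF j] V_meas[OF j]
  \<comment> \<open>The law of \<open>Ws j\<close> alone is wanted; level 0 is an arbitrary choice
    for the second component.\<close>
  have "distr M borel2 (\<lambda>w. (Ws j w, Wsm j 0 w)) = distr M borel2 (\<lambda>w. (W j w, V j 0 w))"
    using copies j by (simp add: independent_copies_def borel_prod)
  then have "(\<integral>p. f (fst p) \<partial>distr M borel2 (\<lambda>w. (Ws j w, Wsm j 0 w))) =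
      (\<integral>p. f (fst p) \<partial>distr M borel2 (\<lambda>w. (W j w, V j 0 w)))" by simp
  then show ?thesis by (simp add: integral_distr)
qed

text \<open>Pairs are kept on both sides because a perturbation involves \<open>W i\<close> and
  \<open>V i k\<close> at once, and the held-fixed argument may be either component of the
  copy.\<close>

lemma copies_law:
  assumes i: "1 \<le> i" and j: "1 \<le> j"
  shows "distr M (borel2 \<Otimes>\<^sub>M borel2) (\<lambda>w. ((W i w, V i k w), (Ws j w, Wsm j k w))) =
    distr M2 (borel2 \<Otimes>\<^sub>M borel2)
      (\<lambda>z. ((W i (fst z), V i k (fst z)), (W j (snd z), V j k (snd z))))"
proof (rule decoupled_distr_cong)
  have [measurable]: "Ws j \<in> borel_measurable M" "Wsm j k \<in> borel_measurable M"
    by (rule copies_measurable[OF j])+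
  show "distr M borel2 (\<lambda>w. (Ws j w, Wsm j k w)) = distr M borel2 (\<lambda>w. (W j w, V j k w))"
    using copies j by (simp add: independent_copies_def borel_prod)
  show "(\<lambda>w. (W j w, V j k w)) \<in> measurable M borel2" using j by measurable
  \<comment> \<open>The independence clause speaks of the whole system \<open>J\<close>; the pair
    needed here is the measurable function \<open>f\<close> of it.\<close>
  define J where "J w = (\<lambda>i\<in>{1..}. W i w, \<lambda>p\<in>{1..} \<times> UNIV. V (fst p) (snd p) w)" for w
  define Q where "Q = PiM {1::nat..} (\<lambda>_. borel :: 'w measure) \<Otimes>\<^sub>M PiM ({1::nat..} \<times> (UNIV :: nat set)) (\<lambda>_. borel :: 'w measure)"
  have J: "J \<in> measurable M Q"
    unfolding J_def Q_def by (intro measurable_Pair measurable_restrict) auto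
  have ind: "indep_set {(\<lambda>w. (Ws j w, Wsm j k w)) -` A \<inter> space M |A. A \<in> sets borel} {J -` B \<inter> space M |B. B \<in> sets Q}"
    using copies j unfolding independent_copies_def J_def Q_def by blast
  show "decoupled borel2 (\<lambda>w. (W i w, V i k w)) borel2 (\<lambda>w. (Ws j w, Wsm j k w))"
  proof (rule decoupledI)
    fix A B :: "('w \<times> 'w) set" assume A: "A \<in> sets borel2" and B: "B \<in> sets borel2"
    define f where "f = (\<lambda>p :: (nat \<Rightarrow> 'w) \<times> (nat \<times> nat \<Rightarrow> 'w). (fst p i, snd p (i, k)))"
    have f: "f \<in> measurable Q borel2"
      unfolding f_def Q_def using i
      by (intro measurable_Pair measurable_compose[OF measurable_fst] measurable_compose[OF measurable_snd]
          measurable_component_singleton) auto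
    have fJ: "f (J w) = (W i w, V i k w)" for w using i by (simp add: f_def J_def)
    define PB where "PB = (\<lambda>w. (Ws j w, Wsm j k w)) -` B \<inter> space M"
    define PA where "PA = J -` (f -` A \<inter> space Q) \<inter> space M"
    have "B \<in> sets borel" using B borel_prod[where 'a = 'w and 'b = 'w] by metis
    then have "PB \<in> {(\<lambda>w. (Ws j w, Wsm j k w)) -` A \<inter> space M |A. A \<in> sets borel}"
      unfolding PB_def by blast
    moreover have "PA \<in> {J -` B \<inter> space M |B. B \<in> sets Q}"
      unfolding PA_def using measurable_sets[OF f A] by blast
    ultimately have "prob (PB \<inter> PA) = prob PB * prob PA" by (rule indep_setD[OF ind])
    moreover have "(\<lambda>w. (W i w, V i k w)) -` A \<inter> space M = PA"
      using measurable_space[OF J] by (simp add: PA_def set_eq_iff fJ) blast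
    ultimately show "prob ((\<lambda>w. (W i w, V i k w)) -` A \<inter> space M \<inter> ((\<lambda>w. (Ws j w, Wsm j k w)) -` B \<inter> space M)) =
        prob ((\<lambda>w. (W i w, V i k w)) -` A \<inter> space M) * prob ((\<lambda>w. (Ws j w, Wsm j k w)) -` B \<inter> space M)"
      unfolding PB_def[symmetric] by (metis Int_commute mult.commute)
  qed (use i in measurable)
qed

lemma copies_nn_integral:
  assumes ij: "1 \<le> i" "1 \<le> j" and F: "F \<in> borel_measurable (borel2 \<Otimes>\<^sub>M borel2)"
  shows "(\<integral>\<^sup>+ w. F ((W i w, V i k w), (Ws j w, Wsm j k w)) \<partial>M) =
    (\<integral>\<^sup>+ z. F ((W i (fst z), V i k (fst z)), (W j (snd z), V j k (snd z))) \<partial>M2)"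
proof -
  note [measurable] = F copies_measurable[OF ij(2)] W_meas[OF ij(1)] V_meas[OF ij(1)] W_meas[OF ij(2)] V_meas[OF ij(2)]
  have "(\<integral>\<^sup>+ w. F ((W i w, V i k w), (Ws j w, Wsm j k w)) \<partial>M) =
      integral\<^sup>N (distr M (borel2 \<Otimes>\<^sub>M borel2) (\<lambda>w. ((W i w, V i k w), (Ws j w, Wsm j k w)))) F"
    by (subst nn_integral_distr) auto
  then show ?thesis unfolding copies_law[OF ij] by (subst (asm) nn_integral_distr) auto
qed

lemma copies_L2_le:
  assumes ij: "1 \<le> i" "1 \<le> j" and F: "F \<in> borel_measurable (borel2 \<Otimes>\<^sub>M borel2)"
  shows "L2_le M (\<lambda>w. F ((W i w, V i k w), (Ws j w, Wsm j k w))) c \<longleftrightarrow>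
    L2_le M2 (\<lambda>z. F ((W i (fst z), V i k (fst z)), (W j (snd z), V j k (snd z)))) c"
proof -
  note [measurable] = F copies_measurable[OF ij(2)] W_meas[OF ij(1)] V_meas[OF ij(1)] W_meas[OF ij(2)] V_meas[OF ij(2)]
  show ?thesis
    unfolding L2_le_def using copies_nn_integral[OF ij, of "\<lambda>p. ennreal ((F p)\<^sup>2)" k] by simp
qed

lemma copies_integral:
  fixes F :: "_ \<Rightarrow> real"
  assumes ij: "1 \<le> i" "1 \<le> j" and F: "F \<in> borel_measurable (borel2 \<Otimes>\<^sub>M borel2)"
  shows "(\<integral>w. F ((W i w, V i k w), (Ws j w, Wsm j k w)) \<partial>M) =
    (\<integral>z. F ((W i (fst z), V i k (fst z)), (W j (snd z), V j k (snd z))) \<partial>M2)"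
proof -
  note [measurable] = F copies_measurable[OF ij(2)] W_meas[OF ij(1)] V_meas[OF ij(1)] W_meas[OF ij(2)] V_meas[OF ij(2)]
  have "(\<integral>w. F ((W i w, V i k w), (Ws j w, Wsm j k w)) \<partial>M) =
      integral\<^sup>L (distr M (borel2 \<Otimes>\<^sub>M borel2) (\<lambda>w. ((W i w, V i k w), (Ws j w, Wsm j k w)))) F"
    by (subst integral_distr) auto
  then show ?thesis unfolding copies_law[OF ij] by (subst (asm) integral_distr) auto
qed

end

text \<open>Each summand of the pointwise bound is integrated to the order \<open>\<nu> powr (2 * \<beta>)\<close> by the
  choices \<open>b = \<nu> powr (- 1 / (1 + \<tau>))\<close> and \<open>t = b powr ((1 + \<delta>) / r)\<close>.\<close>

lemma modulus_L2_bound: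
  fixes D L X :: "'a \<Rightarrow> real" and K A \<delta> r \<nu>
  assumes meas [measurable]: "D \<in> borel_measurable M" "L \<in> borel_measurable M"
    and \<delta>: "0 < \<delta>" and r: "2 < r" and L_nonneg: "\<And>w. 0 \<le> L w"
    and D_le: "AE w in M. \<bar>D w\<bar> \<le> L w * X w" and X: "L2_le M X \<nu>"
    and X_nonneg: "\<And>w. 0 \<le> X w"
    and tail: "\<And>b. b0 \<le> b \<Longrightarrow> (\<integral>\<^sup>+ w. ennreal (L w * (if L w > b then 1 else 0)) \<partial>M) \<le> ennreal (K * b powr (- \<delta>))"
    and K: "0 \<le> K" and b0: "1 \<le> b0"
    and moment: "(\<integral>\<^sup>+ w. ennreal (\<bar>D w\<bar> powr r) \<partial>M) \<le> ennreal A" and A: "0 \<le> A"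
  defines "\<tau> \<equiv> (1 + \<delta>) * (r - 2) / (2 * r)"
  shows "L2_le M D (sqrt ((1 + K + A) * b0 powr (2 * \<tau>)) * \<nu> powr modulus_exponent \<delta> r)"
proof -
  define \<beta> where "\<beta> = \<tau> / (1 + \<tau>)"
  have \<tau>: "0 < \<tau>" using \<delta> r by (simp add: \<tau>_def)
  have \<beta>: "modulus_exponent \<delta> r = \<beta>" by (simp add: modulus_exponent_def \<beta>_def \<tau>_def Let_def)
  have [measurable]: "X \<in> borel_measurable M" and \<nu>: "0 \<le> \<nu>" using X by auto
  have b0_ge: "1 \<le> b0 powr (2 * \<tau>)" using b0 \<tau> by (simp add: ge_one_powr_ge_zero)
  define C where "C = sqrt ((1 + K + A) * b0 powr (2 * \<tau>))"
  have C: "C\<^sup>2 = (1 + K + A) * b0 powr (2 * \<tau>)" "0 \<le> C"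
    using K A b0_ge by (auto simp: C_def)
  have "L2_le M D (C * \<nu> powr \<beta>)"
  \<comment> \<open>For \<nu> = 0 the power defining \<open>b\<close> takes its default value 0, so
    this case is separate: then X, and with it D, vanishes almost everywhere.\<close>
  proof (cases "\<nu> = 0")
    case True
    have "(\<integral>\<^sup>+ w. ennreal ((X w)\<^sup>2) \<partial>M) = 0" using X True by (simp add: L2_le_def)
    then have "AE w in M. X w = 0" by (subst (asm) nn_integral_0_iff_AE) auto
    with D_le have "AE w in M. D w = 0" by eventually_elim auto
    then show ?thesis using True L2_le_mono[OF L2_le_zero[of 0 M], of D] by auto
  next
    case False
    then have \<nu>_pos: "0 < \<nu>" using \<nu> by simp
    define b where "b = \<nu> powr (- 1 / (1 + \<tau>))"
    have b_pos: "0 < b" using \<nu>_pos by (simp add: b_def)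
    have b\<tau>: "b powr (- 2 * \<tau>) = (\<nu> powr \<beta>)\<^sup>2"
      using \<nu>_pos \<tau> by (simp add: b_def \<beta>_def powr_powr powr_power)
    have main: "(\<integral>\<^sup>+ w. ennreal ((D w)\<^sup>2) \<partial>M) \<le> ennreal ((1 + K + A) * b0 powr (2 * \<tau>) * (\<nu> powr \<beta>)\<^sup>2)"
    proof (cases "b0 \<le> b")
      case True
      define t where "t = b powr ((1 + \<delta>) / r)"
      have t: "0 < t" using b_pos by (simp add: t_def)
      \<comment> \<open>This \<open>t\<close> makes the large-modulus and the large-increment terms
        equal in order, namely \<open>b powr (- 2 * \<tau>)\<close>. The choice of \<open>b\<close>
        equates that with b^2 \<nu>^2.\<close>
      have t2: "t\<^sup>2 / b * (K * b powr (- \<delta>)) = K * b powr (- 2 * \<tau>)"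
      proof -
        have "t\<^sup>2 / b * b powr (- \<delta>) = b powr (2 * ((1 + \<delta>) / r) - 1 - \<delta>)"
          using b_pos by (simp add: t_def powr_power powr_diff powr_minus divide_inverse mult_ac)
        also have "2 * ((1 + \<delta>) / r) - 1 - \<delta> = - 2 * \<tau>" using r by (simp add: \<tau>_def field_simps)
        finally have "t\<^sup>2 / b * b powr (- \<delta>) = b powr (- 2 * \<tau>)" .
        moreover have "t\<^sup>2 / b * (K * b powr (- \<delta>)) = K * (t\<^sup>2 / b * b powr (- \<delta>))" by simp
        ultimately show ?thesis by simp
      qed
      have tr: "t powr (2 - r) = b powr (- 2 * \<tau>)"
      proof -
        have "(1 + \<delta>) / r * (2 - r) = - 2 * \<tau>" using r by (simp add: \<tau>_def field_simps)
        then show ?thesis by (simp add: t_def powr_powr)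
      qed
      \<comment> \<open>Three regimes: a small modulus uses the perturbation inequality; a large
        modulus with |D| \<le> t uses 1 \<le> L / b; a large |D| uses the moment of order r.\<close>
      have pw: "AE w in M. (D w)\<^sup>2 \<le> b\<^sup>2 * (X w)\<^sup>2 + t\<^sup>2 / b * (L w * (if L w > b then 1 else 0)) + t powr (2 - r) * \<bar>D w\<bar> powr r"
        using D_le
      proof eventually_elim
        case (elim w)
        have nn: "0 \<le> b\<^sup>2 * (X w)\<^sup>2" "0 \<le> t\<^sup>2 / b * (L w * (if L w > b then 1 else 0))" "0 \<le> t powr (2 - r) * \<bar>D w\<bar> powr r"
          using b_pos L_nonneg by auto
        consider "L w \<le> b" | "L w > b" "\<bar>D w\<bar> \<le> t" | "\<bar>D w\<bar> > t" by linarith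
        then show ?case
        proof cases
          case 1
          have "\<bar>D w\<bar> \<le> b * X w" using elim 1 X_nonneg[of w] by (meson mult_right_mono order_trans)
          from power_mono[OF this, of 2] have "(D w)\<^sup>2 \<le> b\<^sup>2 * (X w)\<^sup>2" by (simp add: power_mult_distrib)
          then show ?thesis using nn by linarith
        next
          case 2
          have "(D w)\<^sup>2 \<le> t\<^sup>2" using power_mono[OF 2(2), of 2] by simp
          also have "\<dots> \<le> t\<^sup>2 / b * (L w * (if L w > b then 1 else 0))"
            using 2(1) b_pos t by (simp add: field_simps)
          finally show ?thesis using nn by linarith
        next
          case 3
          have D: "0 < \<bar>D w\<bar>" using 3 t by linarith
          have "(D w)\<^sup>2 = \<bar>D w\<bar> powr (2 - r) * \<bar>D w\<bar> powr r"
            using D by (simp add: powr_add[symmetric])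
          also have "\<dots> \<le> t powr (2 - r) * \<bar>D w\<bar> powr r"
            using 3 t r by (intro mult_right_mono powr_mono2') auto
          finally show ?thesis using nn by linarith
        qed
      qed
      have "(\<integral>\<^sup>+ w. ennreal ((D w)\<^sup>2) \<partial>M) \<le> (\<integral>\<^sup>+ w. ennreal (b\<^sup>2) * ennreal ((X w)\<^sup>2) +
          ennreal (t\<^sup>2 / b) * ennreal (L w * (if L w > b then 1 else 0)) + ennreal (t powr (2 - r)) * ennreal (\<bar>D w\<bar> powr r) \<partial>M)"
      proof (rule nn_integral_mono_AE)
        show "AE w in M. ennreal ((D w)\<^sup>2) \<le> ennreal (b\<^sup>2) * ennreal ((X w)\<^sup>2) +
          ennreal (t\<^sup>2 / b) * ennreal (L w * (if L w > b then 1 else 0)) + ennreal (t powr (2 - r)) * ennreal (\<bar>D w\<bar> powr r)"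
          using pw
        proof eventually_elim
          case (elim w)
          have nn: "0 \<le> b\<^sup>2 * (X w)\<^sup>2" "0 \<le> t\<^sup>2 / b * (L w * (if L w > b then 1 else 0))" "0 \<le> t powr (2 - r) * \<bar>D w\<bar> powr r"
            using b_pos L_nonneg by auto
          have "ennreal ((D w)\<^sup>2) \<le> ennreal (b\<^sup>2 * (X w)\<^sup>2 + t\<^sup>2 / b * (L w * (if L w > b then 1 else 0)) + t powr (2 - r) * \<bar>D w\<bar> powr r)"
            by (rule ennreal_leI[OF elim])
          also have "\<dots> = ennreal (b\<^sup>2 * (X w)\<^sup>2) + ennreal (t\<^sup>2 / b * (L w * (if L w > b then 1 else 0))) + ennreal (t powr (2 - r) * \<bar>D w\<bar> powr r)"
            using nn by (simp only: ennreal_plus add_nonneg_nonneg)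
          also have "\<dots> = ennreal (b\<^sup>2) * ennreal ((X w)\<^sup>2) +
              ennreal (t\<^sup>2 / b) * ennreal (L w * (if L w > b then 1 else 0)) + ennreal (t powr (2 - r)) * ennreal (\<bar>D w\<bar> powr r)"
            using b_pos by (subst (1 2 3) ennreal_mult') auto
          finally show ?case .
        qed
      qed
      also have "\<dots> = ennreal (b\<^sup>2) * (\<integral>\<^sup>+ w. ennreal ((X w)\<^sup>2) \<partial>M) +
          ennreal (t\<^sup>2 / b) * (\<integral>\<^sup>+ w. ennreal (L w * (if L w > b then 1 else 0)) \<partial>M) +
          ennreal (t powr (2 - r)) * (\<integral>\<^sup>+ w. ennreal (\<bar>D w\<bar> powr r) \<partial>M)"
        by (simp add: nn_integral_add nn_integral_cmult)
      also have "\<dots> \<le> ennreal (b\<^sup>2) * ennreal (\<nu>\<^sup>2) + ennreal (t\<^sup>2 / b) * ennreal (K * b powr (- \<delta>)) + ennreal (t powr (2 - r)) * ennreal A"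
        using X tail[OF True] moment by (intro add_mono mult_left_mono) (auto simp: L2_le_def)
      also have "\<dots> = ennreal (b\<^sup>2 * \<nu>\<^sup>2 + t\<^sup>2 / b * (K * b powr (- \<delta>)) + t powr (2 - r) * A)"
      proof -
        have nn: "0 \<le> b\<^sup>2" "0 \<le> \<nu>\<^sup>2" "0 \<le> t\<^sup>2 / b" "0 \<le> K * b powr (- \<delta>)" "0 \<le> t powr (2 - r)"
          using b_pos K by auto
        show ?thesis using nn A by (simp only: ennreal_plus ennreal_mult add_nonneg_nonneg mult_nonneg_nonneg)
      qed
      also have "b\<^sup>2 * \<nu>\<^sup>2 = (\<nu> powr \<beta>)\<^sup>2"
      proof -
        have "b * \<nu> = \<nu> powr (- 1 / (1 + \<tau>) + 1)" unfolding b_def powr_add using \<nu>_pos by simp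
        also have "- 1 / (1 + \<tau>) + 1 = \<beta>" using \<tau> by (simp add: \<beta>_def field_simps)
        finally show ?thesis by (simp add: power_mult_distrib[symmetric])
      qed
      also have "t\<^sup>2 / b * (K * b powr (- \<delta>)) = K * (\<nu> powr \<beta>)\<^sup>2" unfolding t2 b\<tau> ..
      also have "t powr (2 - r) * A = (\<nu> powr \<beta>)\<^sup>2 * A" unfolding tr b\<tau> ..
      also have "ennreal ((\<nu> powr \<beta>)\<^sup>2 + K * (\<nu> powr \<beta>)\<^sup>2 + (\<nu> powr \<beta>)\<^sup>2 * A) \<le> ennreal ((1 + K + A) * b0 powr (2 * \<tau>) * (\<nu> powr \<beta>)\<^sup>2)"
      proof (rule ennreal_leI)
        have "(1 + K + A) * (\<nu> powr \<beta>)\<^sup>2 * 1 \<le> (1 + K + A) * (\<nu> powr \<beta>)\<^sup>2 * b0 powr (2 * \<tau>)"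
          using b0_ge K A by (intro mult_left_mono) auto
        then show "(\<nu> powr \<beta>)\<^sup>2 + K * (\<nu> powr \<beta>)\<^sup>2 + (\<nu> powr \<beta>)\<^sup>2 * A \<le> (1 + K + A) * b0 powr (2 * \<tau>) * (\<nu> powr \<beta>)\<^sup>2"
          by (simp add: algebra_simps)
      qed
      finally show ?thesis .
    next
      case False
      have pw: "(D w)\<^sup>2 \<le> 1 + \<bar>D w\<bar> powr r" for w
      proof (cases "\<bar>D w\<bar> \<le> 1")
        case True
        then have "(D w)\<^sup>2 \<le> 1" by (simp add: abs_square_le_1)
        then show ?thesis by (smt (verit) powr_ge_zero)
      next
        case False
        then have "\<bar>D w\<bar> powr 2 \<le> \<bar>D w\<bar> powr r" using r by (intro powr_mono) auto
        then show ?thesis using False by simp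
      qed
      have "(\<integral>\<^sup>+ w. ennreal ((D w)\<^sup>2) \<partial>M) \<le> (\<integral>\<^sup>+ w. 1 + ennreal (\<bar>D w\<bar> powr r) \<partial>M)"
        using ennreal_leI[OF pw] by (intro nn_integral_mono) (simp add: ennreal_plus)
      also have "\<dots> \<le> 1 + ennreal A"
        using moment by (simp add: nn_integral_add emeasure_space_1)
      also have "\<dots> = ennreal (1 + A)" using A by (simp add: ennreal_plus)
      also have "\<dots> \<le> ennreal ((1 + K + A) * b0 powr (2 * \<tau>) * (\<nu> powr \<beta>)\<^sup>2)"
      proof (rule ennreal_leI)
        have "b0 powr (- 2 * \<tau>) \<le> (\<nu> powr \<beta>)\<^sup>2"
          unfolding b\<tau>[symmetric] using False b_pos \<tau> by (intro powr_mono2') auto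
        then have "b0 powr (2 * \<tau>) * b0 powr (- 2 * \<tau>) \<le> b0 powr (2 * \<tau>) * (\<nu> powr \<beta>)\<^sup>2"
          by (intro mult_left_mono) auto
        then have "1 \<le> b0 powr (2 * \<tau>) * (\<nu> powr \<beta>)\<^sup>2" using b0 by (simp add: powr_add[symmetric])
        from mult_mono[OF _ this, of "1 + A" "1 + K + A"] show "1 + A \<le> (1 + K + A) * b0 powr (2 * \<tau>) * (\<nu> powr \<beta>)\<^sup>2"
          using K A by (simp add: mult.assoc)
      qed
      finally show ?thesis .
    qed
    then show ?thesis
      using C by (auto simp: L2_le_def power_mult_distrib)
  qed
  then show ?thesis by (simp add: \<beta> C_def)
qed

end

section \<open>A uniform rate from either branch\<close>

lemma abs_diff_powr_le:
  fixes x y r :: real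
  assumes "0 < r"
  shows "\<bar>x - y\<bar> powr r \<le> 2 powr r * (\<bar>x\<bar> powr r + \<bar>y\<bar> powr r)"
proof -
  have "\<bar>x - y\<bar> powr r \<le> (2 * max \<bar>x\<bar> \<bar>y\<bar>) powr r"
    using assms by (intro powr_mono2) auto
  also have "\<dots> = 2 powr r * max \<bar>x\<bar> \<bar>y\<bar> powr r" by (simp add: powr_mult)
  also have "\<dots> \<le> 2 powr r * (\<bar>x\<bar> powr r + \<bar>y\<bar> powr r)"
    by (intro mult_left_mono) (auto simp: max_def)
  finally show ?thesis .
qed

context prob_space
begin

text \<open>In the Hoelder branch the constant is the given one. In the modulus branch
  \<open>modulus_L2_bound\<close> applies once the increments have r-th moments bounded uniformly
  over all held-fixed arguments, and most of the work is to obtain these from the listed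
  maxima.\<close>

lemma kernel_perturbation_L2:
  fixes W :: "nat \<Rightarrow> 'a \<Rightarrow> 'w::euclidean_space" and V :: "nat \<Rightarrow> nat \<Rightarrow> 'a \<Rightarrow> 'w"
    and Ws :: "nat \<Rightarrow> 'a \<Rightarrow> 'w" and Wsm :: "nat \<Rightarrow> nat \<Rightarrow> 'a \<Rightarrow> 'w"
  assumes copies: "independent_copies M W V Ws Wsm"
    and W_meas [measurable]: "\<And>i. 1 \<le> i \<Longrightarrow> W i \<in> borel_measurable M"
    and V_meas [measurable]: "\<And>i k. 1 \<le> i \<Longrightarrow> V i k \<in> borel_measurable M"
    and kernel: "case_prod \<phi> \<in> borel_measurable borel2"
    and sym: "\<And>x y. \<phi> x y = \<phi> y x"
    and ned: "\<And>i k. 1 \<le> i \<Longrightarrow> Lp_norm M 2 (\<lambda>w. W i w - V i k w) \<le> ennreal (\<nu> k)" "\<And>k. 0 \<le> \<nu> k"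
    and pert: "kernel_perturbation M \<phi> W V Ws Wsm \<nu> \<rho>"
  shows "\<exists>C\<ge>0. \<forall>i j k. 1 \<le> i \<longrightarrow> 1 \<le> j \<longrightarrow> i \<noteq> j \<longrightarrow> (\<forall>Z\<in>held_fixed W V Ws Wsm j k.
    L2_le M (\<lambda>w. \<phi> (W i w) (Z w) - \<phi> (V i k w) (Z w)) (C * \<rho> k))"
proof -
  note copies_meas [measurable] = copies_measurable[OF copies W_meas V_meas]
  have kernel_comp [measurable (raw)]: "(\<lambda>x. \<phi> (f x) (g x)) \<in> borel_measurable Q"
    if "f \<in> borel_measurable Q" "g \<in> borel_measurable Q" for f g and Q :: "'z measure"
    using measurable_compose[OF measurable_Pair[OF that] kernel] by simp
  have Z_meas: "Z \<in> borel_measurable M" if "1 \<le> j" "Z \<in> held_fixed W V Ws Wsm j k" for j k Z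
    using that copies_meas by (auto simp: held_fixed_def)
  have Z_D: "(\<lambda>w. \<phi> (W i w) (Z w) - \<phi> (V i k w) (Z w)) \<in> borel_measurable M"
    if "1 \<le> i" "1 \<le> j" "Z \<in> held_fixed W V Ws Wsm j k" for i j k Z
    using Z_meas[OF that(2,3)] that(1) by measurable
  from pert consider (A) \<alpha> where "expected_Hoelder M \<phi> W V Ws Wsm \<alpha>" "\<And>k. \<rho> k = \<nu> k powr \<alpha>"
    | (B) \<delta> r where "data_dependent_modulus M \<phi> W V Ws Wsm \<delta> r" "\<And>k. \<rho> k = \<nu> k powr modulus_exponent \<delta> r"
    unfolding kernel_perturbation_def by blast
  then show ?thesis
  proof cases
    case A
    then obtain C where \<alpha>: "0 < \<alpha>" and C: "0 \<le> C" and H: "\<And>i j k Z. 1 \<le> i \<Longrightarrow> 1 \<le> j \<Longrightarrow> Z \<in> held_fixed W V Ws Wsm j k \<Longrightarrow> i \<noteq> j \<Longrightarrow>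
      Lp_norm M 2 (\<lambda>w. \<phi> (W i w) (Z w) - \<phi> (V i k w) (Z w))
        \<le> ennreal (C * enn2real (Lp_norm M 2 (\<lambda>w. W i w - V i k w)) powr \<alpha>)"
      unfolding expected_Hoelder_def by blast
    have "L2_le M (\<lambda>w. \<phi> (W i w) (Z w) - \<phi> (V i k w) (Z w)) (C * \<rho> k)"
      if Z: "1 \<le> i" "1 \<le> j" "i \<noteq> j" "Z \<in> held_fixed W V Ws Wsm j k" for i j k Z
    proof -
      have "enn2real (Lp_norm M 2 (\<lambda>w. W i w - V i k w)) \<le> \<nu> k"
        using ned(1)[OF Z(1), of k] ned(2)[of k] by (simp add: enn2real_leI)
      then have "ennreal (C * enn2real (Lp_norm M 2 (\<lambda>w. W i w - V i k w)) powr \<alpha>) \<le> ennreal (C * \<rho> k)"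
        unfolding A(2) using C \<alpha> by (intro ennreal_leI mult_left_mono powr_mono2) auto
      with H[OF Z(1,2,4,3)] have "Lp_norm M 2 (\<lambda>w. \<phi> (W i w) (Z w) - \<phi> (V i k w) (Z w)) \<le> ennreal (C * \<rho> k)"
        by (rule order_trans)
      from Lp_norm_2_L2_le[OF Z_D[OF Z(1,2,4)] this]
      have "L2_le M (\<lambda>w. \<bar>\<phi> (W i w) (Z w) - \<phi> (V i k w) (Z w)\<bar>) (C * \<rho> k)"
        using C by (simp add: A(2))
      then show ?thesis by (rule L2_le_abs[OF _ Z_D[OF Z(1,2,4)]])
    qed
    then show ?thesis using C by blast
  next
    case B
    from B(1) have \<delta>: "0 < \<delta>" and r: "2 < r" by (auto simp: data_dependent_modulus_def)
    from B(1) obtain L :: "'w \<Rightarrow> 'w \<Rightarrow> 'w \<Rightarrow> real" and K b0 where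
      L_meas: "(\<lambda>(w, w', z). L w w' z) \<in> borel_measurable borel"
      and L_nonneg: "\<And>w w' z. 0 \<le> L w w' z"
      and L_le: "\<And>i j k Z. 1 \<le> i \<Longrightarrow> 1 \<le> j \<Longrightarrow> Z \<in> held_fixed W V Ws Wsm j k \<Longrightarrow> i \<noteq> j \<Longrightarrow>
        AE w in M. \<bar>\<phi> (W i w) (Z w) - \<phi> (V i k w) (Z w)\<bar>
            \<le> L (W i w) (V i k w) (Z w) * norm (W i w - V i k w)"
      and L_tail: "\<And>b i j k Z. b0 \<le> b \<Longrightarrow> 1 \<le> i \<Longrightarrow> 1 \<le> j \<Longrightarrow> Z \<in> held_fixed W V Ws Wsm j k \<Longrightarrow> i \<noteq> j \<Longrightarrow>
        (\<integral>\<^sup>+ w. ennreal (L (W i w) (V i k w) (Z w) * (if L (W i w) (V i k w) (Z w) > b then 1 else 0)) \<partial>M)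
          \<le> ennreal (K * b powr (- \<delta>))"
      unfolding data_dependent_modulus_def by (elim conjE exE) blast
    define S1 where "S1 = (SUP (i, j, m)\<in>{(i, j, m). 1 \<le> i \<and> 1 \<le> j \<and> i \<noteq> j}.
      Lp_norm M r (\<lambda>w. Max {\<bar>\<phi> (W i w) (W j w)\<bar>, \<bar>\<phi> (V i m w) (W j w)\<bar>, \<bar>\<phi> (V i m w) (V j m w)\<bar>}))"
    define S2 where "S2 = (SUP (i, j, m)\<in>{(i, j, m). 1 \<le> i \<and> 1 \<le> j \<and> i \<noteq> j}.
      Lp_norm M r (\<lambda>w. Max {\<bar>\<phi> (W i w) (Ws j w)\<bar>, \<bar>\<phi> (V i m w) (Ws j w)\<bar>, \<bar>\<phi> (V i m w) (Wsm j m w)\<bar>}))"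
    have S: "S1 < \<top>" "S2 < \<top>"
      using B(1) unfolding data_dependent_modulus_def S1_def S2_def by blast+
    define R where "R = max (enn2real S1 powr r) (enn2real S2 powr r)"
    have R: "0 \<le> R" by (simp add: R_def le_max_iff_disj)
    have mom: "(\<integral>\<^sup>+ w. ennreal (\<bar>X w\<bar> powr r) \<partial>M) \<le> ennreal R"
      if X: "\<And>w. \<bar>X w\<bar> \<le> Y w" and Y: "Lp_norm M r Y \<le> S1 \<or> Lp_norm M r Y \<le> S2" for X Y
    proof -
      have "(\<integral>\<^sup>+ w. ennreal (\<bar>X w\<bar> powr r) \<partial>M) \<le> (\<integral>\<^sup>+ w. ennreal (norm (Y w) powr r) \<partial>M)"
        using r X by (intro nn_integral_mono ennreal_leI powr_mono2) (auto intro: order_trans[OF X])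
      also have "\<dots> \<le> ennreal R"
        using Y
      proof
        assume "Lp_norm M r Y \<le> S1"
        then have "(\<integral>\<^sup>+ w. ennreal (norm (Y w) powr r) \<partial>M) \<le> ennreal (enn2real S1 powr r)"
          by (rule Lp_norm_bound[OF _ S(1)]) (use r in simp)
        also have "\<dots> \<le> ennreal R" by (rule ennreal_leI) (simp add: R_def)
        finally show ?thesis .
      next
        assume "Lp_norm M r Y \<le> S2"
        then have "(\<integral>\<^sup>+ w. ennreal (norm (Y w) powr r) \<partial>M) \<le> ennreal (enn2real S2 powr r)"
          by (rule Lp_norm_bound[OF _ S(2)]) (use r in simp)
        also have "\<dots> \<le> ennreal R" by (rule ennreal_leI) (simp add: R_def)
        finally show ?thesis .
      qed
      finally show ?thesis .
    qed
    have S1_le: "Lp_norm M r (\<lambda>w. Max {\<bar>\<phi> (W i w) (W j w)\<bar>, \<bar>\<phi> (V i k w) (W j w)\<bar>, \<bar>\<phi> (V i k w) (V j k w)\<bar>}) \<le> S1"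
      and S2_le: "Lp_norm M r (\<lambda>w. Max {\<bar>\<phi> (W i w) (Ws j w)\<bar>, \<bar>\<phi> (V i k w) (Ws j w)\<bar>, \<bar>\<phi> (V i k w) (Wsm j k w)\<bar>}) \<le> S2"
      if "1 \<le> i" "1 \<le> j" "i \<noteq> j" for i j k
      unfolding S1_def S2_def by (rule SUP_upper2[of "(i, j, k)"]; use that in simp)+
    have mom_Z: "(\<integral>\<^sup>+ w. ennreal (\<bar>\<phi> (W i w) (Z w)\<bar> powr r) \<partial>M) \<le> ennreal R"
        "(\<integral>\<^sup>+ w. ennreal (\<bar>\<phi> (V i k w) (Z w)\<bar> powr r) \<partial>M) \<le> ennreal R"
      if Z: "1 \<le> i" "1 \<le> j" "i \<noteq> j" "Z \<in> held_fixed W V Ws Wsm j k" for i j k Z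
    proof -
      note m1 = mom[OF _ disjI1[OF S1_le[OF Z(1-3), of k]]] and m1' = mom[OF _ disjI1[OF S1_le[OF Z(2,1), of k]]]
        and m2 = mom[OF _ disjI2[OF S2_le[OF Z(1-3), of k]]] and m2' = mom[OF _ disjI2[OF S2_le[OF Z(2,1), of k]]]
      \<comment> \<open>This combination is not among the listed ones. By symmetry it is the middle
        entry of the maximum for the exchanged pair of indices.\<close>
      have WV: "(\<integral>\<^sup>+ w. ennreal (\<bar>\<phi> (W i w) (V j k w)\<bar> powr r) \<partial>M) \<le> ennreal R"
        using m1'[of "\<lambda>w. \<phi> (W i w) (V j k w)"] Z(3) by (simp add: sym[of "W i _"])
      \<comment> \<open>No pointwise identity helps here, since the copy sits on the other index. On
        the product space the coordinates are exchanged, which yields the law of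
        \<open>V j k\<close> with \<open>Ws i\<close>, a listed combination.\<close>
      have WVs: "(\<integral>\<^sup>+ w. ennreal (\<bar>\<phi> (W i w) (Wsm j k w)\<bar> powr r) \<partial>M) \<le> ennreal R"
      proof -
        interpret P: pair_prob_space M M ..
        note [measurable] = W_meas[OF Z(1)] W_meas[OF Z(2)] V_meas[OF Z(1)] V_meas[OF Z(2)]
        have "(\<integral>\<^sup>+ w. ennreal (\<bar>\<phi> (W i w) (Wsm j k w)\<bar> powr r) \<partial>M) =
            (\<integral>\<^sup>+ z. ennreal (\<bar>\<phi> (W i (fst z)) (V j k (snd z))\<bar> powr r) \<partial>M2)"
          using copies_nn_integral[OF copies W_meas V_meas Z(1,2), of "\<lambda>p. ennreal (\<bar>\<phi> (fst (fst p)) (snd (snd p))\<bar> powr r)" k]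
          by simp
        also have "\<dots> = (\<integral>\<^sup>+ z. ennreal (\<bar>\<phi> (W i (fst z)) (V j k (snd z))\<bar> powr r) \<partial>distr M2 M2 (\<lambda>z. (snd z, fst z)))"
          by (simp add: distr_pair_swap_self)
        also have "\<dots> = (\<integral>\<^sup>+ z. ennreal (\<bar>\<phi> (V j k (fst z)) (W i (snd z))\<bar> powr r) \<partial>M2)"
          by (subst nn_integral_distr) (auto simp: sym[of "W i _"])
        also have "\<dots> = (\<integral>\<^sup>+ w. ennreal (\<bar>\<phi> (V j k w) (Ws i w)\<bar> powr r) \<partial>M)"
          using copies_nn_integral[OF copies W_meas V_meas Z(2,1), of "\<lambda>p. ennreal (\<bar>\<phi> (snd (fst p)) (fst (snd p))\<bar> powr r)" k]
          by simp
        also have "\<dots> \<le> ennreal R" using Z(3) by (intro m2') auto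
        finally show ?thesis .
      qed
      have W1: "(\<integral>\<^sup>+ w. ennreal (\<bar>\<phi> (W i w) (W j w)\<bar> powr r) \<partial>M) \<le> ennreal R" "(\<integral>\<^sup>+ w. ennreal (\<bar>\<phi> (V i k w) (W j w)\<bar> powr r) \<partial>M) \<le> ennreal R" "(\<integral>\<^sup>+ w. ennreal (\<bar>\<phi> (V i k w) (V j k w)\<bar> powr r) \<partial>M) \<le> ennreal R"
        by (rule m1, simp)+
      have W2: "(\<integral>\<^sup>+ w. ennreal (\<bar>\<phi> (W i w) (Ws j w)\<bar> powr r) \<partial>M) \<le> ennreal R" "(\<integral>\<^sup>+ w. ennreal (\<bar>\<phi> (V i k w) (Ws j w)\<bar> powr r) \<partial>M) \<le> ennreal R" "(\<integral>\<^sup>+ w. ennreal (\<bar>\<phi> (V i k w) (Wsm j k w)\<bar> powr r) \<partial>M) \<le> ennreal R"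
        by (rule m2, simp)+
      show "(\<integral>\<^sup>+ w. ennreal (\<bar>\<phi> (W i w) (Z w)\<bar> powr r) \<partial>M) \<le> ennreal R"
        using Z(4) WV WVs W1 W2 unfolding held_fixed_def by auto
      show "(\<integral>\<^sup>+ w. ennreal (\<bar>\<phi> (V i k w) (Z w)\<bar> powr r) \<partial>M) \<le> ennreal R"
        using Z(4) W1 W2 unfolding held_fixed_def by auto
    qed
    define A where "A = 2 powr r * (R + R)"
    \<comment> \<open>Nothing is known about the signs of \<open>K\<close> and \<open>b0\<close>, so
      \<bar>K\<bar> and this maximum are used instead.\<close>
    define b1 where "b1 = max 1 b0"
    define C where "C = sqrt ((1 + \<bar>K\<bar> + A) * b1 powr (2 * ((1 + \<delta>) * (r - 2) / (2 * r))))"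
    have A: "0 \<le> A" using R by (simp add: A_def)
    have "L2_le M (\<lambda>w. \<phi> (W i w) (Z w) - \<phi> (V i k w) (Z w)) (C * \<rho> k)"
      if Z: "1 \<le> i" "1 \<le> j" "i \<noteq> j" "Z \<in> held_fixed W V Ws Wsm j k" for i j k Z
      unfolding C_def B(2)
    proof (rule modulus_L2_bound[where L = "\<lambda>w. L (W i w) (V i k w) (Z w)" and X = "\<lambda>w. norm (W i w - V i k w)"])
      note [measurable] = W_meas[OF Z(1)] V_meas[OF Z(1)] Z_meas[OF Z(2,4)]
      show "(\<lambda>w. \<phi> (W i w) (Z w) - \<phi> (V i k w) (Z w)) \<in> borel_measurable M" by measurable
      have "(\<lambda>w. (W i w, V i k w, Z w)) \<in> measurable M (borel \<Otimes>\<^sub>M borel \<Otimes>\<^sub>M borel)" by measurable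
      then have "(\<lambda>w. (W i w, V i k w, Z w)) \<in> borel_measurable M" by (simp add: borel_prod)
      from measurable_compose[OF this L_meas] show "(\<lambda>w. L (W i w) (V i k w) (Z w)) \<in> borel_measurable M" by simp
      show "AE w in M. \<bar>\<phi> (W i w) (Z w) - \<phi> (V i k w) (Z w)\<bar> \<le> L (W i w) (V i k w) (Z w) * norm (W i w - V i k w)"
        by (rule L_le[OF Z(1,2,4,3)])
      show "L2_le M (\<lambda>w. norm (W i w - V i k w)) (\<nu> k)"
        by (rule Lp_norm_2_L2_le[OF _ ned(1)[OF Z(1)] ned(2)]) measurable
      show "(\<integral>\<^sup>+ w. ennreal (L (W i w) (V i k w) (Z w) * (if L (W i w) (V i k w) (Z w) > b then 1 else 0)) \<partial>M)
          \<le> ennreal (\<bar>K\<bar> * b powr (- \<delta>))" if "b1 \<le> b" for b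
        using that by (intro order_trans[OF L_tail[OF _ Z(1,2,4,3)]] ennreal_leI mult_right_mono) (auto simp: b1_def)
      have "(\<integral>\<^sup>+ w. ennreal (\<bar>\<phi> (W i w) (Z w) - \<phi> (V i k w) (Z w)\<bar> powr r) \<partial>M) \<le>
          (\<integral>\<^sup>+ w. ennreal (2 powr r) * (ennreal (\<bar>\<phi> (W i w) (Z w)\<bar> powr r) + ennreal (\<bar>\<phi> (V i k w) (Z w)\<bar> powr r)) \<partial>M)"
        using abs_diff_powr_le[of r] r by (intro nn_integral_mono) (simp flip: ennreal_plus ennreal_mult)
      also have "\<dots> = ennreal (2 powr r) * ((\<integral>\<^sup>+ w. ennreal (\<bar>\<phi> (W i w) (Z w)\<bar> powr r) \<partial>M) + (\<integral>\<^sup>+ w. ennreal (\<bar>\<phi> (V i k w) (Z w)\<bar> powr r) \<partial>M))"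
        by (simp add: nn_integral_cmult nn_integral_add)
      also have "\<dots> \<le> ennreal (2 powr r) * (ennreal R + ennreal R)"
        by (intro mult_left_mono add_mono mom_Z[OF Z]) auto
      also have "\<dots> = ennreal A" using R by (simp add: A_def flip: ennreal_plus ennreal_mult)
      finally show "(\<integral>\<^sup>+ w. ennreal (\<bar>\<phi> (W i w) (Z w) - \<phi> (V i k w) (Z w)\<bar> powr r) \<partial>M) \<le> ennreal A" .
    qed (use \<delta> r L_nonneg A in \<open>auto simp: b1_def\<close>)
    moreover have "0 \<le> C" using A by (simp add: C_def)
    ultimately show ?thesis by blast
  qed
qed

lemma kernel_unif_integrable_truncation:
  assumes V_meas: "\<And>i k. 1 \<le> i \<Longrightarrow> V i k \<in> borel_measurable M"
    and kernel: "case_prod \<phi> \<in> borel_measurable borel2"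
    and ui: "kernel_unif_integrable M \<phi> W V r" and r: "2 \<le> r" and e: "0 < e"
  shows "\<exists>T\<ge>0. \<forall>i j k. 1 \<le> i \<longrightarrow> 1 \<le> j \<longrightarrow>
    L2_le M (\<lambda>w. \<phi> (V i k w) (V j k w) - clamp T (\<phi> (V i k w) (V j k w))) e"
proof -
  define I where "I b m = (\<lambda>(i, j). \<integral>\<^sup>+ w. ennreal (\<bar>\<phi> (V i m w) (V j m w)\<bar> powr r
          * (if \<bar>\<phi> (V i m w) (V j m w)\<bar> > b then 1 else 0)) \<partial>M)" for b :: real and m
  have "((\<lambda>b. SUP m. SUP p\<in>{1..} \<times> {1..}. I b m p) \<longlongrightarrow> 0) at_top"
    using ui unfolding kernel_unif_integrable_def I_def by blast
  from order_tendstoD(2)[OF this, of "ennreal (e\<^sup>2)"] e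
  \<comment> \<open>A level of at least 1 makes x^2 at most |x| to the power r on the tail, so the
    tail integral dominates the squared truncation error.\<close>
  have "\<forall>\<^sub>F b in at_top. (SUP m. SUP p\<in>{1..} \<times> {1..}. I b m p) < ennreal (e\<^sup>2) \<and> 1 \<le> b"
    using eventually_ge_at_top[of "1::real"] by (intro eventually_conj) auto
  then obtain T where T: "(SUP m. SUP p\<in>{1..} \<times> {1..}. I T m p) < ennreal (e\<^sup>2)" "1 \<le> T"
    by (metis (mono_tags, lifting) eventually_at_top_linorder order_refl)
  have "L2_le M (\<lambda>w. \<phi> (V i k w) (V j k w) - clamp T (\<phi> (V i k w) (V j k w))) e" if ij: "1 \<le> i" "1 \<le> j" for i j k
  proof -
    define X where "X w = \<phi> (V i k w) (V j k w)" for w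
    have [measurable]: "X \<in> borel_measurable M"
      using measurable_compose[OF measurable_Pair[OF V_meas[OF ij(1), of k] V_meas[OF ij(2), of k]] kernel]
      by (simp add: X_def[abs_def])
    have pw: "(X w - clamp T (X w))\<^sup>2 \<le> \<bar>X w\<bar> powr r * (if \<bar>X w\<bar> > T then 1 else 0)" for w
    proof (cases "\<bar>X w\<bar> > T")
      case True
      have "(X w - clamp T (X w))\<^sup>2 \<le> (X w)\<^sup>2"
        using abs_diff_clamp_le[of T "X w"] T(2) True by (simp add: abs_le_square_iff)
      also have "\<dots> = \<bar>X w\<bar> powr 2" by simp
      also have "\<dots> \<le> \<bar>X w\<bar> powr r" using True T(2) r by (intro powr_mono) auto
      finally show ?thesis using True by simp
    next
      case False
      then show ?thesis using abs_diff_clamp_le[of T "X w"] T(2) by simp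
    qed
    have "(\<integral>\<^sup>+ w. ennreal ((X w - clamp T (X w))\<^sup>2) \<partial>M) \<le> I T k (i, j)"
      unfolding I_def X_def[symmetric] prod.case by (intro nn_integral_mono ennreal_leI pw)
    also have "\<dots> \<le> (SUP p\<in>{1..} \<times> {1..}. I T k p)" by (rule SUP_upper) (use ij in auto)
    also have "\<dots> \<le> (SUP m. SUP p\<in>{1..} \<times> {1..}. I T m p)" by (rule SUP_upper) auto
    finally show ?thesis using T e unfolding X_def[symmetric] by (auto simp: L2_le_def)
  qed
  then show ?thesis using T(2) by (intro exI[of _ T]) auto
qed

end

text \<open>The shift to \<open>Suc k\<close> avoids the value 0 of
  \<open>real k powr (- \<eta>)\<close> at k = 0 and gives a positive majorant. The finitely many
  indices before the asymptotic bound holds are absorbed by a sum in the constant.\<close>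

lemma bigo_powr_bound:
  fixes \<rho> :: "nat \<Rightarrow> real"
  assumes rate: "\<rho> \<in> O(\<lambda>k. real k powr (- \<eta>))" and \<eta>: "0 < \<eta>"
  obtains R where "0 < R" "\<And>k. \<rho> k \<le> R * real (Suc k) powr (- \<eta>)"
proof -
  obtain c where c: "0 < c" "\<forall>\<^sub>F k in sequentially. norm (\<rho> k) \<le> c * norm (real k powr (- \<eta>))"
    using landau_o.bigE[OF rate] by auto
  obtain k0 where k0: "\<And>k. k0 \<le> k \<Longrightarrow> norm (\<rho> k) \<le> c * norm (real k powr (- \<eta>))"
    using c(2) by (auto simp: eventually_sequentially)
  define R where "R = c * 2 powr \<eta> + (\<Sum>k\<le>k0. \<bar>\<rho> k\<bar> * real (Suc k) powr \<eta>)"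
  have sum_nonneg: "0 \<le> (\<Sum>k\<le>k0. \<bar>\<rho> k\<bar> * real (Suc k) powr \<eta>)" by (intro sum_nonneg) auto
  show ?thesis
  proof
    have "0 < c * 2 powr \<eta>" using c by simp
    then show "0 < R" using sum_nonneg by (simp add: R_def)
    fix k
    have p: "0 < real (Suc k) powr (- \<eta>)" by simp
    have "\<rho> k * real (Suc k) powr \<eta> \<le> R"
    proof (cases "k \<le> k0")
      case True
      have "\<rho> k * real (Suc k) powr \<eta> \<le> \<bar>\<rho> k\<bar> * real (Suc k) powr \<eta>" by (intro mult_right_mono) auto
      also have "\<dots> \<le> (\<Sum>k\<le>k0. \<bar>\<rho> k\<bar> * real (Suc k) powr \<eta>)"
        by (rule member_le_sum) (use True in auto)
      also have "\<dots> \<le> R" using c by (simp add: R_def)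
      finally show ?thesis .
    next
      case False
      then have k: "1 \<le> k" "k0 \<le> k" by auto
      \<comment> \<open>For k \<ge> 1 one has k + 1 \<le> 2 k; this is where the factor
        \<open>2 powr \<eta>\<close> in \<open>R\<close> comes from.\<close>
      have "\<rho> k * real (Suc k) powr \<eta> \<le> c * real k powr (- \<eta>) * (2 * real k) powr \<eta>"
        using k0[OF k(2)] c k(1) \<eta> by (intro mult_mono powr_mono2) auto
      also have "\<dots> = c * 2 powr \<eta> * (real k powr (- \<eta>) * real k powr \<eta>)"
        by (simp add: powr_mult)
      also have "real k powr (- \<eta>) * real k powr \<eta> = 1" using k(1) by (simp add: powr_add[symmetric])
      finally show ?thesis using sum_nonneg by (simp add: R_def)
    qed
    from mult_right_mono[OF this, of "real (Suc k) powr (- \<eta>)"]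
    show "\<rho> k \<le> R * real (Suc k) powr (- \<eta>)"
      by (simp add: mult.assoc powr_add[symmetric])
  qed
qed

section \<open>The three conclusions\<close>

theorem theorem3:
  fixes M :: "'a measure"
    and N :: "'e measure"
    and \<E> :: "int \<Rightarrow> 'a \<Rightarrow> 'e"
    and W :: "nat \<Rightarrow> 'a \<Rightarrow> 'w::euclidean_space"
    and Ws :: "nat \<Rightarrow> 'a \<Rightarrow> 'w"
    and Wsm :: "nat \<Rightarrow> nat \<Rightarrow> 'a \<Rightarrow> 'w"
    and \<phi> :: "'w \<Rightarrow> 'w \<Rightarrow> real"
    and \<nu> \<rho> \<sigma> :: "nat \<Rightarrow> real"
    and r \<eta> :: real
    and m :: "nat \<Rightarrow> nat"
  assumes "prob_space M"
    and base: "iid_base M N \<E>"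
    and ned: "uniformly_L2_NED M N \<E> W \<nu>"
    and copies: "independent_copies M W (ned_approx M N \<E> W) Ws Wsm"
    and kernel_measurable: "(\<lambda>(w1, w2). \<phi> w1 w2) \<in> borel_measurable borel"
    and kernel_sym: "\<And>w1 w2. \<phi> w1 w2 = \<phi> w2 w1"
    and centred: "centred_indep_copy M \<phi> W Ws"
    and proj_centred: "\<And>n i. 2 \<le> n \<Longrightarrow> i \<in> {1..n} \<Longrightarrow>
      prob_space.expectation M (\<lambda>\<omega>. first_proj M \<phi> Ws n i (W i \<omega>)) = 0"
    and sigma_nonneg: "\<And>n. 2 \<le> n \<Longrightarrow> 0 \<le> \<sigma> n"
    and sigma_sq: "\<And>n. 2 \<le> n \<Longrightarrow> (\<sigma> n)\<^sup>2 =
      prob_space.variance M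
        (\<lambda>\<omega>. real n powr (- 1 / 2) * (\<Sum>i\<in>{1..n}. first_proj M \<phi> Ws n i (W i \<omega>)))"
    and perturbation: "kernel_perturbation M \<phi> W (ned_approx M N \<E> W) Ws Wsm \<nu> \<rho>"
    and "2 \<le> r"
    and unif_integrable: "kernel_unif_integrable M \<phi> W (ned_approx M N \<E> W) r"
    and "1 < \<eta>"
    and rate: "\<rho> \<in> O(\<lambda>k. real k powr (- \<eta>))"
    and m_at_top: "filterlim m at_top sequentially"
    and m_small: "(\<lambda>n. real (m n)) \<in> o(\<lambda>n. sqrt (real n))"
    and m_rate: "(\<lambda>n. sqrt (real n) * \<rho> (m n)) \<in> o(\<lambda>_. 1)"
  shows
    "op_little M
        (\<lambda>n \<omega>. U_stat \<phi> W n \<omega> - 2 / real n * (\<Sum>i\<in>{1..n}. first_proj M \<phi> Ws n i (W i \<omega>)))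
        (\<lambda>n. real n powr (- 1 / 2)) \<and>
     (op_big M (U_stat \<phi> W) (\<lambda>n. real n powr (- 1 / 2)) \<and>
      op_little M (U_stat \<phi> W) (\<lambda>_. 1)) \<and>
     ((\<exists>r'>2. kernel_unif_integrable M \<phi> W (ned_approx M N \<E> W) r') \<and>
      (\<exists>l>0. \<forall>n\<ge>2. l \<le> \<sigma> n) \<longrightarrow>
      weak_conv_m
        (\<lambda>n. distr M borel (\<lambda>\<omega>. inverse (2 * \<sigma> n) * sqrt (real n) * U_stat \<phi> W n \<omega>))
        std_normal_distribution)"
proof -
  interpret prob_space M by (rule \<open>prob_space M\<close>)
  define V where "V = ned_approx M N \<E> W"
  have W_meas: "W i \<in> borel_measurable M" if "1 \<le> i" for i
    using ned that unfolding uniformly_L2_NED_def by (auto intro: borel_measurable_integrable)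
  have V_window: "V i k \<in> borel_measurable (base_algebra M N \<E> (window i k))" for i k
    unfolding V_def ned_approx_def base_sigma_eq window_def by (rule vec_cond_exp_measurable)
  have indep: "indep_vars (\<lambda>_. N) \<E> UNIV" using base by (simp add: iid_base_def)
  have V_meas: "V i k \<in> borel_measurable M" for i k
    by (rule measurable_from_base_algebra[OF indep V_window])
  have kernel: "case_prod \<phi> \<in> borel_measurable borel2"
    using kernel_measurable by (simp add: borel_prod)
  note copies' = copies[folded V_def]
  have cm: "Ws j \<in> borel_measurable M" "Wsm j k \<in> borel_measurable M" if "1 \<le> j" for j k
    by (rule copies_measurable[OF copies' _ _ that]; use W_meas V_meas in auto)+
  have kernel_comp [measurable (raw)]: "(\<lambda>x. \<phi> (f x) (g x)) \<in> borel_measurable Q"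
    if "f \<in> borel_measurable Q" "g \<in> borel_measurable Q" for f g and Q :: "'z measure"
    using measurable_compose[OF measurable_Pair[OF that] kernel] by simp
  have \<nu>: "0 \<le> \<nu> k" "1 \<le> i \<Longrightarrow> Lp_norm M 2 (\<lambda>w. W i w - V i k w) \<le> ennreal (\<nu> k)" for i k
    using ned unfolding uniformly_L2_NED_def V_def by auto
  obtain C where C: "0 \<le> C" and pert: "\<And>i j k Z. 1 \<le> i \<Longrightarrow> 1 \<le> j \<Longrightarrow> i \<noteq> j \<Longrightarrow> Z \<in> held_fixed W V Ws Wsm j k \<Longrightarrow>
      L2_le M (\<lambda>w. \<phi> (W i w) (Z w) - \<phi> (V i k w) (Z w)) (C * \<rho> k)"
    using kernel_perturbation_L2[OF copies' W_meas V_meas kernel kernel_sym \<nu>(2,1) perturbation[folded V_def]] by blast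
  have \<rho>_nonneg: "0 \<le> \<rho> k" for k
    using perturbation by (auto simp: kernel_perturbation_def)
  obtain R where R: "0 < R" and \<rho>_le: "\<And>k. \<rho> k \<le> R * real (Suc k) powr (- \<eta>)"
    using bigo_powr_bound[OF rate] \<open>1 < \<eta>\<close> by auto
  define a where "a k = C * \<rho> k" for k
  \<comment> \<open>\<open>C + 1\<close> instead of \<open>C\<close>, so that the majorant is
    strictly positive even when \<open>C\<close> is 0.\<close>
  define C1 where "C1 = (C + 1) * R"
  define c where "c k = C1 * real (Suc k) powr (- \<eta>)" for k
  have C1: "0 < C1" using C R by (simp add: C1_def)
  have trunc: "\<exists>T\<ge>0. \<forall>i j k. 1 \<le> i \<longrightarrow> 1 \<le> j \<longrightarrow>
      L2_le M (\<lambda>w. \<phi> (V i k w) (V j k w) - clamp T (\<phi> (V i k w) (V j k w))) e" if "0 < e" for e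
    by (rule kernel_unif_integrable_truncation[OF V_meas kernel unif_integrable[folded V_def] \<open>2 \<le> r\<close> that])
  \<comment> \<open>Truncation with error 1 yields the uniform moment bound: the clamped part is at
    most \<open>T\<close>, hence the norm at most \<open>1 + T\<close>.\<close>
  obtain T where T: "0 \<le> T" "\<And>i j k. 1 \<le> i \<Longrightarrow> 1 \<le> j \<Longrightarrow>
      L2_le M (\<lambda>w. \<phi> (V i k w) (V j k w) - clamp T (\<phi> (V i k w) (V j k w))) 1"
    using trunc[of 1] by auto
  interpret K: ned_kernel_rate M N \<E> W V \<phi> a "1 + T" c C1
  proof (unfold_locales)
    fix i j k :: nat assume ij: "1 \<le> i" "1 \<le> j" "i \<noteq> j"
    note [measurable] = W_meas[OF ij(1)] W_meas[OF ij(2)] V_meas cm[OF ij(2)]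
    show "L2_le M (\<lambda>w. \<phi> (W i w) (W j w) - \<phi> (V i k w) (W j w)) (a k)"
      "L2_le M (\<lambda>w. \<phi> (W i w) (V j k w) - \<phi> (V i k w) (V j k w)) (a k)"
      unfolding a_def by (rule pert[OF ij]; simp add: held_fixed_def)+
    have "L2_le M (\<lambda>w. \<phi> (W i w) (Ws j w) - \<phi> (V i k w) (Ws j w)) (a k)"
      "L2_le M (\<lambda>w. \<phi> (W i w) (Wsm j k w) - \<phi> (V i k w) (Wsm j k w)) (a k)"
      unfolding a_def by (rule pert[OF ij]; simp add: held_fixed_def)+
    then show "L2_le M2 (\<lambda>z. \<phi> (W i (fst z)) (W j (snd z)) - \<phi> (V i k (fst z)) (W j (snd z))) (a k)"
      "L2_le M2 (\<lambda>z. \<phi> (W i (fst z)) (V j k (snd z)) - \<phi> (V i k (fst z)) (V j k (snd z))) (a k)"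
      using copies_L2_le[OF copies' W_meas V_meas ij(1,2),
          of "\<lambda>p. \<phi> (fst (fst p)) (fst (snd p)) - \<phi> (snd (fst p)) (fst (snd p))" k "a k"]
        copies_L2_le[OF copies' W_meas V_meas ij(1,2),
          of "\<lambda>p. \<phi> (fst (fst p)) (snd (snd p)) - \<phi> (snd (fst p)) (snd (snd p))" k "a k"]
      by simp_all
    have "L2_le M (\<lambda>w. clamp T (\<phi> (V i k w) (V j k w))) T"
      by (rule L2_le_bounded) (use abs_clamp_le T in auto)
    from L2_le_add[OF T(2)[OF ij(1,2), of k] this] show "L2_le M (\<lambda>w. \<phi> (V i k w) (V j k w)) (1 + T)" by simp
    have "(\<integral>w. \<phi> (W i w) (Ws j w) \<partial>M) = 0" using centred ij by (simp add: centred_indep_copy_def)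
    then show "(\<integral>z. \<phi> (W i (fst z)) (W j (snd z)) \<partial>M2) = 0"
      using copies_integral[OF copies' W_meas V_meas ij(1,2), of "\<lambda>p. \<phi> (fst (fst p)) (fst (snd p))" k] by simp
  next
    show "a k \<le> c k" for k
    proof -
      have "a k \<le> (C + 1) * \<rho> k" unfolding a_def using \<rho>_nonneg[of k] by (intro mult_right_mono) auto
      also have "\<dots> \<le> (C + 1) * (R * real (Suc k) powr (- \<eta>))" using C by (intro mult_left_mono \<rho>_le) auto
      finally show ?thesis by (simp add: c_def C1_def mult.assoc)
    qed
    show "0 < c k" for k using C1 by (simp add: c_def)
    show "c l \<le> c k" if "k \<le> l" for k l
      unfolding c_def using C1 that \<open>1 < \<eta>\<close> by (intro mult_left_mono powr_mono2') auto
    have "summable (\<lambda>k. real (Suc k) powr (- \<eta>))"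
      by (subst summable_Suc_iff) (use \<open>1 < \<eta>\<close> in \<open>simp add: summable_real_powr_iff\<close>)
    then show "summable c" unfolding c_def by (rule summable_mult)
    show "real k * c k \<le> C1" for k
    proof -
      have "real k * real (Suc k) powr (- \<eta>) \<le> real (Suc k) * real (Suc k) powr (- \<eta>)"
        by (intro mult_right_mono) auto
      also have "\<dots> = real (Suc k) powr (1 - \<eta>)" by (simp add: powr_mult_base)
      also have "\<dots> \<le> real (Suc k) powr 0" using \<open>1 < \<eta>\<close> by (intro powr_mono) auto
      finally have "real k * real (Suc k) powr (- \<eta>) \<le> 1" by simp
      from mult_left_mono[OF this, of C1] show ?thesis using C1 by (simp add: c_def mult_ac)
    qed
    show "\<exists>T\<ge>0. \<forall>i j k. 1 \<le> i \<longrightarrow> 1 \<le> j \<longrightarrow> i \<noteq> j \<longrightarrow>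
      L2_le M (\<lambda>w. \<phi> (V i k w) (V j k w) - clamp T (\<phi> (V i k w) (V j k w))) e" if "0 < e" for e
      using trunc[OF that] by blast
  qed (use indep W_meas V_window kernel kernel_sym in auto)
  \<comment> \<open>The copy enters the first-order projection only through its law, so
    \<open>W j\<close> can be integrated out instead.\<close>
  have proj_eq: "first_proj M \<phi> Ws n i x = K.kproj n i x" for n i x
  proof -
    have "(\<integral>w. \<phi> x (Ws j w) \<partial>M) = proj M \<phi> (W j) x" if j: "1 \<le> j" for j
      unfolding proj_def by (rule copy_integral[OF copies' W_meas V_meas j]) auto
    then show ?thesis unfolding first_proj_def K.kproj_def by (intro arg_cong2[where f="(*)"] refl sum.cong) auto
  qed
  define G where "G = K.ksum"
  have G: "L2_le M (G n) (sqrt (real n) * K.CS)" if "2 \<le> n" for n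
    unfolding G_def by (rule K.kproj_sum_bound[OF that])
  have m_lim: "(\<lambda>n. real (m n) / sqrt (real n)) \<longlonglongrightarrow> 0"
    using m_small by (rule smalloD_tendsto)
  have "(\<lambda>n. sqrt (real n) * \<rho> (m n)) \<longlonglongrightarrow> 0"
    using smalloD_tendsto[OF m_rate] by simp
  from tendsto_mult_left[OF this, of C] have a_lim: "(\<lambda>n. sqrt (real n) * a (m n)) \<longlonglongrightarrow> 0"
    by (simp add: a_def mult_ac)
  have "\<exists>d. (\<forall>n\<ge>2. L2_le M (\<lambda>w. U_stat \<phi> W n w - 2 / real n * G n w) (d n)) \<and>
      (\<lambda>n. sqrt (real n) * d n) \<longlonglongrightarrow> 0"
    unfolding G_def by (rule K.U_stat_projection_rate[OF m_lim a_lim])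
  then obtain d where d_all: "\<forall>n\<ge>2. L2_le M (\<lambda>w. U_stat \<phi> W n w - 2 / real n * G n w) (d n)"
    and d_lim: "(\<lambda>n. sqrt (real n) * d n) \<longlonglongrightarrow> 0"
    by (elim exE conjE)
  have d: "L2_le M (\<lambda>w. U_stat \<phi> W n w - 2 / real n * G n w) (d n)" if "2 \<le> n" for n
    using d_all that by simp
  have powr_half: "real n powr (- 1 / 2) = 1 / sqrt (real n)" for n
    using powr_minus[of "real n" "1 / 2"] by (simp add: powr_half_sqrt inverse_eq_divide)
  have part_a: "op_little M (\<lambda>n w. U_stat \<phi> W n w - 2 / real n * G n w) (\<lambda>n. real n powr (- 1 / 2))"
    unfolding op_little_def
  proof (intro allI impI)
    fix \<epsilon> :: real assume \<epsilon>: "0 < \<epsilon>"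
    have "(\<lambda>n. (sqrt (real n) * d n / \<epsilon>)\<^sup>2) \<longlonglongrightarrow> (0 / \<epsilon>)\<^sup>2"
      by (intro tendsto_intros d_lim) (use \<epsilon> in simp)
    then have "(\<lambda>n. (sqrt (real n) * d n / \<epsilon>)\<^sup>2) \<longlonglongrightarrow> 0" by simp
    then show "(\<lambda>n. prob {w \<in> space M. \<bar>U_stat \<phi> W n w - 2 / real n * G n w\<bar> > \<epsilon> * real n powr (- 1 / 2)}) \<longlonglongrightarrow> 0"
    proof (rule Lim_null_comparison[rotated], intro eventually_sequentiallyI[of 2])
      fix n :: nat assume n: "2 \<le> n"
      have "0 < \<epsilon> * real n powr (- 1 / 2)" using \<epsilon> n by simp
      from prob_gt_le_L2[OF d[OF n] this]
      show "norm (prob {w \<in> space M. \<bar>U_stat \<phi> W n w - 2 / real n * G n w\<bar> > \<epsilon> * real n powr (- 1 / 2)}) \<le> (sqrt (real n) * d n / \<epsilon>)\<^sup>2"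
        unfolding powr_half by (simp add: mult.commute)
    qed
  qed
  \<comment> \<open>1 for the remainder, once \<open>sqrt (real n) * d n\<close> is below 1, and
    twice the constant of the projection sum.\<close>
  define H where "H = 1 + 2 * \<bar>K.CS\<bar>"
  have H: "0 < H" by (simp add: H_def)
  have "\<forall>\<^sub>F n in sequentially. sqrt (real n) * d n < 1"
    using order_tendstoD(2)[OF d_lim, of 1] by simp
  then have U: "\<forall>\<^sub>F n in sequentially. L2_le M (U_stat \<phi> W n) (H / sqrt (real n)) \<and> 2 \<le> n"
    using eventually_ge_at_top[of "2::nat"]
  proof eventually_elim
    case (elim n)
    have sn: "0 < sqrt (real n)" using elim by simp
    have "L2_le M (U_stat \<phi> W n) (d n + \<bar>2 / real n\<bar> * (sqrt (real n) * K.CS))"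
      using L2_le_add[OF d[OF elim(2)] L2_le_cmult[OF G[OF elim(2)], of "2 / real n"]] by simp
    moreover have "d n \<le> 1 / sqrt (real n)" using elim sn by (simp add: field_simps)
    moreover have "\<bar>2 / real n\<bar> * (sqrt (real n) * K.CS) = 2 * K.CS / sqrt (real n)"
    proof -
      have "\<bar>2 / real n\<bar> * (sqrt (real n) * K.CS) = 2 * K.CS * (sqrt (real n) / real n)" by simp
      also have "sqrt (real n) / real n = inverse (sqrt (real n))" by (rule sqrt_divide_self_eq) simp
      finally show ?thesis by (simp add: divide_inverse)
    qed
    moreover have "2 * K.CS / sqrt (real n) \<le> 2 * \<bar>K.CS\<bar> / sqrt (real n)"
      by (intro divide_right_mono) auto
    ultimately have "L2_le M (U_stat \<phi> W n) (H / sqrt (real n))"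
      by (elim L2_le_weaken) (simp add: H_def add_divide_distrib)
    then show ?case using elim(2) by simp
  qed
  have part_b1: "op_big M (U_stat \<phi> W) (\<lambda>n. real n powr (- 1 / 2))"
    unfolding op_big_def
  proof (intro allI impI)
    fix \<epsilon> :: real assume \<epsilon>: "0 < \<epsilon>"
    show "\<exists>K. \<forall>\<^sub>F n in sequentially. prob {w \<in> space M. \<bar>U_stat \<phi> W n w\<bar> > K * real n powr (- 1 / 2)} \<le> \<epsilon>"
    proof (intro exI eventually_mono[OF U])
      fix n assume n: "L2_le M (U_stat \<phi> W n) (H / sqrt (real n)) \<and> 2 \<le> n"
      \<comment> \<open>Chebyshev's inequality bounds the probability by the square of norm over
        threshold; this threshold makes the quotient exactly sqrt \<epsilon>.\<close>
      define u where "u = H / sqrt \<epsilon> * real n powr (- 1 / 2)"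
      have "0 < u" using H \<epsilon> n by (simp add: u_def)
      then have "prob {w \<in> space M. \<bar>U_stat \<phi> W n w\<bar> > u} \<le> (H / sqrt (real n) / u)\<^sup>2"
        using prob_gt_le_L2 n by blast
      also have "H / sqrt (real n) / u = sqrt \<epsilon>"
        unfolding u_def powr_half using H \<epsilon> n by simp
      finally show "prob {w \<in> space M. \<bar>U_stat \<phi> W n w\<bar> > H / sqrt \<epsilon> * real n powr (- 1 / 2)} \<le> \<epsilon>"
        using \<epsilon> by (simp add: u_def)
    qed
  qed
  have part_b2: "op_little M (U_stat \<phi> W) (\<lambda>_. 1)"
    unfolding op_little_def
  proof (intro allI impI)
    fix \<epsilon> :: real assume \<epsilon>: "0 < \<epsilon>"
    have "(\<lambda>n. (H / \<epsilon>)\<^sup>2 * (1 / real n)) \<longlonglongrightarrow> (H / \<epsilon>)\<^sup>2 * 0"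
      by (intro tendsto_intros lim_1_over_n)
    then have "(\<lambda>n. (H / \<epsilon>)\<^sup>2 * (1 / real n)) \<longlonglongrightarrow> 0" by simp
    then show "(\<lambda>n. prob {w \<in> space M. \<bar>U_stat \<phi> W n w\<bar> > \<epsilon> * 1}) \<longlonglongrightarrow> 0"
    proof (rule Lim_null_comparison[rotated], intro eventually_mono[OF U])
      fix n assume n: "L2_le M (U_stat \<phi> W n) (H / sqrt (real n)) \<and> 2 \<le> n"
      then have "prob {w \<in> space M. \<bar>U_stat \<phi> W n w\<bar> > \<epsilon>} \<le> (H / sqrt (real n) / \<epsilon>)\<^sup>2"
        using prob_gt_le_L2 \<epsilon> by blast
      also have "\<dots> = (H / \<epsilon>)\<^sup>2 * (1 / real n)"
        by (simp add: power_divide power_mult_distrib)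
      finally show "norm (prob {w \<in> space M. \<bar>U_stat \<phi> W n w\<bar> > \<epsilon> * 1}) \<le> (H / \<epsilon>)\<^sup>2 * (1 / real n)"
        by simp
    qed
  qed
  have part_c: "weak_conv_m (\<lambda>n. distr M borel (\<lambda>w. inverse (2 * \<sigma> n) * sqrt (real n) * U_stat \<phi> W n w))
      std_normal_distribution" if l: "0 < l" "\<forall>n\<ge>2. l \<le> \<sigma> n" for l
  proof (rule K.U_stat_clt[OF l(1) _ _ m_lim a_lim])
    show "l \<le> \<sigma> n" if "2 \<le> n" for n using l that by simp
    fix n :: nat assume n: "2 \<le> n"
    have var: "(\<sigma> n)\<^sup>2 = variance (\<lambda>w. real n powr (- 1 / 2) * G n w)"
      using sigma_sq[OF n] unfolding proj_eq G_def K.ksum_def .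
    \<comment> \<open>Since the sum is centred, its variance is the second moment that
      \<open>U_stat_clt\<close> refers to.\<close>
    have "expectation (G n) = 0"
      unfolding G_def K.ksum_def[abs_def] using K.kproj_mean[OF n] L2_le_integrable(1)[OF K.kproj_W_bound[OF n]] by simp
    then have "(\<sigma> n)\<^sup>2 = expectation (\<lambda>w. (real n powr (- 1 / 2) * G n w)\<^sup>2)"
      using var by simp
    also have "\<dots> = 1 / real n * expectation (\<lambda>w. (G n w)\<^sup>2)"
      unfolding powr_half by (simp add: power_mult_distrib power_divide)
    finally show "real n * (\<sigma> n)\<^sup>2 = expectation (\<lambda>w. (K.ksum n w)\<^sup>2)"
      using n by (simp add: G_def)
  qed
  show ?thesis
    using part_a part_b1 part_b2 part_c unfolding proj_eq G_def K.ksum_def by blast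
qed

end
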